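(* Let $v$ be a continuous $\mathbb{R}$-action on a compact surface $S$. If $v$ is extended $R$-closed, then $v$ is extended pointwise almost periodic.
   Context: $S$ is a compact surface and $v$ is a continuous $\mathbb{R}$-action (flow) on $S$. For $x\in S$, $O(x)$, $O^+(x)$, $O^-(x)$ denote the orbit, positive orbit and negative orbit of $x$, and $\omega(x)$, $\alpha(x)$ its omega and alpha limit sets. Saddle: a singular point (fixed point) $x$ is a (topological) saddle if it has a neighborhood on which the flow is locally homeomorphic (by a homeomorphism carrying orbits to orbits and preserving their direction) to the flow on a neighborhood of a saddle of a $C^1$ $\mathbb{R}$-action. We say "$\omega(x)$ is a saddle" if $\omega(x)=\{p\}$ with $p$ a saddle, and then write $W^u(\omega(x))=W^u(p)$; similarly for $\alpha$ and $W^s$. Extended orbits: put $W^u(y)=\{z\in S\mid \alpha(z)=\{y\}\}$ and $W^s(y)=\{z\in S\mid \omega(z)=\{y\}\}$. Define $O^+_0(x)=O^+(x)$, $O^+_{i+1}(x)=O^+_i(x)\cup\bigcup\{W^u(\omega(x'))\mid x'\in O^+_i(x),\ \omega(x')\text{ is a saddle}\}$ for every ordinal $i$, and $O^+_\mu(x)=\bigcup_{\nu<\mu}O^+_\nu(x)$ for every limit ordinal $\mu$. The extended positive orbit is $O^+_{\mathrm{ex}}(x)=\bigcup_{\nu\text{ ordinal}}O^+_\nu(x)$. The extended negative orbit $O^-_{\mathrm{ex}}(x)$ is defined symmetrically, starting from $O^-(x)$ and using $W^s(\alpha(x'))$ when $\alpha(x')$ is a saddle. The extended orbit is $O_{\mathrm{ex}}(x)=O^+_{\mathrm{ex}}(x)\cup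 O^-_{\mathrm{ex}}(x)$. The action $v$ is extended $R$-closed if $R_{\mathrm{ex}}=\{(x,y)\in S\times S\mid y\in\overline{O_{\mathrm{ex}}(x)}\}$ is closed in $S\times S$. The action $v$ is extended pointwise almost periodic (extended p.a.p.) if the set $\{\overline{O_{\mathrm{ex}}(x)}\mid x\in S\}$ of closures of extended orbits is a decomposition of $S$, i.e. any two of its members are equal or disjoint (they cover $S$). *)

theory Defs
  imports "HOL-Analysis.Analysis"
begin

section \<open>Compact surfaces and flows\<close>

text \<open>
  A surface is a whole Hausdorff type, possibly with boundary and possibly disconnected.
  Second countability follows from compactness.
\<close>

definition half_plane :: "(real^2) set" where
  "half_plane = {z. z $ 1 \<ge> 0}"

definition compact_surface :: "'a::t2_space itself \<Rightarrow> bool" where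
  "compact_surface _ \<longleftrightarrow>
     compact (UNIV :: 'a set) \<and>
     (\<forall>x::'a. \<exists>U W. open U \<and> x \<in> U \<and> openin (top_of_set half_plane) W \<and> U homeomorphic W)"

definition flow :: "(real \<Rightarrow> 'a \<Rightarrow> 'a::topological_space) \<Rightarrow> bool" where
  "flow v \<longleftrightarrow>
     continuous_on UNIV (\<lambda>(t, x). v t x) \<and>
     (\<forall>x. v 0 x = x) \<and> (\<forall>s t x. v (s + t) x = v s (v t x))"

definition pos_orbit :: "(real \<Rightarrow> 'a \<Rightarrow> 'a) \<Rightarrow> 'a \<Rightarrow> 'a set" where
  "pos_orbit v x = {v t x | t. t \<ge> 0}"

definition neg_orbit :: "(real \<Rightarrow> 'a \<Rightarrow> 'a) \<Rightarrow> 'a \<Rightarrow> 'a set" where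
  "neg_orbit v x = {v t x | t. t \<le> 0}"

definition omega_limit :: "(real \<Rightarrow> 'a \<Rightarrow> 'a::topological_space) \<Rightarrow> 'a \<Rightarrow> 'a set" where
  "omega_limit v x = (\<Inter>n::real. closure {v t x | t. t > n})"

definition alpha_limit :: "(real \<Rightarrow> 'a \<Rightarrow> 'a::topological_space) \<Rightarrow> 'a \<Rightarrow> 'a set" where
  "alpha_limit v x = (\<Inter>n::real. closure {v t x | t. t < n})"

definition unstable_set :: "(real \<Rightarrow> 'a \<Rightarrow> 'a::topological_space) \<Rightarrow> 'a \<Rightarrow> 'a set" where
  "unstable_set v y = {z. alpha_limit v z = {y}}"

definition stable_set :: "(real \<Rightarrow> 'a \<Rightarrow> 'a::topological_space) \<Rightarrow> 'a \<Rightarrow> 'a set" where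
  "stable_set v y = {z. omega_limit v z = {y}}"

section \<open>Topological saddles\<close>

text \<open>
  Every orbit arc of \<^term>\<open>v\<close> inside \<^term>\<open>U\<close> is mapped by \<^term>\<open>h\<close> onto an orbit arc of
  \<^term>\<open>w\<close>; the increasing time change \<^term>\<open>\<sigma>\<close> expresses that the direction is preserved.
\<close>

definition maps_orbit_arcs ::
  "('a \<Rightarrow> 'b) \<Rightarrow> (real \<Rightarrow> 'a \<Rightarrow> 'a) \<Rightarrow> 'a set \<Rightarrow> (real \<Rightarrow> 'b \<Rightarrow> 'b) \<Rightarrow> bool" where
  "maps_orbit_arcs h v U w \<longleftrightarrow>
     (\<forall>x t. t \<ge> 0 \<and> (\<forall>s\<in>{0..t}. v s x \<in> U) \<longrightarrow>
        (\<exists>\<sigma>::real \<Rightarrow> real. \<sigma> 0 = 0 \<and> continuous_on {0..t} \<sigma> \<and> strict_mono_on {0..t} \<sigma> \<and>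
             (\<forall>s\<in>{0..t}. h (v s x) = w (\<sigma> s) (h x))))"

definition locally_orbit_equivalent ::
  "(real \<Rightarrow> 'a \<Rightarrow> 'a::topological_space) \<Rightarrow> 'a \<Rightarrow>
   (real \<Rightarrow> 'b \<Rightarrow> 'b::topological_space) \<Rightarrow> 'b \<Rightarrow> bool" where
  "locally_orbit_equivalent v p w q \<longleftrightarrow>
     (\<exists>U V h k. open U \<and> p \<in> U \<and> open V \<and> q \<in> V \<and> homeomorphism U V h k \<and> h p = q \<and>
        maps_orbit_arcs h v U w \<and> maps_orbit_arcs k w V v)"

definition C1_flow :: "(real \<Rightarrow> 'b \<Rightarrow> 'b::real_normed_vector) \<Rightarrow> bool" where
  "C1_flow w \<longleftrightarrow> flow w \<and>
     (\<exists>D. continuous_on UNIV D \<and>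
        (\<forall>z. ((\<lambda>(t, x). w t x) has_derivative blinfun_apply (D z)) (at z)))"

text \<open>
  A saddle of a \<open>C\<^sup>1\<close> action is a fixed point at which the linearised action has one contracting
  and one expanding real eigendirection. Being a saddle is a local property, and a \<open>C\<^sup>1\<close> action
  near a fixed point of a surface can be moved to the plane by a chart and cut off by a time change;
  so the plane suffices as phase space of the model.
\<close>

definition C1_saddle :: "(real \<Rightarrow> real^2 \<Rightarrow> real^2) \<Rightarrow> real^2 \<Rightarrow> bool" where
  "C1_saddle w q \<longleftrightarrow> C1_flow w \<and> (\<forall>t. w t q = q) \<and>
     (\<exists>l m a b. l < 0 \<and> 0 < m \<and> a \<noteq> 0 \<and> b \<noteq> 0 \<and>
        (\<forall>t. frechet_derivative (w t) (at q) a = exp (l * t) *\<^sub>R a \<and>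
             frechet_derivative (w t) (at q) b = exp (m * t) *\<^sub>R b))"

definition saddle :: "(real \<Rightarrow> 'a \<Rightarrow> 'a::topological_space) \<Rightarrow> 'a \<Rightarrow> bool" where
  "saddle v p \<longleftrightarrow> (\<forall>t. v t p = p) \<and> (\<exists>w q. C1_saddle w q \<and> locally_orbit_equivalent v p w q)"

section \<open>Transfinite iteration\<close>

definition immediate_pred :: "'i rel \<Rightarrow> 'i \<Rightarrow> 'i \<Rightarrow> bool" where
  "immediate_pred r j i \<longleftrightarrow> (j, i) \<in> r - Id \<and> (\<nexists>k. (j, k) \<in> r - Id \<and> (k, i) \<in> r - Id)"

text \<open>
  The elements of a well-order \<^term>\<open>r\<close> play the role of the ordinals below its order type. The
  three clauses (zero, successor, limit) are restated as equations below.
\<close>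

definition ord_iterate :: "'i rel \<Rightarrow> ('a set \<Rightarrow> 'a set) \<Rightarrow> 'a set \<Rightarrow> 'i \<Rightarrow> 'a set" where
  "ord_iterate r F A = wfrec (r - Id) (\<lambda>f i.
     if \<forall>j. (j, i) \<notin> r - Id then A
     else if \<exists>j. immediate_pred r j i then F (f (THE j. immediate_pred r j i))
     else (\<Union>j\<in>{j. (j, i) \<in> r - Id}. f j))"

lemma immediate_pred_unique:
  assumes "Well_order r" "immediate_pred r j i" "immediate_pred r k i"
  shows "j = k"
proof (rule ccontr)
  assume "j \<noteq> k"
  moreover have "j \<in> Field r" "k \<in> Field r"
    using assms(2,3) by (auto simp: immediate_pred_def Field_def)
  moreover have "total_on (Field r) r"
    using assms(1) by (simp add: well_order_on_def linear_order_on_def)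
  ultimately have "(j, k) \<in> r - Id \<or> (k, j) \<in> r - Id"
    by (auto simp: total_on_def)
  then show False
    using assms(2,3) by (auto simp: immediate_pred_def)
qed

lemma ord_iterate_zero:
  assumes "Well_order r" "\<forall>j. (j, i) \<notin> r - Id"
  shows "ord_iterate r F A i = A"
proof -
  have "wf (r - Id)" using assms(1) by (simp add: well_order_on_def)
  then show ?thesis using assms(2) by (simp add: ord_iterate_def wfrec)
qed

lemma ord_iterate_succ:
  assumes "Well_order r" "immediate_pred r j i"
  shows "ord_iterate r F A i = F (ord_iterate r F A j)"
proof -
  have "wf (r - Id)" using assms(1) by (simp add: well_order_on_def)
  moreover have "(THE j. immediate_pred r j i) = j"
    using assms immediate_pred_unique by (intro the_equality) auto
  moreover have "(j, i) \<in> r - Id" using assms(2) by (simp add: immediate_pred_def)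
  ultimately show ?thesis using assms(2)
    by (subst ord_iterate_def, subst wfrec) (auto simp: ord_iterate_def cut_apply)
qed

lemma ord_iterate_limit:
  assumes "Well_order r" "(j0, i) \<in> r - Id" "\<nexists>j. immediate_pred r j i"
  shows "ord_iterate r F A i = (\<Union>j\<in>{j. (j, i) \<in> r - Id}. ord_iterate r F A j)"
proof -
  have "wf (r - Id)" using assms(1) by (simp add: well_order_on_def)
  then show ?thesis using assms(2,3)
    by (subst ord_iterate_def, subst wfrec) (auto simp: ord_iterate_def cut_apply)
qed

text \<open>
  The union over all ordinals. Well-orders on subsets of the power set suffice: an increasing
  sequence of subsets of \<^typ>\<open>'a\<close> is constant from some ordinal of cardinality at most that of
  \<^typ>\<open>'a\<close> on, and \<^typ>\<open>'a set\<close> carries longer well-orders.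
\<close>

definition ord_iterates_union :: "('a set \<Rightarrow> 'a set) \<Rightarrow> 'a set \<Rightarrow> 'a set" where
  "ord_iterates_union F A =
     (\<Union>r\<in>{r :: 'a set rel. Well_order r}. \<Union>i\<in>Field r. ord_iterate r F A i)"

section \<open>Extended orbits\<close>

definition pos_step :: "(real \<Rightarrow> 'a \<Rightarrow> 'a::topological_space) \<Rightarrow> 'a set \<Rightarrow> 'a set" where
  "pos_step v A =
     A \<union> \<Union>{unstable_set v p | p. saddle v p \<and> (\<exists>x'\<in>A. omega_limit v x' = {p})}"

definition neg_step :: "(real \<Rightarrow> 'a \<Rightarrow> 'a::topological_space) \<Rightarrow> 'a set \<Rightarrow> 'a set" where
  "neg_step v A =
     A \<union> \<Union>{stable_set v p | p. saddle v p \<and> (\<exists>x'\<in>A. alpha_limit v x' = {p})}"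

definition ext_pos_orbit :: "(real \<Rightarrow> 'a \<Rightarrow> 'a::topological_space) \<Rightarrow> 'a \<Rightarrow> 'a set" where
  "ext_pos_orbit v x = ord_iterates_union (pos_step v) (pos_orbit v x)"

definition ext_neg_orbit :: "(real \<Rightarrow> 'a \<Rightarrow> 'a::topological_space) \<Rightarrow> 'a \<Rightarrow> 'a set" where
  "ext_neg_orbit v x = ord_iterates_union (neg_step v) (neg_orbit v x)"

definition ext_orbit :: "(real \<Rightarrow> 'a \<Rightarrow> 'a::topological_space) \<Rightarrow> 'a \<Rightarrow> 'a set" where
  "ext_orbit v x = ext_pos_orbit v x \<union> ext_neg_orbit v x"

definition extended_R_closed :: "(real \<Rightarrow> 'a \<Rightarrow> 'a::topological_space) \<Rightarrow> bool" where
  "extended_R_closed v \<longleftrightarrow> closed {(x, y). y \<in> closure (ext_orbit v x)}"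

definition extended_pap :: "(real \<Rightarrow> 'a \<Rightarrow> 'a::topological_space) \<Rightarrow> bool" where
  "extended_pap v \<longleftrightarrow> partition_on UNIV {closure (ext_orbit v x) | x. True}"

end

theory Submission
  imports Defs
begin

text \<open>
  Call a point generic if neither of its limit sets is a saddle; its extended orbit is then its orbit.
  For an extended \<open>R\<close>-closed flow, \<open>y\<close> lies in the class \<open>C x\<close> (the closure of the extended orbit of
  \<open>x\<close>) if and only if \<open>x\<close> lies in \<open>C y\<close>, so classes of generic points that meet are equal. Let a
  saddle \<open>p\<close> be a limit set of \<open>z\<close>. If all orbits of the extended positive (or negative) orbit of
  \<open>p\<close> end in saddles, this extended orbit consists of finitely many saddles and connections
  between them, and counting separatrices shows that it is the class of each of its points.
  Otherwise both extended orbits of \<open>p\<close> contain orbits whose limit set is not a saddle. The crucial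
  point is that such a limit set contains a generic point, which makes \<open>C z\<close> the class of a generic
  point. If not, a minimal such limit set \<open>\<Lambda>\<close> consists of finitely many saddles and connections; an
  orbit accumulating on \<open>\<Lambda>\<close> passes along a cycle of corners, the passage map of this cycle tends to
  the cycle, and all orbits near one side of a connection \<open>e\<close> accumulate on \<open>e\<close>. By \<open>R\<close>-closedness
  these orbits lie in \<open>C e\<close>, which contains only finitely many nongeneric orbits, although a section
  meets uncountably many.
\<close>

section \<open>A topological normal form of saddles\<close>

text \<open>The flow is only continuous and its saddles are given only up to homeomorphism, so
  neither invariant manifolds nor return maps come with derivatives. Differentiability is used once,
  in the plane, to produce coordinates with monotone behaviour; afterwards only strict monotonicity
  survives. Transition maps between sections are therefore obtained from closed graphs over compact
  intervals, which give continuity, and from injectivity on an interval, which gives monotonicity;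
  the value 0 at 0 fixes the direction. Monotonicity is also what compares orbits: if one orbit
  returns ever closer to a cycle of connections, all orbits between it and the cycle do too. The
  surface may be nonorientable, so the side on which a section is hit belongs to the data: a corner
  is a saddle with two signs, and the sign on arrival at the next saddle is found by the transit.
  All notions are symmetric under reversal of time, and facts about alpha limits, unstable branches
  and exits are facts about \<open>v (- t)\<close> with the two coordinates exchanged.\<close>

definition square :: "real \<Rightarrow> 'a set \<Rightarrow> ('a \<Rightarrow> real \<times> real) \<Rightarrow> 'a set" where
  "square c U \<psi> = {z\<in>U. \<bar>fst (\<psi> z)\<bar> \<le> c \<and> \<bar>snd (\<psi> z)\<bar> \<le> c}"

text \<open>
  Only monotonicity of the coordinates is recorded, and only in a form that an orbit equivalence
  without derivatives transports. By the last two conditions the points staying in the square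
  for all positive (negative) times lie on a graph over the first (second) axis.
\<close>

definition saddle_box ::
  "(real \<Rightarrow> 'a \<Rightarrow> 'a::topological_space) \<Rightarrow> 'a \<Rightarrow> 'a set \<Rightarrow> ('a \<Rightarrow> real \<times> real) \<Rightarrow> bool" where
  "saddle_box v p U \<psi> \<longleftrightarrow>
     open U \<and> p \<in> U \<and> \<psi> p = (0, 0) \<and> (\<forall>t. v t p = p) \<and>
     (\<exists>V k. open V \<and> homeomorphism U V \<psi> k \<and> {-2..2} \<times> {-2..2} \<subseteq> V) \<and>
     (\<forall>z t. 0 < t \<and> (\<forall>s\<in>{0..t}. v s z \<in> square 2 U \<psi> \<and> 1/2 \<le> \<bar>fst (\<psi> (v s z))\<bar>) \<longrightarrow>
        \<bar>fst (\<psi> (v t z))\<bar> < \<bar>fst (\<psi> z)\<bar>) \<and>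
     (\<forall>z t. 0 < t \<and> (\<forall>s\<in>{0..t}. v s z \<in> square 2 U \<psi> \<and> 1/2 \<le> \<bar>snd (\<psi> (v s z))\<bar>) \<longrightarrow>
        \<bar>snd (\<psi> z)\<bar> < \<bar>snd (\<psi> (v t z))\<bar>) \<and>
     (\<forall>z z'. z \<noteq> z' \<and> (\<forall>t\<ge>0. v t z \<in> square 1 U \<psi> \<and> v t z' \<in> square 1 U \<psi>) \<longrightarrow>
        \<bar>snd (\<psi> z) - snd (\<psi> z')\<bar> < \<bar>fst (\<psi> z) - fst (\<psi> z')\<bar>) \<and>
     (\<forall>z z'. z \<noteq> z' \<and> (\<forall>t\<le>0. v t z \<in> square 1 U \<psi> \<and> v t z' \<in> square 1 U \<psi>) \<longrightarrow>
        \<bar>fst (\<psi> z) - fst (\<psi> z')\<bar> < \<bar>snd (\<psi> z) - snd (\<psi> z')\<bar>)"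

text \<open>With X and Y the differences of the coordinates of two orbits, this is the derivative of
  \<open>Y\<^sup>2 - X\<^sup>2\<close> along the pair. The linear part contributes at least
  \<open>2 * \<kappa>\<close> times the squared length and the errors take away at most
  \<open>4 * \<theta>\<close> times it; the factor 10 leaves ample room.\<close>

lemma cone_form_derivative:
  fixes X Y d1 d2 :: "real"
  assumes "\<kappa> > 0" "l \<le> -\<kappa>" "\<kappa> \<le> m" "10 * \<theta> \<le> \<kappa>"
    and "\<bar>d1\<bar> \<le> \<theta> * (\<bar>X\<bar> + \<bar>Y\<bar>)" "\<bar>d2\<bar> \<le> \<theta> * (\<bar>X\<bar> + \<bar>Y\<bar>)" "\<theta> \<ge> 0"
  shows "2 * Y * (m * Y + d2) - 2 * X * (l * X + d1) \<ge> \<kappa> * (X\<^sup>2 + Y\<^sup>2)"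
proof -
  define S where "S = X\<^sup>2 + Y\<^sup>2"
  have a: "\<bar>Y * d2\<bar> \<le> \<bar>Y\<bar> * (\<theta> * (\<bar>X\<bar> + \<bar>Y\<bar>))" "\<bar>X * d1\<bar> \<le> \<bar>X\<bar> * (\<theta> * (\<bar>X\<bar> + \<bar>Y\<bar>))"
    by (auto simp: abs_mult intro!: mult_left_mono assms)
  have b: "\<bar>X\<bar> * (\<theta> * (\<bar>X\<bar> + \<bar>Y\<bar>)) + \<bar>Y\<bar> * (\<theta> * (\<bar>X\<bar> + \<bar>Y\<bar>)) = \<theta> * (\<bar>X\<bar> + \<bar>Y\<bar>)\<^sup>2"
    by (simp add: power2_eq_square algebra_simps)
  have "(\<bar>X\<bar> + \<bar>Y\<bar>)\<^sup>2 \<le> 2 * S"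
    using sum_squares_bound[of "\<bar>X\<bar>" "\<bar>Y\<bar>"] by (simp add: power2_sum S_def)
  then have c: "\<theta> * (\<bar>X\<bar> + \<bar>Y\<bar>)\<^sup>2 \<le> \<theta> * (2 * S)"
    using assms(7) by (rule mult_left_mono)
  have d: "10 * \<theta> * S \<le> \<kappa> * S"
    using assms(4) by (rule mult_right_mono) (simp add: S_def)
  have e: "\<kappa> * Y\<^sup>2 \<le> m * Y\<^sup>2" "l * X\<^sup>2 \<le> -\<kappa> * X\<^sup>2"
    by (intro mult_right_mono assms; simp)+
  have "\<kappa> * S = \<kappa> * X\<^sup>2 + \<kappa> * Y\<^sup>2" "0 \<le> \<theta> * S" using assms(7) by (simp_all add: S_def algebra_simps)
  then have "\<kappa> * S \<le> 2 * (m * Y\<^sup>2) - 2 * (l * X\<^sup>2) + 2 * (Y * d2) - 2 * (X * d1)"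
    using a b c d e by linarith
  then show ?thesis by (simp add: algebra_simps power2_eq_square S_def)
qed

text \<open>The factor 4 is the ratio of 2 to 1/2: in rescaled coordinates the estimate is used
  where \<open>|X|\<close> is at least 1/2 and \<open>|Y|\<close> at most 2. The error is then at
  most half of the contraction. With the coordinates exchanged and signs reversed it also gives the
  expansion of Y.\<close>

lemma contracting_derivative:
  fixes X Y d1 :: "real"
  assumes "\<kappa> > 0" "l \<le> -\<kappa>" "10 * \<theta> \<le> \<kappa>" "\<bar>d1\<bar> \<le> \<theta> * (\<bar>X\<bar> + \<bar>Y\<bar>)" "\<theta> \<ge> 0"
    and "\<bar>Y\<bar> \<le> 4 * \<bar>X\<bar>" "X \<noteq> 0"
  shows "2 * X * (l * X + d1) < 0"
proof -
  have "\<bar>d1\<bar> \<le> \<theta> * (5 * \<bar>X\<bar>)"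
    using assms(4,5,6) by (smt (verit) mult_left_mono)
  then have "\<bar>X * d1\<bar> \<le> \<bar>X\<bar> * (\<theta> * (5 * \<bar>X\<bar>))"
    by (auto simp: abs_mult intro!: mult_left_mono)
  also have "\<dots> = 5 * \<theta> * X\<^sup>2" by (simp add: power2_eq_square)
  also have "\<dots> \<le> \<kappa> / 2 * X\<^sup>2" using assms(3) by (intro mult_right_mono) auto
  finally have "\<bar>X * d1\<bar> \<le> \<kappa> / 2 * X\<^sup>2" .
  moreover have "l * X\<^sup>2 \<le> -\<kappa> * X\<^sup>2" by (intro mult_right_mono assms) simp
  moreover have "\<kappa> * X\<^sup>2 > 0" using assms by simp
  ultimately show ?thesis by (simp add: algebra_simps power2_eq_square)
qed

section \<open>Averaged coordinates near a planar hyperbolic fixed point\<close>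

locale hyperbolic_planar_flow =
  fixes F :: "real \<Rightarrow> real \<times> real \<Rightarrow> real \<times> real" and l m :: real
  assumes flow_F: "flow F" and fix_F: "F t 0 = 0" and l_neg: "l < 0" and m_pos: "0 < m"
    and linearization: "\<epsilon> > 0 \<Longrightarrow> \<exists>\<rho>>0. \<forall>t\<in>{0..1}. \<forall>P P'. norm P \<le> \<rho> \<longrightarrow> norm P' \<le> \<rho> \<longrightarrow>
       \<bar>fst (F t P) - fst (F t P') - exp (l * t) * (fst P - fst P')\<bar> \<le> \<epsilon> * norm (P - P') \<and>
       \<bar>snd (F t P) - snd (F t P') - exp (m * t) * (snd P - snd P')\<bar> \<le> \<epsilon> * norm (P - P')"
begin

lemma F_add: "F s (F t P) = F (s + t) P"
  using flow_F unfolding flow_def by metis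

lemma F_0 [simp]: "F 0 P = P"
  using flow_F unfolding flow_def by metis

lemma continuous_on_F [continuous_intros]:
  "continuous_on A f \<Longrightarrow> continuous_on A g \<Longrightarrow> continuous_on A (\<lambda>s. F (f s) (g s))"
  using continuous_on_compose2[of UNIV "\<lambda>(t, x). F t x" A "\<lambda>s. (f s, g s)"] flow_F
  by (auto simp: flow_def intro: continuous_intros)

text \<open>
  Averaging along the flow turns a coordinate into one that is differentiable along orbits, with a
  derivative that is Lipschitz close to linear; the flow itself need not have a differentiable
  generator.
\<close>

definition avg :: "real \<Rightarrow> (real \<times> real \<Rightarrow> real) \<Rightarrow> real \<times> real \<Rightarrow> real" where
  "avg c \<pi> P = integral {0..1} (\<lambda>s. exp (- c * s) * \<pi> (F s P))"

text \<open>Substituting u = s + t turns \<open>avg c \<pi> (F t P)\<close> into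
  \<open>exp (c * t)\<close> times the integral of \<open>exp (- c * u) * \<pi> (F u P)\<close> over
  [t, t + 1]. Now t occurs only in the factor and in the limits of integration, so continuity of the
  flow suffices for differentiating.\<close>

lemma avg_has_derivative:
  assumes \<pi>: "continuous_on UNIV \<pi>"
  shows "((\<lambda>t. avg c \<pi> (F t P)) has_real_derivative
     c * avg c \<pi> (F t P) + (exp (- c) * \<pi> (F 1 (F t P)) - \<pi> (F t P))) (at t)"
proof -
  define h where "h u = exp (- c * u) * \<pi> (F u P)" for u
  \<comment> \<open>The interval contains [t', t' + 1] for every t' within distance 1 of t.\<close>
  have "continuous_on {t-1..t+2} h"
    unfolding h_def by (intro continuous_intros continuous_on_compose2[OF \<pi>]) auto
  then obtain A where A: "\<And>x. x \<in> {t-1..t+2} \<Longrightarrow> (A has_vector_derivative h x) (at x within {t-1..t+2})"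
    by (rule antiderivative_continuous) auto
  have eq: "avg c \<pi> (F t' P) = exp (c * t') * (A (t' + 1) - A t')" if t': "t' \<in> {t-1<..<t+1}" for t'
  proof -
    have "((\<lambda>s. h (s + t')) has_integral A (1 + t') - A (0 + t')) {0..1}"
    proof (rule fundamental_theorem_of_calculus)
      fix s :: real assume s: "s \<in> {0..1}"
      have "(A has_vector_derivative h (s + t')) (at (s + t') within (\<lambda>s. s + t') ` {0..1})"
        by (rule has_vector_derivative_within_subset[OF A]) (use s t' in auto)
      then have "((A \<circ> (\<lambda>s. s + t')) has_vector_derivative 1 *\<^sub>R h (s + t')) (at s within {0..1})"
        by (rule vector_diff_chain_within[rotated]) (auto intro!: derivative_eq_intros)
      then show "((\<lambda>s. A (s + t')) has_vector_derivative h (s + t')) (at s within {0..1})"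
        by (simp add: o_def)
    qed simp
    then have "((\<lambda>s. exp (c * t') * h (s + t')) has_integral exp (c * t') * (A (1 + t') - A (0 + t'))) {0..1}"
      by (rule has_integral_mult_right)
    moreover have "exp (c * t') * h (s + t') = exp (- c * s) * \<pi> (F s (F t' P))" for s
      by (simp add: h_def F_add algebra_simps flip: mult_exp_exp) (simp add: mult_exp_exp)
    ultimately show ?thesis unfolding avg_def by (simp add: integral_unique add.commute)
  qed
  have der: "(A has_real_derivative h x) (at x)" if "x \<in> {t-1<..<t+2}" for x
    using A[of x] that at_within_Icc_at[of "t-1" x "t+2"] by (simp add: has_real_derivative_iff_has_vector_derivative)
  have d1: "((\<lambda>x. A (x + 1)) has_real_derivative h (t + 1)) (at t)"
    using der[of "t+1"] by (simp add: DERIV_shift)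
  have "((\<lambda>t'. exp (c * t') * (A (t' + 1) - A t')) has_real_derivative
      exp (c * t) * c * (A (t + 1) - A t) + exp (c * t) * (h (t + 1) - h t)) (at t)"
    by (auto intro!: derivative_eq_intros d1 der)
  moreover have "exp (c * t) * c * (A (t + 1) - A t) + exp (c * t) * (h (t + 1) - h t) =
      c * avg c \<pi> (F t P) + (exp (- c) * \<pi> (F 1 (F t P)) - \<pi> (F t P))"
  proof -
    have "exp (c * t) * h (t + 1) = exp (- c) * \<pi> (F 1 (F t P))" "exp (c * t) * h t = \<pi> (F t P)"
      by (simp_all add: h_def F_add add.commute[of 1 t] distrib_left flip: mult.assoc exp_add)
    moreover have "avg c \<pi> (F t P) = exp (c * t) * (A (t + 1) - A t)" by (rule eq) auto
    ultimately show ?thesis by (simp add: right_diff_distrib)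
  qed
  ultimately have "((\<lambda>t'. exp (c * t') * (A (t' + 1) - A t')) has_real_derivative
      c * avg c \<pi> (F t P) + (exp (- c) * \<pi> (F 1 (F t P)) - \<pi> (F t P))) (at t)" by simp
  then show ?thesis
    by (rule DERIV_cong_ev[THEN iffD1, rotated 3])
      (auto intro!: eventually_nhds_in_open[of "{t-1<..<t+1}", THEN eventually_mono] simp: eq)
qed

text \<open>For a coordinate scaled exactly by \<open>exp (c * t)\<close> the weight
  \<open>exp (- c * s)\<close> makes the average equal to the coordinate. So only the deviation from
  this scaling is integrated, with a weight of at most \<open>exp \<bar>c\<bar>\<close> on
  [0, 1].\<close>

lemma avg_close:
  assumes \<pi>: "continuous_on UNIV \<pi>"
    and close: "\<And>t. t \<in> {0..1} \<Longrightarrow> \<bar>\<pi> (F t P) - \<pi> (F t P') - exp (c * t) * (\<pi> P - \<pi> P')\<bar> \<le> \<epsilon> * norm (P - P')"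
  shows "\<bar>avg c \<pi> P - avg c \<pi> P' - (\<pi> P - \<pi> P')\<bar> \<le> exp \<bar>c\<bar> * \<epsilon> * norm (P - P')"
proof -
  let ?h = "\<lambda>s. exp (- c * s) * (\<pi> (F s P) - \<pi> (F s P') - exp (c * s) * (\<pi> P - \<pi> P'))"
  have int: "(\<lambda>s. exp (- c * s) * \<pi> (F s P)) integrable_on {0..1}" for P
    by (intro integrable_continuous_real continuous_intros continuous_on_compose2[OF \<pi>]) auto
  have "((\<lambda>s. exp (- c * s) * \<pi> (F s P) - exp (- c * s) * \<pi> (F s P') - (\<pi> P - \<pi> P')) has_integral
      (avg c \<pi> P - avg c \<pi> P' - (\<pi> P - \<pi> P'))) {0..1}"
    unfolding avg_def by (intro has_integral_diff integrable_integral int has_integral_const_real[of _ 0 1, simplified])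
  moreover have "exp (- c * s) * \<pi> (F s P) - exp (- c * s) * \<pi> (F s P') - (\<pi> P - \<pi> P') = ?h s" for s
    by (simp add: algebra_simps exp_minus)
  ultimately have *: "(?h has_integral (avg c \<pi> P - avg c \<pi> P' - (\<pi> P - \<pi> P'))) (cbox 0 1)"
    by simp
  have "\<bar>?h s\<bar> \<le> exp \<bar>c\<bar> * (\<epsilon> * norm (P - P'))" if s: "s \<in> {0..1}" for s
  proof -
    have "- c * s \<le> \<bar>c\<bar> * 1"
      using abs_ge_self[of "- c * s"] mult_left_mono[of s 1 "\<bar>c\<bar>"] s by (simp add: abs_mult)
    then show ?thesis using close[OF s] by (auto simp: abs_mult intro!: mult_mono)
  qed
  moreover have "0 \<le> exp \<bar>c\<bar> * (\<epsilon> * norm (P - P'))" using close[of 0] by (auto intro!: mult_nonneg_nonneg order_trans[OF abs_ge_zero])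
  ultimately show ?thesis
    using has_integral_bound[OF _ *, of "exp \<bar>c\<bar> * (\<epsilon> * norm (P - P'))"] by (simp add: mult.assoc)
qed

end

text \<open>Linear growth is enough. Since f may start at 0, the estimate begins at time 1, when
  strict growth has made f positive and \<open>\<kappa> * f 1\<close> bounds the slope from
  below.\<close>

lemma unbounded_growth:
  fixes f f' :: "real \<Rightarrow> real"
  assumes "\<And>t. t \<ge> 0 \<Longrightarrow> (f has_real_derivative f' t) (at t)"
    and "\<And>t. t \<ge> 0 \<Longrightarrow> f' t > 0" "\<And>t. t \<ge> 0 \<Longrightarrow> f' t \<ge> \<kappa> * \<bar>f t\<bar>" "\<kappa> > 0" "f 0 \<ge> 0"
  shows "\<exists>t\<ge>0. f t > B"
proof -
  have incr: "f s < f t" if "0 \<le> s" "s < t" for s t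
    using DERIV_pos_imp_increasing[of s t f] assms(1,2) that by (meson order_trans)
  have pos: "f 1 > 0" using incr[of 0 1] assms(5) by simp
  have ge: "f t \<ge> f 1 + \<kappa> * f 1 * (t - 1)" if t: "t > 1" for t
  proof -
    obtain c where c: "c > 1" "c < t" "f t - f 1 = (t - 1) * f' c"
      using MVT2[of 1 t f f'] assms(1) t by fastforce
    have "f c > f 1" using incr[of 1 c] c by simp
    then have "\<kappa> * f 1 \<le> \<kappa> * \<bar>f c\<bar>" using pos assms(4) by simp
    then have "f' c \<ge> \<kappa> * f 1" using assms(3)[of c] c by simp
    then have "(t - 1) * (\<kappa> * f 1) \<le> (t - 1) * f' c" using t by (intro mult_left_mono) auto
    then have "(t - 1) * (\<kappa> * f 1) \<le> f t - f 1" by (simp only: c(3))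
    then show ?thesis by (simp add: mult.commute[of "t - 1"])
  qed
  define t where "t = 2 + \<bar>B\<bar> / (\<kappa> * f 1)"
  have "t > 1" unfolding t_def using pos assms(4) by (smt (verit) divide_nonneg_pos mult_pos_pos)
  then have "f t \<ge> f 1 + \<kappa> * f 1 * (t - 1)" by (rule ge)
  moreover have "\<kappa> * f 1 * (t - 1) = \<kappa> * f 1 + \<bar>B\<bar>"
    using pos assms(4) by (simp add: t_def field_simps)
  moreover have "\<kappa> * f 1 > 0" using pos assms(4) by simp
  ultimately show ?thesis using pos \<open>t > 1\<close> by (intro exI[of _ t]) linarith
qed

context hyperbolic_planar_flow begin

definition rate :: real where "rate = min (- l) m"

lemma rate: "rate > 0" "l \<le> - rate" "rate \<le> m"
  using l_neg m_pos by (auto simp: rate_def)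

lemma averaged_coordinates:
  obtains X Y d1 d2 :: "real \<times> real \<Rightarrow> real" and \<rho> \<theta> :: real
  where "\<rho> > 0" "\<theta> \<ge> 0" "10 * \<theta> \<le> rate" "X 0 = 0" "Y 0 = 0" "d1 0 = 0" "d2 0 = 0"
    and "continuous_on (cball 0 \<rho>) X" "continuous_on (cball 0 \<rho>) Y"
    and "\<And>P P'. norm P \<le> \<rho> \<Longrightarrow> norm P' \<le> \<rho> \<Longrightarrow> norm (P - P') \<le> 2 * (\<bar>X P - X P'\<bar> + \<bar>Y P - Y P'\<bar>)"
    and "\<And>P P'. norm P \<le> \<rho> \<Longrightarrow> norm P' \<le> \<rho> \<Longrightarrow> \<bar>d1 P - d1 P'\<bar> \<le> \<theta> * (\<bar>X P - X P'\<bar> + \<bar>Y P - Y P'\<bar>)"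
    and "\<And>P P'. norm P \<le> \<rho> \<Longrightarrow> norm P' \<le> \<rho> \<Longrightarrow> \<bar>d2 P - d2 P'\<bar> \<le> \<theta> * (\<bar>X P - X P'\<bar> + \<bar>Y P - Y P'\<bar>)"
    and "\<And>t P. ((\<lambda>t. X (F t P)) has_real_derivative l * X (F t P) + d1 (F t P)) (at t)"
    and "\<And>t P. ((\<lambda>t. Y (F t P)) has_real_derivative m * Y (F t P) + d2 (F t P)) (at t)"
proof -
  define K where "K = exp \<bar>l\<bar> + exp \<bar>m\<bar>"
  \<comment> \<open>The 1/4 makes the averaged coordinates a bi-Lipschitz change of variables; rate
    / 20 makes the error constant \<open>\<theta> = 2 * b\<close> satisfy
    \<open>10 * \<theta> \<le> rate\<close>. Dividing by K absorbs the weights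
    \<open>exp \<bar>l\<bar>\<close> and \<open>exp \<bar>m\<bar>\<close>.\<close>
  define b where "b = min (1/4) (rate / 20)"
  define \<epsilon> where "\<epsilon> = b / K"
  have K: "K > 0" by (simp add: K_def add_pos_pos)
  have b: "b > 0" "b \<le> 1/4" "20 * b \<le> rate" using rate by (auto simp: b_def)
  have \<epsilon>: "\<epsilon> > 0" "K * \<epsilon> = b" using K b by (auto simp: \<epsilon>_def)
  obtain \<rho> where \<rho>: "\<rho> > 0" and lin:
      "\<And>t P P'. t \<in> {0..1} \<Longrightarrow> norm P \<le> \<rho> \<Longrightarrow> norm P' \<le> \<rho> \<Longrightarrow>
       \<bar>fst (F t P) - fst (F t P') - exp (l * t) * (fst P - fst P')\<bar> \<le> \<epsilon> * norm (P - P')"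
      "\<And>t P P'. t \<in> {0..1} \<Longrightarrow> norm P \<le> \<rho> \<Longrightarrow> norm P' \<le> \<rho> \<Longrightarrow>
       \<bar>snd (F t P) - snd (F t P') - exp (m * t) * (snd P - snd P')\<bar> \<le> \<epsilon> * norm (P - P')"
    using linearization[OF \<epsilon>(1)] by blast
  have small: "exp \<bar>l\<bar> * \<epsilon> \<le> b" "exp \<bar>m\<bar> * \<epsilon> \<le> b"
    using \<epsilon> by (auto simp: K_def algebra_simps)
  define X where "X = avg l fst"
  define Y where "Y = avg m snd"
  define d1 where "d1 P = exp (- l) * fst (F 1 P) - fst P" for P
  define d2 where "d2 P = exp (- m) * snd (F 1 P) - snd P" for P
  have cont: "continuous_on UNIV (fst :: real \<times> real \<Rightarrow> real)" "continuous_on UNIV (snd :: real \<times> real \<Rightarrow> real)"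
    by (intro continuous_intros)+
  have XP: "\<bar>X P - X P' - (fst P - fst P')\<bar> \<le> b * norm (P - P')" if "norm P \<le> \<rho>" "norm P' \<le> \<rho>" for P P'
    using avg_close[OF cont(1) lin(1)[OF _ that]] mult_right_mono[OF small(1), of "norm (P - P')"]
    by (simp add: X_def)
  have YP: "\<bar>Y P - Y P' - (snd P - snd P')\<bar> \<le> b * norm (P - P')" if "norm P \<le> \<rho>" "norm P' \<le> \<rho>" for P P'
    using avg_close[OF cont(2) lin(2)[OF _ that]] mult_right_mono[OF small(2), of "norm (P - P')"]
    by (simp add: Y_def)
  have coord: "\<bar>fst P - fst P'\<bar> \<le> norm (P - P')" "\<bar>snd P - snd P'\<bar> \<le> norm (P - P')" for P P' :: "real \<times> real"
    using norm_fst_le[of "fst P - fst P'" "snd P - snd P'"] norm_snd_le[of "snd P - snd P'" "fst P - fst P'"]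
    by (cases P; cases P'; simp)+
  have lips: "dist (X P) (X P') \<le> 2 * dist P P'" "dist (Y P) (Y P') \<le> 2 * dist P P'"
    if "norm P \<le> \<rho>" "norm P' \<le> \<rho>" for P P'
  proof -
    have "b * norm (P - P') \<le> norm (P - P') / 4" using mult_right_mono[OF b(2), of "norm (P - P')"] by simp
    then show "dist (X P) (X P') \<le> 2 * dist P P'" "dist (Y P) (Y P') \<le> 2 * dist P P'"
      using XP[OF that] YP[OF that] coord[of P P'] unfolding dist_norm real_norm_def by linarith+
  qed
  have N: "norm (P - P') \<le> 2 * (\<bar>X P - X P'\<bar> + \<bar>Y P - Y P'\<bar>)" if "norm P \<le> \<rho>" "norm P' \<le> \<rho>" for P P'
  proof -
    have "norm (P - P') \<le> \<bar>fst P - fst P'\<bar> + \<bar>snd P - snd P'\<bar>"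
      by (cases P; cases P'; simp) (metis norm_Pair_le real_norm_def)
    moreover have "\<bar>fst P - fst P'\<bar> \<le> \<bar>X P - X P'\<bar> + b * norm (P - P')"
      "\<bar>snd P - snd P'\<bar> \<le> \<bar>Y P - Y P'\<bar> + b * norm (P - P')"
      using XP[OF that] YP[OF that] by linarith+
    moreover have "b * norm (P - P') \<le> 1 / 4 * norm (P - P')"
      using mult_right_mono[OF b(2), of "norm (P - P')"] by simp
    ultimately have "norm (P - P') \<le> \<bar>X P - X P'\<bar> + \<bar>Y P - Y P'\<bar> + norm (P - P') / 2" by argo
    then show ?thesis by argo
  qed
  have d1: "\<bar>d1 P - d1 P'\<bar> \<le> 2 * b * (\<bar>X P - X P'\<bar> + \<bar>Y P - Y P'\<bar>)" if "norm P \<le> \<rho>" "norm P' \<le> \<rho>" for P P'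
  proof -
    have "d1 P - d1 P' = exp (- l) * (fst (F 1 P) - fst (F 1 P') - exp (l * 1) * (fst P - fst P'))"
      by (simp add: d1_def algebra_simps exp_minus)
    also have "\<bar>\<dots>\<bar> \<le> exp \<bar>l\<bar> * (\<epsilon> * norm (P - P'))"
      unfolding abs_mult using lin(1)[of 1, OF _ that] by (intro mult_mono) auto
    also have "\<dots> \<le> b * norm (P - P')" using mult_right_mono[OF small(1), of "norm (P - P')"] by simp
    also have "\<dots> \<le> b * (2 * (\<bar>X P - X P'\<bar> + \<bar>Y P - Y P'\<bar>))" by (intro mult_left_mono N that) (use b in simp)
    finally show ?thesis by (simp add: algebra_simps)
  qed
  have d2: "\<bar>d2 P - d2 P'\<bar> \<le> 2 * b * (\<bar>X P - X P'\<bar> + \<bar>Y P - Y P'\<bar>)" if "norm P \<le> \<rho>" "norm P' \<le> \<rho>" for P P'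
  proof -
    have "d2 P - d2 P' = exp (- m) * (snd (F 1 P) - snd (F 1 P') - exp (m * 1) * (snd P - snd P'))"
      by (simp add: d2_def algebra_simps exp_minus)
    also have "\<bar>\<dots>\<bar> \<le> exp \<bar>m\<bar> * (\<epsilon> * norm (P - P'))"
      unfolding abs_mult using lin(2)[of 1, OF _ that] by (intro mult_mono) auto
    also have "\<dots> \<le> b * norm (P - P')" using mult_right_mono[OF small(2), of "norm (P - P')"] by simp
    also have "\<dots> \<le> b * (2 * (\<bar>X P - X P'\<bar> + \<bar>Y P - Y P'\<bar>))" by (intro mult_left_mono N that) (use b in simp)
    finally show ?thesis by (simp add: algebra_simps)
  qed
  show thesis
  proof (rule that[of \<rho> "2 * b" X Y d1 d2])
    show "continuous_on (cball 0 \<rho>) X" "continuous_on (cball 0 \<rho>) Y"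
      using lips by (auto intro!: lipschitz_on_continuous_on[of 2] lipschitz_onI)
    show "((\<lambda>t. X (F t P)) has_real_derivative l * X (F t P) + d1 (F t P)) (at t)" for t P
      unfolding X_def d1_def by (rule avg_has_derivative[OF cont(1)])
    show "((\<lambda>t. Y (F t P)) has_real_derivative m * Y (F t P) + d2 (F t P)) (at t)" for t P
      unfolding Y_def d2_def by (rule avg_has_derivative[OF cont(2)])
  qed (use \<rho> b d1 d2 N in \<open>auto simp: X_def Y_def avg_def d1_def d2_def fix_F\<close>)
qed

text \<open>The lower Lipschitz bound makes the averaged coordinates injective, and invariance of
  domain turns them into a chart. Monotonicity is read off the derivatives of the squares of X and
  Y, the two graph conditions off the cone form \<open>q\<close>.\<close>

lemma saddle_box_at_origin:
  assumes "open W" "0 \<in> W"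
  shows "\<exists>U \<psi>. U \<subseteq> W \<and> saddle_box F 0 U \<psi>"
proof -
  obtain X Y d1 d2 :: "real \<times> real \<Rightarrow> real" and \<rho> \<theta> :: real
  where \<rho>: "\<rho> > 0" and \<theta>: "\<theta> \<ge> 0" "10 * \<theta> \<le> rate" and z: "X 0 = 0" "Y 0 = 0" "d1 0 = 0" "d2 0 = 0"
    and cX: "continuous_on (cball 0 \<rho>) X" and cY: "continuous_on (cball 0 \<rho>) Y"
    and N: "\<And>P P'. norm P \<le> \<rho> \<Longrightarrow> norm P' \<le> \<rho> \<Longrightarrow> norm (P - P') \<le> 2 * (\<bar>X P - X P'\<bar> + \<bar>Y P - Y P'\<bar>)"
    and d1: "\<And>P P'. norm P \<le> \<rho> \<Longrightarrow> norm P' \<le> \<rho> \<Longrightarrow> \<bar>d1 P - d1 P'\<bar> \<le> \<theta> * (\<bar>X P - X P'\<bar> + \<bar>Y P - Y P'\<bar>)"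
    and d2: "\<And>P P'. norm P \<le> \<rho> \<Longrightarrow> norm P' \<le> \<rho> \<Longrightarrow> \<bar>d2 P - d2 P'\<bar> \<le> \<theta> * (\<bar>X P - X P'\<bar> + \<bar>Y P - Y P'\<bar>)"
    and DX: "\<And>t P. ((\<lambda>t. X (F t P)) has_real_derivative l * X (F t P) + d1 (F t P)) (at t)"
    and DY: "\<And>t P. ((\<lambda>t. Y (F t P)) has_real_derivative m * Y (F t P) + d2 (F t P)) (at t)"
    by (rule averaged_coordinates) blast
  define U where "U = W \<inter> ball 0 \<rho>"
  have U: "open U" "0 \<in> U" "U \<subseteq> W" using assms \<rho> by (auto simp: U_def)
  have UD: "norm P \<le> \<rho>" if "P \<in> U" for P using that by (auto simp: U_def)
  define \<Phi> where "\<Phi> P = (X P, Y P)" for P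
  have "continuous_on U \<Phi>" unfolding \<Phi>_def
    by (intro continuous_intros continuous_on_subset[OF cX] continuous_on_subset[OF cY]) (auto simp: U_def)
  moreover have inj: "inj_on \<Phi> U"
  proof (rule inj_onI)
    fix P P' assume "P \<in> U" "P' \<in> U" "\<Phi> P = \<Phi> P'"
    then show "P = P'" using N[of P P'] UD[of P] UD[of P'] by (simp add: \<Phi>_def)
  qed
  ultimately obtain k0 where hom: "homeomorphism U (\<Phi> ` U) \<Phi> k0"
    using invariance_of_domain_homeomorphism[of U \<Phi>] U by auto
  have "open (\<Phi> ` U)"
    using invariance_of_domain[OF \<open>continuous_on U \<Phi>\<close> U(1) inj] .
  moreover have "0 \<in> \<Phi> ` U" using U z by (force simp: \<Phi>_def zero_prod_def)
  ultimately obtain e where e: "e > 0" "cball 0 e \<subseteq> \<Phi> ` U"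
    using open_contains_cball by blast
  \<comment> \<open>A point of the rescaled square of half-width 2 has norm at most 4 r = e before
    rescaling.\<close>
  define r where "r = e / 4"
  have r: "r > 0" using e by (simp add: r_def)
  define \<psi> where "\<psi> P = (X P / r, Y P / r)" for P
  have box_sub: "(r * x, r * y) \<in> \<Phi> ` U" if "\<bar>x\<bar> \<le> 2" "\<bar>y\<bar> \<le> 2" for x y
  proof -
    have "norm (r * x, r * y) \<le> \<bar>r * x\<bar> + \<bar>r * y\<bar>" by (metis norm_Pair_le real_norm_def)
    also have "\<dots> = r * (\<bar>x\<bar> + \<bar>y\<bar>)" using r by (simp add: abs_mult algebra_simps)
    also have "\<dots> \<le> r * 4" using that r by (intro mult_left_mono) auto
    finally show ?thesis using e by (auto simp: r_def)
  qed
  have chart: "\<exists>V k. open V \<and> homeomorphism U V \<psi> k \<and> {-2..2} \<times> {-2..2} \<subseteq> V"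
  proof (intro exI conjI)
    let ?S = "\<lambda>Q :: real \<times> real. Q /\<^sub>R r" let ?T = "\<lambda>Q :: real \<times> real. r *\<^sub>R Q"
    have "homeomorphism (\<Phi> ` U) (?S ` \<Phi> ` U) ?S ?T"
      using r by (intro homeomorphismI) (auto intro!: continuous_intros)
    from homeomorphism_compose[OF hom this]
    show "homeomorphism U (?S ` \<Phi> ` U) \<psi> (k0 \<circ> ?T)"
      by (rule homeomorphism_cong) (auto simp: \<psi>_def \<Phi>_def divide_inverse mult.commute)
    show "open (?S ` \<Phi> ` U)"
      using r \<open>open (\<Phi> ` U)\<close> by (intro open_scaling) auto
    show "{-2..2} \<times> {-2..2} \<subseteq> ?S ` \<Phi> ` U"
    proof (clarify)
      fix x y :: real assume "x \<in> {-2..2}" "y \<in> {-2..2}"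
      then have "(r * x, r * y) \<in> \<Phi> ` U" by (intro box_sub) auto
      then show "(x, y) \<in> ?S ` \<Phi> ` U" using imageI[of "(r * x, r * y)" "\<Phi> ` U" ?S] r by (simp flip: mult.assoc)
    qed
  qed
  have d1': "\<bar>d1 P\<bar> \<le> \<theta> * (\<bar>X P\<bar> + \<bar>Y P\<bar>)" "\<bar>d2 P\<bar> \<le> \<theta> * (\<bar>Y P\<bar> + \<bar>X P\<bar>)" if "P \<in> U" for P
    using d1[of P 0] d2[of P 0] UD[OF that] z \<rho> by (auto simp: add.commute)
  have box: "P \<in> U" "\<bar>X P\<bar> \<le> c * r" "\<bar>Y P\<bar> \<le> c * r" if "P \<in> square c U \<psi>" for P c
    using that r by (auto simp: square_def \<psi>_def divide_le_eq)
  have decr: "\<bar>X (F t P)\<bar> < \<bar>X P\<bar>"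
    if t: "0 < t" and arc: "\<And>s. s \<in> {0..t} \<Longrightarrow> F s P \<in> square 2 U \<psi> \<and> 1/2 \<le> \<bar>fst (\<psi> (F s P))\<bar>" for P t
  proof -
    have "(X (F t P))\<^sup>2 < (X (F 0 P))\<^sup>2"
    proof (rule DERIV_neg_imp_decreasing[OF t])
      fix s assume s: "0 \<le> s" "s \<le> t"
      have "F s P \<in> square 2 U \<psi>" "r / 2 \<le> \<bar>X (F s P)\<bar>"
        using arc[of s] s r by (auto simp: \<psi>_def le_divide_eq)
      moreover from this have "2 * X (F s P) * (l * X (F s P) + d1 (F s P)) < 0"
        by (intro contracting_derivative[of rate _ \<theta> _ _ "Y (F s P)"] rate \<theta> d1')
          (use r box[of "F s P" 2] in auto)
      moreover have "((\<lambda>s. (X (F s P))\<^sup>2) has_real_derivative 2 * X (F s P) * (l * X (F s P) + d1 (F s P))) (at s)"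
        by (auto intro!: derivative_eq_intros DX)
      ultimately show "\<exists>y. ((\<lambda>s. (X (F s P))\<^sup>2) has_real_derivative y) (at s) \<and> y < 0" by blast
    qed
    then show ?thesis by (simp add: abs_le_square_iff flip: not_le)
  qed
  have incr: "\<bar>Y P\<bar> < \<bar>Y (F t P)\<bar>"
    if t: "0 < t" and arc: "\<And>s. s \<in> {0..t} \<Longrightarrow> F s P \<in> square 2 U \<psi> \<and> 1/2 \<le> \<bar>snd (\<psi> (F s P))\<bar>" for P t
  proof -
    have "(Y (F 0 P))\<^sup>2 < (Y (F t P))\<^sup>2"
    proof (rule DERIV_pos_imp_increasing[OF t])
      fix s assume s: "0 \<le> s" "s \<le> t"
      have "F s P \<in> square 2 U \<psi>" "r / 2 \<le> \<bar>Y (F s P)\<bar>"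
        using arc[of s] s r by (auto simp: \<psi>_def le_divide_eq)
      moreover from this have "2 * Y (F s P) * (- m * Y (F s P) + - d2 (F s P)) < 0"
        by (intro contracting_derivative[of rate _ \<theta> _ _ "X (F s P)"] rate \<theta>)
          (use r box[of "F s P" 2] d1' rate in auto)
      then have "2 * Y (F s P) * (m * Y (F s P) + d2 (F s P)) > 0" by (simp add: algebra_simps)
      moreover have "((\<lambda>s. (Y (F s P))\<^sup>2) has_real_derivative 2 * Y (F s P) * (m * Y (F s P) + d2 (F s P))) (at s)"
        by (auto intro!: derivative_eq_intros DY)
      ultimately show "\<exists>y. ((\<lambda>s. (Y (F s P))\<^sup>2) has_real_derivative y) (at s) \<and> y > 0" by blast
    qed
    then show ?thesis by (simp add: abs_le_square_iff flip: not_le)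
  qed
  \<comment> \<open>The cone form of a pair of orbits. While both stay in U it grows with slope at
    least \<open>rate * |q|\<close>, so a pair with q nonnegative at the start exceeds the bound
    \<open>4 * r\<^sup>2\<close> that holds in the square. In reversed time \<open>- q\<close>
    behaves in the same way; this excludes pairs violating a graph condition.\<close>
  define q where "q P P' t = (Y (F t P) - Y (F t P'))\<^sup>2 - (X (F t P) - X (F t P'))\<^sup>2" for P P' t
  define q' where "q' P P' t = 2 * (Y (F t P) - Y (F t P')) * (m * (Y (F t P) - Y (F t P')) + (d2 (F t P) - d2 (F t P')))
      - 2 * (X (F t P) - X (F t P')) * (l * (X (F t P) - X (F t P')) + (d1 (F t P) - d1 (F t P')))" for P P' t
  have Dq: "(q P P' has_real_derivative q' P P' t) (at t)" for P P' t
    unfolding q_def q'_def by (auto intro!: derivative_eq_intros DX DY simp: algebra_simps)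
  have cone: "q' P P' t > 0" "q' P P' t \<ge> rate * \<bar>q P P' t\<bar>"
    if "P \<noteq> P'" "F t P \<in> U" "F t P' \<in> U" for P P' t
  proof -
    let ?dX = "X (F t P) - X (F t P')" let ?dY = "Y (F t P) - Y (F t P')"
    have "F t P \<noteq> F t P'"
      using \<open>P \<noteq> P'\<close> F_add[of "- t" t P] F_add[of "- t" t P'] by auto
    then have "norm (F t P - F t P') > 0" by simp
    moreover have "norm (F t P - F t P') \<le> 2 * (\<bar>?dX\<bar> + \<bar>?dY\<bar>)" by (intro N UD that)
    ultimately have "\<bar>?dX\<bar> + \<bar>?dY\<bar> > 0" by argo
    then have pos: "?dX\<^sup>2 + ?dY\<^sup>2 > 0" by (smt (verit) sum_power2_gt_zero_iff)
    have q': "q' P P' t \<ge> rate * (?dX\<^sup>2 + ?dY\<^sup>2)"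
      unfolding q'_def using that UD d1 d2 rate \<theta> by (intro cone_form_derivative[of _ _ _ \<theta>]) auto
    then show "q' P P' t > 0" using pos rate by (smt (verit) mult_pos_pos)
    have "\<bar>q P P' t\<bar> \<le> ?dX\<^sup>2 + ?dY\<^sup>2"
      unfolding q_def using zero_le_power2[of ?dX] zero_le_power2[of ?dY] by linarith
    then show "q' P P' t \<ge> rate * \<bar>q P P' t\<bar>" using q' rate by (smt (verit) mult_left_mono)
  qed
  have bdd: "\<bar>q P P' t\<bar> \<le> 4 * r\<^sup>2" if "F t P \<in> square 1 U \<psi>" "F t P' \<in> square 1 U \<psi>" for P P' t
  proof -
    have "\<bar>X (F t P) - X (F t P')\<bar> \<le> 2 * r" "\<bar>Y (F t P) - Y (F t P')\<bar> \<le> 2 * r"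
      using box[OF that(1)] box[OF that(2)] by auto
    then have "(X (F t P) - X (F t P'))\<^sup>2 \<le> (2 * r)\<^sup>2" "(Y (F t P) - Y (F t P'))\<^sup>2 \<le> (2 * r)\<^sup>2"
      using r by (metis abs_le_square_iff abs_of_pos zero_less_mult_iff zero_less_numeral)+
    moreover have "(2 * r)\<^sup>2 = 4 * r\<^sup>2" by (simp add: power_mult_distrib)
    ultimately show ?thesis
      unfolding q_def using zero_le_power2[of "X (F t P) - X (F t P')"] zero_le_power2[of "Y (F t P) - Y (F t P')"]
      by linarith
  qed
  have stable: "\<bar>snd (\<psi> P) - snd (\<psi> P')\<bar> < \<bar>fst (\<psi> P) - fst (\<psi> P')\<bar>"
    if "P \<noteq> P'" and stay: "\<And>t. t \<ge> 0 \<Longrightarrow> F t P \<in> square 1 U \<psi>" "\<And>t. t \<ge> 0 \<Longrightarrow> F t P' \<in> square 1 U \<psi>" for P P'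
  proof (rule ccontr)
    assume "\<not> ?thesis"
    then have "\<bar>X P - X P'\<bar> \<le> \<bar>Y P - Y P'\<bar>"
      using r by (simp add: \<psi>_def not_less divide_le_cancel flip: diff_divide_distrib)
    then have "q P P' 0 \<ge> 0" by (simp add: q_def abs_le_square_iff)
    then have "\<exists>t\<ge>0. q P P' t > 4 * r\<^sup>2"
    proof (intro unbounded_growth[of _ "q' P P'" rate] Dq)
      fix t :: real assume "0 \<le> t"
      then have "F t P \<in> U" "F t P' \<in> U" using stay box(1) by blast+
      then show "0 < q' P P' t" "rate * \<bar>q P P' t\<bar> \<le> q' P P' t" using cone \<open>P \<noteq> P'\<close> by blast+
    qed (use rate in auto)
    then show False using bdd[of _ P P'] stay by (smt (verit))
  qed
  have unstable: "\<bar>fst (\<psi> P) - fst (\<psi> P')\<bar> < \<bar>snd (\<psi> P) - snd (\<psi> P')\<bar>"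
    if "P \<noteq> P'" and stay: "\<And>t. t \<le> 0 \<Longrightarrow> F t P \<in> square 1 U \<psi>" "\<And>t. t \<le> 0 \<Longrightarrow> F t P' \<in> square 1 U \<psi>" for P P'
  proof (rule ccontr)
    assume "\<not> ?thesis"
    then have "\<bar>Y P - Y P'\<bar> \<le> \<bar>X P - X P'\<bar>"
      using r by (simp add: \<psi>_def not_less divide_le_cancel flip: diff_divide_distrib)
    then have q0: "- q P P' (- 0) \<ge> 0" by (simp add: q_def abs_le_square_iff)
    have "((\<lambda>t. - q P P' (- t)) has_real_derivative q' P P' (- t)) (at t)" for t
      by (auto intro!: derivative_eq_intros DERIV_chain'[OF _ Dq, of uminus "-1"])
    then have "\<exists>t\<ge>0. - q P P' (- t) > 4 * r\<^sup>2"
    proof (intro unbounded_growth[of _ "\<lambda>t. q' P P' (- t)" rate])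
      fix t :: real assume "0 \<le> t"
      then have "F (- t) P \<in> U" "F (- t) P' \<in> U" using stay[of "- t"] box(1) by auto
      then show "0 < q' P P' (- t)" "rate * \<bar>- q P P' (- t)\<bar> \<le> q' P P' (- t)"
        using cone \<open>P \<noteq> P'\<close> by auto
    qed (use rate q0 in auto)
    then show False using bdd[of _ P P'] stay by (smt (verit))
  qed
  have "saddle_box F 0 U \<psi>"
    unfolding saddle_box_def
  proof (intro conjI allI impI U chart)
    fix P t assume "0 < t \<and> (\<forall>s\<in>{0..t}. F s P \<in> square 2 U \<psi> \<and> 1/2 \<le> \<bar>fst (\<psi> (F s P))\<bar>)"
    then have "\<bar>X (F t P)\<bar> < \<bar>X P\<bar>" by (intro decr) auto
    then show "\<bar>fst (\<psi> (F t P))\<bar> < \<bar>fst (\<psi> P)\<bar>" using r by (simp add: \<psi>_def divide_strict_right_mono)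
  next
    fix P t assume "0 < t \<and> (\<forall>s\<in>{0..t}. F s P \<in> square 2 U \<psi> \<and> 1/2 \<le> \<bar>snd (\<psi> (F s P))\<bar>)"
    then have "\<bar>Y P\<bar> < \<bar>Y (F t P)\<bar>" by (intro incr) auto
    then show "\<bar>snd (\<psi> P)\<bar> < \<bar>snd (\<psi> (F t P))\<bar>" using r by (simp add: \<psi>_def divide_strict_right_mono)
  qed (use stable unstable z fix_F in \<open>auto simp: \<psi>_def\<close>)
  then show ?thesis using U by blast
qed

end

section \<open>Transport of saddle boxes along orbit equivalences\<close>

lemma saddle_boxD:
  assumes "saddle_box v p U \<psi>"
  shows "open U" "p \<in> U" "\<psi> p = (0, 0)" "\<And>t. v t p = p"
  using assms unfolding saddle_box_def by simp_all

lemma saddle_box_chart: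
  assumes "saddle_box v p U \<psi>"
  obtains V k where "open V" "homeomorphism U V \<psi> k" "{-2..2} \<times> {-2..2} \<subseteq> V"
proof -
  have "\<exists>V k. open V \<and> homeomorphism U V \<psi> k \<and> {-2..2} \<times> {-2..2} \<subseteq> V"
    using assms unfolding saddle_box_def by simp
  then show thesis using that by blast
qed

lemma saddle_box_mono:
  assumes "saddle_box v p U \<psi>" "0 < t" "\<And>s. s \<in> {0..t} \<Longrightarrow> v s z \<in> square 2 U \<psi>"
  shows "(\<And>s. s \<in> {0..t} \<Longrightarrow> 1/2 \<le> \<bar>fst (\<psi> (v s z))\<bar>) \<Longrightarrow> \<bar>fst (\<psi> (v t z))\<bar> < \<bar>fst (\<psi> z)\<bar>"
    and "(\<And>s. s \<in> {0..t} \<Longrightarrow> 1/2 \<le> \<bar>snd (\<psi> (v s z))\<bar>) \<Longrightarrow> \<bar>snd (\<psi> z)\<bar> < \<bar>snd (\<psi> (v t z))\<bar>"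
  using assms unfolding saddle_box_def by simp_all

lemma saddle_box_stay:
  assumes "saddle_box v p U \<psi>" "z \<noteq> z'"
  shows "(\<And>t. t \<ge> 0 \<Longrightarrow> v t z \<in> square 1 U \<psi> \<and> v t z' \<in> square 1 U \<psi>) \<Longrightarrow>
      \<bar>snd (\<psi> z) - snd (\<psi> z')\<bar> < \<bar>fst (\<psi> z) - fst (\<psi> z')\<bar>"
    and "(\<And>t. t \<le> 0 \<Longrightarrow> v t z \<in> square 1 U \<psi> \<and> v t z' \<in> square 1 U \<psi>) \<Longrightarrow>
      \<bar>fst (\<psi> z) - fst (\<psi> z')\<bar> < \<bar>snd (\<psi> z) - snd (\<psi> z')\<bar>"
  using assms unfolding saddle_box_def by simp_all

lemma homeomorphism_mem:
  assumes "homeomorphism S T f g"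
  shows "x \<in> S \<Longrightarrow> f x \<in> T" "y \<in> T \<Longrightarrow> g y \<in> S"
  using homeomorphism_image1[OF assms] homeomorphism_image2[OF assms] by blast+

lemma compact_square:
  assumes "saddle_box v p U \<psi>" "c \<le> 2"
  shows "compact (square c U \<psi>)"
proof -
  obtain V k where V: "homeomorphism U V \<psi> k" "{-2..2} \<times> {-2..2} \<subseteq> V"
    by (rule saddle_box_chart[OF assms(1)])
  let ?Q = "{-c..c} \<times> {-c..c}"
  have "{-c..c} \<subseteq> {-2..2}" using assms(2) by auto
  then have Q: "?Q \<subseteq> V" using V(2) by (meson Sigma_mono order_trans)
  have "square c U \<psi> = k ` ?Q"
  proof (intro subset_antisym subsetI)
    fix y assume y: "y \<in> square c U \<psi>"
    then have "\<psi> y \<in> ?Q" by (cases "\<psi> y") (auto simp: square_def)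
    moreover have "y = k (\<psi> y)" using y homeomorphism_apply1[OF V(1)] by (simp add: square_def)
    ultimately show "y \<in> k ` ?Q" by (rule rev_image_eqI)
  next
    fix y assume "y \<in> k ` ?Q"
    then obtain a where a: "y = k a" "a \<in> ?Q" by (rule imageE)
    then have "a \<in> V" using Q by (rule_tac subsetD)
    then have "y \<in> U" "\<psi> y = a" using homeomorphism_mem(2)[OF V(1)] homeomorphism_apply2[OF V(1)] a(1) by simp_all
    then show "y \<in> square c U \<psi>" using a(2) by (auto simp: square_def)
  qed
  moreover have "compact (k ` ?Q)"
    using continuous_on_subset[OF homeomorphism_cont2[OF V(1)] Q] by (intro compact_continuous_image compact_Times) auto
  ultimately show ?thesis by simp
qed

lemma flow_add: "flow v \<Longrightarrow> v s (v t x) = v (s + t) x"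
  unfolding flow_def by metis

lemma flow_zero: "flow v \<Longrightarrow> v 0 x = x"
  unfolding flow_def by metis

lemma continuous_on_flow:
  "flow v \<Longrightarrow> continuous_on A f \<Longrightarrow> continuous_on A g \<Longrightarrow> continuous_on A (\<lambda>s. v (f s) (g s))"
  using continuous_on_compose2[of UNIV "\<lambda>(t, x). v t x" A "\<lambda>s. (f s, g s)"]
  by (auto simp: flow_def intro: continuous_intros)

lemma flow_reverse:
  assumes v: "flow v"
  shows "flow (\<lambda>t. v (- t))"
proof -
  have "continuous_on UNIV (\<lambda>z. v (- fst z) (snd z))"
    by (intro continuous_on_flow[OF v] continuous_intros)
  then show ?thesis by (simp add: flow_def[of "\<lambda>t. v (- t)"] case_prod_beta flow_add[OF v] flow_zero[OF v])
qed

text \<open>An arc traversed backward is the forward arc from its last point \<open>x0\<close>.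
  Reading the time change from the other end gives \<open>\<sigma> t - \<sigma> (t - s)\<close>,
  again increasing and 0 at 0.\<close>

lemma maps_orbit_arcs_reverse:
  assumes "flow v" "flow w" "maps_orbit_arcs h v U w"
  shows "maps_orbit_arcs h (\<lambda>t. v (- t)) U (\<lambda>t. w (- t))"
  unfolding maps_orbit_arcs_def
proof (intro allI impI, elim conjE)
  fix x t assume t: "0 \<le> t" and arc: "\<forall>s\<in>{0..t}. v (- s) x \<in> U"
  define x0 where "x0 = v (- t) x"
  have x0: "v s x0 = v (- (t - s)) x" for s by (simp add: x0_def flow_add[OF assms(1)])
  have "\<forall>s\<in>{0..t}. v s x0 \<in> U" using arc[rule_format, of "t - s" for s] by (auto simp: x0)
  then obtain \<sigma> where \<sigma>: "\<sigma> 0 = 0" "continuous_on {0..t} \<sigma>" "strict_mono_on {0..t} \<sigma>"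
      and eq: "\<And>s. s \<in> {0..t} \<Longrightarrow> h (v s x0) = w (\<sigma> s) (h x0)"
    using assms(3) t unfolding maps_orbit_arcs_def by metis
  have hx: "h x0 = w (- \<sigma> t) (h x)"
    using eq[of t] t by (simp add: x0 flow_add[OF assms(2)] flow_zero[OF assms(2)] flow_zero[OF assms(1)])
  show "\<exists>\<sigma>. \<sigma> 0 = 0 \<and> continuous_on {0..t} \<sigma> \<and> strict_mono_on {0..t} \<sigma> \<and>
      (\<forall>s\<in>{0..t}. h (v (- s) x) = w (- \<sigma> s) (h x))"
  proof (intro exI[of _ "\<lambda>s. \<sigma> t - \<sigma> (t - s)"] conjI ballI)
    show "continuous_on {0..t} (\<lambda>s. \<sigma> t - \<sigma> (t - s))"
      by (intro continuous_intros continuous_on_compose2[OF \<sigma>(2)]) auto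
    show "strict_mono_on {0..t} (\<lambda>s. \<sigma> t - \<sigma> (t - s))"
      using \<sigma>(3) by (auto simp: strict_mono_on_def)
    fix s assume s: "s \<in> {0..t}"
    have "h (v (- s) x) = h (v (t - s) x0)" by (simp add: x0)
    also have "\<dots> = w (\<sigma> (t - s)) (h x0)" using s by (intro eq) auto
    finally show "h (v (- s) x) = w (- (\<sigma> t - \<sigma> (t - s))) (h x)"
      by (simp add: hx flow_add[OF assms(2)])
  qed simp
qed

text \<open>The time change is continuous, so by the intermediate value theorem the image arc has no
  gaps: every time between 0 and T is attained.\<close>

lemma maps_orbit_arcsE:
  assumes "maps_orbit_arcs h v U w" "flow w" "0 < t" "\<And>s. s \<in> {0..t} \<Longrightarrow> v s x \<in> U"
  obtains T where "0 < T" "h (v t x) = w T (h x)"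
    "\<And>\<tau>. \<tau> \<in> {0..T} \<Longrightarrow> \<exists>s\<in>{0..t}. w \<tau> (h x) = h (v s x)"
proof -
  have "\<forall>s\<in>{0..t}. v s x \<in> U" "0 \<le> t" using assms by auto
  then obtain \<sigma> where \<sigma>: "\<sigma> 0 = 0" "continuous_on {0..t} \<sigma>" "strict_mono_on {0..t} \<sigma>"
      and eq: "\<And>s. s \<in> {0..t} \<Longrightarrow> h (v s x) = w (\<sigma> s) (h x)"
    using assms(1) unfolding maps_orbit_arcs_def by metis
  show thesis
  proof
    show "0 < \<sigma> t" using \<sigma>(3) \<open>0 < t\<close> by (metis \<sigma>(1) atLeastAtMost_iff less_eq_real_def strict_mono_onD order_refl)
    show "h (v t x) = w (\<sigma> t) (h x)" using assms by (intro eq) auto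
    fix \<tau> assume "\<tau> \<in> {0..\<sigma> t}"
    then obtain s where "0 \<le> s" "s \<le> t" "\<sigma> s = \<tau>"
      using IVT'[of \<sigma> 0 \<tau> t] \<sigma> \<open>0 < t\<close> by auto
    then show "\<exists>s\<in>{0..t}. w \<tau> (h x) = h (v s x)" using eq[of s] by (intro bexI[of _ s]) auto
  qed
qed

text \<open>
  The reparametrisation may depend on the arc and may be bounded, so it need not carry
  \<open>[0, \<infinity>)\<close> onto \<open>[0, \<infinity>)\<close>; the maximal time spent in \<open>K\<close> is compared instead.
\<close>

lemma stay_forward:
  assumes v: "flow v" and w: "flow w" and hom: "homeomorphism U V h k"
    and h: "maps_orbit_arcs h v U w" and k: "maps_orbit_arcs k w V v"
    and K: "closed K" "K \<subseteq> V" and stay: "\<And>t. t \<ge> 0 \<Longrightarrow> v t z \<in> U \<and> h (v t z) \<in> K" and "t \<ge> 0"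
  shows "w t (h z) \<in> K"
proof (rule ccontr)
  assume bad: "w t (h z) \<notin> K"
  define B where "B = {\<tau>. \<tau> \<ge> 0 \<and> w \<tau> (h z) \<notin> K}"
  define T where "T = Inf B"
  have B: "t \<in> B" "bdd_below B" using bad \<open>t \<ge> 0\<close> by (auto simp: B_def intro!: bdd_belowI[of _ 0])
  have z: "z \<in> U" "h z \<in> K" using stay[of 0] by (simp_all add: flow_zero[OF v])
  have T0: "T \<ge> 0" unfolding T_def using B by (intro cInf_greatest) (auto simp: B_def)
  have before: "w s (h z) \<in> K" if "0 \<le> s" "s < T" for s
    using that B cInf_lower[of s B] by (force simp: B_def T_def)
  have TK: "w T (h z) \<in> K"
  proof (cases "T = 0")
    case False
    have "closed ((\<lambda>s. w s (h z)) -` K)"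
      using K(1) by (intro closed_vimage) (auto intro!: continuous_on_flow[OF w] continuous_intros)
    moreover have "{0..<T} \<subseteq> (\<lambda>s. w s (h z)) -` K" using before by auto
    ultimately have "closure {0..<T} \<subseteq> (\<lambda>s. w s (h z)) -` K" by (rule closure_minimal[rotated])
    then show ?thesis using False T0 by (auto simp: closure_atLeastLessThan)
  qed (use z in \<open>simp add: flow_zero[OF w]\<close>)
  \<comment> \<open>Up to T, the infimum of the bad times, the w-orbit lies in V, so k carries it
    back to the v-orbit of z. From the point reached there the v-orbit goes on inside the preimage
    of K, and its image keeps the w-orbit in K a little beyond T.\<close>
  have "\<exists>S\<ge>0. k (w T (h z)) = v S z"
  proof (cases "T = 0")
    case True
    then show ?thesis
      using z hom by (auto simp: flow_zero[OF w] flow_zero[OF v] homeomorphism_apply1 intro!: exI[of _ 0])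
  next
    case False
    then have "0 < T" using T0 by simp
    moreover have "w s (h z) \<in> V" if "s \<in> {0..T}" for s
      using that before[of s] TK K by (cases "s = T") auto
    ultimately obtain S where "0 < S" "k (w T (h z)) = v S (k (h z))"
      using maps_orbit_arcsE[OF k v, of T "h z"] by metis
    then show ?thesis using z hom by (auto simp: homeomorphism_apply1 intro!: exI[of _ S])
  qed
  then obtain S where S: "S \<ge> 0" "k (w T (h z)) = v S z" by auto
  have hS: "h (v S z) = w T (h z)"
    using S(2) hom TK K by (metis homeomorphism_apply2 subset_iff)
  have "v s (v S z) \<in> U" if "s \<in> {0..1}" for s using stay[of "s + S"] S that by (simp add: flow_add[OF v])
  from maps_orbit_arcsE[OF h w zero_less_one this]
  obtain T' where T': "0 < T'" "\<And>\<tau>. \<tau> \<in> {0..T'} \<Longrightarrow> \<exists>s\<in>{0..1}. w \<tau> (h (v S z)) = h (v s (v S z))"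
    by metis
  have after: "w (\<tau> + T) (h z) \<in> K" if \<tau>: "\<tau> \<in> {0..T'}" for \<tau>
  proof -
    obtain s where "s \<in> {0..1}" "w \<tau> (h (v S z)) = h (v s (v S z))" using T'(2)[OF \<tau>] by auto
    then show ?thesis using stay[of "s + S"] S by (simp add: hS flow_add[OF v] flow_add[OF w])
  qed
  have "T + T' \<le> Inf B"
  proof (rule cInf_greatest)
    fix x assume x: "x \<in> B"
    then have "x \<ge> T" unfolding T_def using B by (intro cInf_lower)
    moreover have "\<not> x - T \<le> T'" using after[of "x - T"] x \<open>x \<ge> T\<close> by (auto simp: B_def)
    ultimately show "T + T' \<le> x" by simp
  qed (use B in auto)
  then show False using T' by (simp add: T_def)
qed

text \<open>Each clause of a saddle box concerns only the set traced by an arc and its end points,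
  not its parametrisation. So monotonicity passes to the image arc, and the two graph conditions
  pass through \<open>stay_forward\<close>, for negative times after reversing both flows.\<close>

lemma saddle_box_transfer:
  assumes v: "flow v" and w: "flow w" and hom: "homeomorphism U V h k" and "open U" "open V"
    and p: "p \<in> U" "h p = q" "\<And>t. v t p = p"
    and h: "maps_orbit_arcs h v U w" and k: "maps_orbit_arcs k w V v"
    and sb: "saddle_box w q W \<psi>" and "W \<subseteq> V"
  shows "saddle_box v (p :: 'a::t2_space) {z\<in>U. (h z :: 'b::t2_space) \<in> W} (\<psi> \<circ> h)"
proof -
  let ?U = "{z\<in>U. h z \<in> W}"
  have sq: "z \<in> square c ?U (\<psi> \<circ> h) \<longleftrightarrow> z \<in> U \<and> h z \<in> square c W \<psi>" for z c
    by (auto simp: square_def)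
  obtain V' k' where V': "open V'" "homeomorphism W V' \<psi> k'" "{-2..2} \<times> {-2..2} \<subseteq> V'"
    by (rule saddle_box_chart[OF sb])
  have Uh: "?U = k ` W"
  proof (intro subset_antisym subsetI)
    fix z assume "z \<in> ?U"
    then show "z \<in> k ` W" using hom by (intro image_eqI[of _ _ "h z"]) (auto simp: homeomorphism_apply1)
  next
    fix z assume "z \<in> k ` W"
    then obtain y where "z = k y" "y \<in> W" "y \<in> V" using \<open>W \<subseteq> V\<close> by blast
    then show "z \<in> ?U" using homeomorphism_mem(2)[OF hom] by (simp add: homeomorphism_apply2[OF hom])
  qed
  have homU: "homeomorphism ?U W h k"
  proof (rule homeomorphism_of_subsets[OF hom])
    show "h ` ?U = W" using hom \<open>W \<subseteq> V\<close> by (simp add: Uh image_image homeomorphism_apply2[OF hom] subset_iff cong: image_cong)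
  qed (use \<open>W \<subseteq> V\<close> in auto)
  have closed: "closed (square 1 W \<psi>)"
    using compact_imp_closed[OF compact_square[OF sb]] by simp
  have sub: "square 1 W \<psi> \<subseteq> V" using \<open>W \<subseteq> V\<close> by (auto simp: square_def)
  have fwd: "w t (h z) \<in> square 1 W \<psi>"
    if "\<And>t. t \<ge> 0 \<Longrightarrow> v t z \<in> square 1 ?U (\<psi> \<circ> h)" "t \<ge> 0" for z t
    using stay_forward[OF v w hom h k closed sub, of z t] that unfolding sq by blast
  have bwd: "w t (h z) \<in> square 1 W \<psi>"
    if "\<And>t. t \<le> 0 \<Longrightarrow> v t z \<in> square 1 ?U (\<psi> \<circ> h)" "t \<le> 0" for z t
    using stay_forward[OF flow_reverse[OF v] flow_reverse[OF w] hom maps_orbit_arcs_reverse[OF v w h]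
        maps_orbit_arcs_reverse[OF w v k] closed sub, of z "- t"] that unfolding sq by simp
  have ne: "h z \<noteq> h z'" if "z \<noteq> z'" "z \<in> U" "z' \<in> U" for z z'
    using hom that by (metis homeomorphism_apply1)
  have inU: "z \<in> U" if "v 0 z \<in> square 1 ?U (\<psi> \<circ> h)" for z using that by (auto simp: sq flow_zero[OF v])
  show ?thesis
    unfolding saddle_box_def
  proof (intro conjI allI impI)
    show "open ?U"
    proof -
      have "open (h -` W \<inter> U)"
        using continuous_on_open_vimage[OF \<open>open U\<close>] homeomorphism_cont1[OF hom] saddle_boxD(1)[OF sb] by blast
      then show ?thesis by (simp add: vimage_def Int_def conj_commute)
    qed
    show "p \<in> ?U" "(\<psi> \<circ> h) p = (0, 0)" using p saddle_boxD[OF sb] by auto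
    show "v t p = p" for t by (rule p)
    show "\<exists>V k. open V \<and> homeomorphism ?U V (\<psi> \<circ> h) k \<and> {-2..2} \<times> {-2..2} \<subseteq> V"
      using homeomorphism_compose[OF homU V'(2)] V' by blast
  next
    fix z t assume "0 < t \<and> (\<forall>s\<in>{0..t}. v s z \<in> square 2 ?U (\<psi> \<circ> h) \<and> 1/2 \<le> \<bar>fst ((\<psi> \<circ> h) (v s z))\<bar>)"
    then have a: "0 < t" "\<And>s. s \<in> {0..t} \<Longrightarrow> v s z \<in> U \<and> h (v s z) \<in> square 2 W \<psi> \<and> 1/2 \<le> \<bar>fst (\<psi> (h (v s z)))\<bar>"
      by (auto simp: sq)
    then obtain T where T: "0 < T" "h (v t z) = w T (h z)" "\<And>\<tau>. \<tau> \<in> {0..T} \<Longrightarrow> \<exists>s\<in>{0..t}. w \<tau> (h z) = h (v s z)"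
      by (metis maps_orbit_arcsE[OF h w])
    have "w \<tau> (h z) \<in> square 2 W \<psi> \<and> 1/2 \<le> \<bar>fst (\<psi> (w \<tau> (h z)))\<bar>" if "\<tau> \<in> {0..T}" for \<tau>
      using T(3)[OF that] a(2) by auto
    then have "\<bar>fst (\<psi> (w T (h z)))\<bar> < \<bar>fst (\<psi> (h z))\<bar>" by (intro saddle_box_mono(1)[OF sb T(1)]) blast+
    then show "\<bar>fst ((\<psi> \<circ> h) (v t z))\<bar> < \<bar>fst ((\<psi> \<circ> h) z)\<bar>" using T(2) by simp
  next
    fix z t assume "0 < t \<and> (\<forall>s\<in>{0..t}. v s z \<in> square 2 ?U (\<psi> \<circ> h) \<and> 1/2 \<le> \<bar>snd ((\<psi> \<circ> h) (v s z))\<bar>)"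
    then have a: "0 < t" "\<And>s. s \<in> {0..t} \<Longrightarrow> v s z \<in> U \<and> h (v s z) \<in> square 2 W \<psi> \<and> 1/2 \<le> \<bar>snd (\<psi> (h (v s z)))\<bar>"
      by (auto simp: sq)
    then obtain T where T: "0 < T" "h (v t z) = w T (h z)" "\<And>\<tau>. \<tau> \<in> {0..T} \<Longrightarrow> \<exists>s\<in>{0..t}. w \<tau> (h z) = h (v s z)"
      by (metis maps_orbit_arcsE[OF h w])
    have "w \<tau> (h z) \<in> square 2 W \<psi> \<and> 1/2 \<le> \<bar>snd (\<psi> (w \<tau> (h z)))\<bar>" if "\<tau> \<in> {0..T}" for \<tau>
      using T(3)[OF that] a(2) by auto
    then have "\<bar>snd (\<psi> (h z))\<bar> < \<bar>snd (\<psi> (w T (h z)))\<bar>" by (intro saddle_box_mono(2)[OF sb T(1)]) blast+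
    then show "\<bar>snd ((\<psi> \<circ> h) z)\<bar> < \<bar>snd ((\<psi> \<circ> h) (v t z))\<bar>" using T(2) by simp
  next
    fix z z' assume a: "z \<noteq> z' \<and> (\<forall>t\<ge>0. v t z \<in> square 1 ?U (\<psi> \<circ> h) \<and> v t z' \<in> square 1 ?U (\<psi> \<circ> h))"
    then have "h z \<noteq> h z'" using inU ne by blast
    moreover have "w t (h z) \<in> square 1 W \<psi> \<and> w t (h z') \<in> square 1 W \<psi>" if "t \<ge> 0" for t
      using fwd a that by blast
    ultimately show "\<bar>snd ((\<psi> \<circ> h) z) - snd ((\<psi> \<circ> h) z')\<bar> < \<bar>fst ((\<psi> \<circ> h) z) - fst ((\<psi> \<circ> h) z')\<bar>"
      unfolding o_def by (intro saddle_box_stay(1)[OF sb])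
  next
    fix z z' assume a: "z \<noteq> z' \<and> (\<forall>t\<le>0. v t z \<in> square 1 ?U (\<psi> \<circ> h) \<and> v t z' \<in> square 1 ?U (\<psi> \<circ> h))"
    then have "h z \<noteq> h z'" using inU ne by blast
    moreover have "w t (h z) \<in> square 1 W \<psi> \<and> w t (h z') \<in> square 1 W \<psi>" if "t \<le> 0" for t
      using bwd a that by blast
    ultimately show "\<bar>fst ((\<psi> \<circ> h) z) - fst ((\<psi> \<circ> h) z')\<bar> < \<bar>snd ((\<psi> \<circ> h) z) - snd ((\<psi> \<circ> h) z')\<bar>"
      unfolding o_def by (intro saddle_box_stay(2)[OF sb])
  qed
qed

section \<open>Eigencoordinates of a model saddle\<close>

lemma plane_basis_coordinates:
  fixes a b :: "real^2"
  assumes "a $ 1 * b $ 2 \<noteq> a $ 2 * b $ 1"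
  obtains N :: "real^2 \<Rightarrow> real \<times> real"
  where "linear N" "\<And>P. N (fst P *\<^sub>R a + snd P *\<^sub>R b) = P" "\<And>z. fst (N z) *\<^sub>R a + snd (N z) *\<^sub>R b = z"
proof -
  define d where "d = a $ 1 * b $ 2 - a $ 2 * b $ 1"
  have d: "d \<noteq> 0" using assms by (simp add: d_def)
  \<comment> \<open>Cramer's rule for the matrix with columns a and b.\<close>
  define N where "N z = ((z $ 1 * b $ 2 - z $ 2 * b $ 1) / d, (a $ 1 * z $ 2 - a $ 2 * z $ 1) / d)" for z :: "real^2"
  show thesis
  proof
    show "linear N"
      by (rule linearI) (auto simp: N_def add_divide_distrib diff_divide_distrib algebra_simps)
    show "N (fst P *\<^sub>R a + snd P *\<^sub>R b) = P" for P
    proof -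
      have "(fst P * a $ 1 + snd P * b $ 1) * b $ 2 - (fst P * a $ 2 + snd P * b $ 2) * b $ 1 = fst P * d"
        "a $ 1 * (fst P * a $ 2 + snd P * b $ 2) - a $ 2 * (fst P * a $ 1 + snd P * b $ 1) = snd P * d"
        by (simp_all add: d_def algebra_simps)
      then show ?thesis using d by (simp add: N_def)
    qed
    show "fst (N z) *\<^sub>R a + snd (N z) *\<^sub>R b = z" for z
    proof -
      have "(z $ 1 * b $ 2 - z $ 2 * b $ 1) * a $ i + (a $ 1 * z $ 2 - a $ 2 * z $ 1) * b $ i = d * z $ i" for i
        using exhaust_2[of i] by (auto simp: d_def algebra_simps)
      then have "(z $ 1 * b $ 2 - z $ 2 * b $ 1) / d * a $ i + (a $ 1 * z $ 2 - a $ 2 * z $ 1) / d * b $ i = z $ i" for i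
        using d by (simp flip: add_divide_distrib)
      then show ?thesis by (simp add: N_def vec_eq_iff)
    qed
  qed
qed

lemma C1_flow_derivative:
  assumes "((\<lambda>(t, x). w t x) has_derivative D) (at (t, x))"
  shows "(w t has_derivative (\<lambda>\<xi>. D (0, \<xi>))) (at x)"
proof -
  have "((\<lambda>x. (t, x)) has_derivative (\<lambda>\<xi>. (0, \<xi>))) (at x)" by (auto intro!: derivative_eq_intros)
  from has_derivative_compose[OF this, of "\<lambda>(t, x). w t x" D] assms show ?thesis by simp
qed

lemma eigenvectors_independent:
  fixes a b :: "real^2"
  assumes "linear A" "A a = c *\<^sub>R a" "A b = \<mu> *\<^sub>R b" "c \<noteq> \<mu>" "a \<noteq> 0" "b \<noteq> 0"
  shows "a $ 1 * b $ 2 \<noteq> a $ 2 * b $ 1"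
proof
  assume eq: "a $ 1 * b $ 2 = a $ 2 * b $ 1"
  have "a $ i = 0" for i
  proof -
    have "a $ i *\<^sub>R b = b $ i *\<^sub>R a"
      using eq exhaust_2[of i] by (auto simp: vec_eq_iff forall_2 mult.commute)
    then have "a $ i *\<^sub>R A b = b $ i *\<^sub>R A a"
      using linear_scale[OF assms(1)] by metis
    then have "\<mu> *\<^sub>R (a $ i *\<^sub>R b) = c *\<^sub>R (b $ i *\<^sub>R a)" by (simp add: assms mult.commute)
    with \<open>a $ i *\<^sub>R b = b $ i *\<^sub>R a\<close> have "\<mu> *\<^sub>R (a $ i *\<^sub>R b) = c *\<^sub>R (a $ i *\<^sub>R b)" by metis
    then have "(\<mu> - c) *\<^sub>R (a $ i *\<^sub>R b) = 0" by (simp only: scaleR_diff_left diff_self)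
    then have "a $ i *\<^sub>R b = 0" using assms(4) by (simp only: scaleR_eq_0_iff) simp
    then show ?thesis using assms(6) by simp
  qed
  then show False using \<open>a \<noteq> 0\<close> by (simp add: vec_eq_iff)
qed

text \<open>Continuity of the derivative enters here: near q the derivative of \<open>w t\<close> is
  close to the one at q, uniformly for t in [0, 1]. By the mean value inequality \<open>F t\<close>
  minus its linear part is then Lipschitz with a small constant, which is the linearization estimate
  of the locale.\<close>

lemma C1_saddle_coordinates:
  assumes "C1_saddle w q"
  obtains N F l m and M :: "real \<times> real \<Rightarrow> real^2"
  where "hyperbolic_planar_flow F l m" "linear M" "linear N" "\<And>P. N (M P) = P" "\<And>z. M (N z) = z"
    "\<And>t P. F t P = N (w t (q + M P) - q)"
proof -
  obtain l m a b where lm: "l < 0" "0 < m" "a \<noteq> 0" "b \<noteq> 0"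
    and eig: "\<And>t. frechet_derivative (w t) (at q) a = exp (l * t) *\<^sub>R a"
      "\<And>t. frechet_derivative (w t) (at q) b = exp (m * t) *\<^sub>R b"
    and w: "C1_flow w" and fixq: "\<And>t. w t q = q"
    using assms unfolding C1_saddle_def by blast
  obtain D where D: "continuous_on UNIV D" "\<And>z. ((\<lambda>(t, x). w t x) has_derivative blinfun_apply (D z)) (at z)"
    and flow: "flow w"
    using w unfolding C1_flow_def by blast
  have Dw: "(w t has_derivative (\<lambda>\<xi>. D (t, x) (0, \<xi>))) (at x)" for t x
    by (rule C1_flow_derivative) (rule D(2))
  have eigD: "D (t, q) (0, a) = exp (l * t) *\<^sub>R a" "D (t, q) (0, b) = exp (m * t) *\<^sub>R b" for t
    using eig frechet_derivative_at[OF Dw[of t q]] by metis+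
  have "a $ 1 * b $ 2 \<noteq> a $ 2 * b $ 1"
  proof (rule eigenvectors_independent)
    show "linear (\<lambda>\<xi>. D (1, q) (0, \<xi>))" using Dw has_derivative_linear by blast
    show "D (1, q) (0, a) = exp (l * 1) *\<^sub>R a" "D (1, q) (0, b) = exp (m * 1) *\<^sub>R b" by (rule eigD)+
  qed (use lm in auto)
  then obtain N :: "real^2 \<Rightarrow> real \<times> real" where N: "linear N"
    "\<And>P. N (fst P *\<^sub>R a + snd P *\<^sub>R b) = P" "\<And>z. fst (N z) *\<^sub>R a + snd (N z) *\<^sub>R b = z"
    using plane_basis_coordinates by metis
  define M where "M P = fst P *\<^sub>R a + snd P *\<^sub>R b" for P :: "real \<times> real"
  have M: "linear M" by (rule linearI) (auto simp: M_def algebra_simps)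
  have NM: "N (M P) = P" and MN: "M (N z) = z" for P z using N by (auto simp: M_def)
  have bl: "bounded_linear M" "bounded_linear N" using M N(1) by (simp_all add: linear_conv_bounded_linear)
  define F where "F t P = N (w t (q + M P) - q)" for t P
  have "hyperbolic_planar_flow F l m"
  proof
    show "flow F"
      unfolding flow_def
    proof (intro conjI allI)
      have "continuous_on UNIV (\<lambda>z. N (w (fst z) (q + M (snd z)) - q))"
        by (intro linear_continuous_on_compose[OF _ N(1)] linear_continuous_on_compose[OF _ M]
            continuous_intros continuous_on_flow[OF flow])
      then show "continuous_on UNIV (\<lambda>(t, x). F t x)" by (simp add: F_def case_prod_beta)
    qed (simp_all add: F_def flow_zero[OF flow] NM MN flow_add[OF flow])
    show "F t 0 = 0" for t using linear_0[OF M] linear_0[OF N(1)] by (simp add: F_def fixq)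
    fix \<epsilon> :: real assume "\<epsilon> > 0"
    obtain K where K: "K > 0" "\<And>x. norm (N x) \<le> norm x * K" using bounded_linear.pos_bounded[OF bl(2)] by blast
    obtain L where L: "L > 0" "\<And>x. norm (M x) \<le> norm x * L" using bounded_linear.pos_bounded[OF bl(1)] by blast
    \<comment> \<open>K and L bound the norms of N and M, between which the derivative of the flow
      is composed.\<close>
    define \<delta> where "\<delta> = \<epsilon> / (K * L)"
    have \<delta>: "\<delta> > 0" "\<delta> * L * K = \<epsilon>" using \<open>\<epsilon> > 0\<close> K L by (auto simp: \<delta>_def)
    have "continuous_on (UNIV \<times> {0..1}) (\<lambda>z. D (snd z, q + M (fst z)))"
      by (intro continuous_on_compose2[OF D(1)] continuous_intros linear_continuous_on_compose[OF _ M]) auto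
    from continuous_on_prod_compactE[OF this compact_Icc _ \<delta>(1), of 0]
    obtain X0 where X0: "0 \<in> X0" "open X0" "\<forall>x\<in>X0 \<inter> UNIV. \<forall>t\<in>{0..1}. dist (D (t, q + M x)) (D (t, q + M 0)) \<le> \<delta>"
      by auto
    obtain \<rho> where \<rho>: "\<rho> > 0" "cball 0 \<rho> \<subseteq> X0" using X0 open_contains_cball by blast
    have close: "norm (D (t, q + M P) - D (t, q)) \<le> \<delta>" if "t \<in> {0..1}" "P \<in> cball 0 \<rho>" for t P
      using X0(3) \<rho>(2) that linear_0[OF M] by (auto simp: dist_norm)
    have DF: "((\<lambda>P. F t P - (exp (l * t) * fst P, exp (m * t) * snd P)) has_derivative
        (\<lambda>\<xi>. N ((D (t, q + M P) - D (t, q)) (0, M \<xi>)))) (at P within S)" for t P S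
    proof -
      have 1: "((\<lambda>P. w t (q + M P)) has_derivative (\<lambda>\<xi>. D (t, q + M P) (0, M \<xi>))) (at P within S)"
        by (rule has_derivative_compose[OF _ Dw, where f = "\<lambda>P. q + M P"])
          (auto intro!: derivative_eq_intros bounded_linear.has_derivative[OF bl(1)])
      have "(F t has_derivative (\<lambda>\<xi>. N (D (t, q + M P) (0, M \<xi>)))) (at P within S)"
        unfolding F_def by (rule bounded_linear.has_derivative[OF bl(2)]) (use has_derivative_diff[OF 1 has_derivative_const] in simp)
      moreover have "N (D (t, q) (0, M \<xi>)) = (exp (l * t) * fst \<xi>, exp (m * t) * snd \<xi>)" for \<xi>
      proof -
        have "D (t, q) (0, M \<xi>) = M (exp (l * t) * fst \<xi>, exp (m * t) * snd \<xi>)"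
          using linear_add[OF has_derivative_linear[OF Dw[of t q]]] linear_scale[OF has_derivative_linear[OF Dw[of t q]]]
          by (simp add: M_def eigD mult.commute)
        then show ?thesis by (simp add: NM)
      qed
      then have "(\<lambda>\<xi>. N ((D (t, q + M P) - D (t, q)) (0, M \<xi>))) =
          (\<lambda>\<xi>. N (D (t, q + M P) (0, M \<xi>)) - (exp (l * t) * fst \<xi>, exp (m * t) * snd \<xi>))"
        by (simp add: blinfun.diff_left linear_diff[OF N(1)])
      moreover have "((\<lambda>P. (exp (l * t) * fst P, exp (m * t) * snd P)) has_derivative
          (\<lambda>\<xi>. (exp (l * t) * fst \<xi>, exp (m * t) * snd \<xi>))) (at P within S)"
        by (auto intro!: derivative_eq_intros)
      ultimately show ?thesis using has_derivative_diff by fastforce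
    qed
    have bound: "norm ((F t P - (exp (l * t) * fst P, exp (m * t) * snd P)) - (F t P' - (exp (l * t) * fst P', exp (m * t) * snd P')))
        \<le> \<epsilon> * norm (P - P')" if t: "t \<in> {0..1}" and P: "P \<in> cball 0 \<rho>" "P' \<in> cball 0 \<rho>" for t P P'
    proof (rule differentiable_bound[OF convex_cball DF _ P])
      fix P assume "P \<in> cball (0 :: real \<times> real) \<rho>"
      show "onorm (\<lambda>\<xi>. N ((D (t, q + M P) - D (t, q)) (0, M \<xi>))) \<le> \<epsilon>"
      proof (rule onorm_le)
        fix \<xi>
        have "norm (N ((D (t, q + M P) - D (t, q)) (0, M \<xi>))) \<le> norm ((D (t, q + M P) - D (t, q)) (0, M \<xi>)) * K"
          by (rule K)
        also have "\<dots> \<le> (norm (D (t, q + M P) - D (t, q)) * norm (0 :: real, M \<xi>)) * K"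
          using K by (intro mult_right_mono norm_blinfun) auto
        also have "\<dots> \<le> (\<delta> * (norm \<xi> * L)) * K"
          using K close[OF t \<open>P \<in> cball 0 \<rho>\<close>] L(2)[of \<xi>] \<delta> by (intro mult_right_mono mult_mono) (auto simp: norm_Pair)
        also have "\<dots> = \<epsilon> * norm \<xi>" by (simp add: mult_ac flip: \<delta>(2))
        finally show "norm (N ((D (t, q + M P) - D (t, q)) (0, M \<xi>))) \<le> \<epsilon> * norm \<xi>" .
      qed
    qed
    show "\<exists>\<rho>>0. \<forall>t\<in>{0..1}. \<forall>P P'. norm P \<le> \<rho> \<longrightarrow> norm P' \<le> \<rho> \<longrightarrow>
       \<bar>fst (F t P) - fst (F t P') - exp (l * t) * (fst P - fst P')\<bar> \<le> \<epsilon> * norm (P - P') \<and>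
       \<bar>snd (F t P) - snd (F t P') - exp (m * t) * (snd P - snd P')\<bar> \<le> \<epsilon> * norm (P - P')"
    proof (intro exI[of _ \<rho>] conjI ballI allI impI \<rho>(1))
      fix t P P' assume a: "t \<in> {0..1::real}" "norm (P :: real \<times> real) \<le> \<rho>" "norm (P' :: real \<times> real) \<le> \<rho>"
      let ?d = "(F t P - (exp (l * t) * fst P, exp (m * t) * snd P)) - (F t P' - (exp (l * t) * fst P', exp (m * t) * snd P'))"
      have d: "norm ?d \<le> \<epsilon> * norm (P - P')" using a by (intro bound) auto
      have "\<bar>fst ?d\<bar> \<le> norm ?d" "\<bar>snd ?d\<bar> \<le> norm ?d"
        using norm_fst_le[of "fst ?d" "snd ?d"] norm_snd_le[of "snd ?d" "fst ?d"]
        unfolding real_norm_def prod.collapse by blast+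
      then show "\<bar>fst (F t P) - fst (F t P') - exp (l * t) * (fst P - fst P')\<bar> \<le> \<epsilon> * norm (P - P')"
        "\<bar>snd (F t P) - snd (F t P') - exp (m * t) * (snd P - snd P')\<bar> \<le> \<epsilon> * norm (P - P')"
        using d by (auto simp: algebra_simps)
    qed
  qed (use lm in auto)
  then show thesis using that M N(1) NM MN by (auto simp: F_def)
qed

text \<open>The affine eigencoordinates conjugate w to the model F without a change of time.
  Composed with the given orbit equivalence they relate v to F, and the box at the origin is pulled
  back.\<close>

lemma saddle_imp_saddle_box:
  fixes v :: "real \<Rightarrow> 'a::t2_space \<Rightarrow> 'a"
  assumes v: "flow v" and "saddle v p"
  shows "\<exists>U \<psi>. saddle_box v p U \<psi>"
proof -
  obtain w q where p: "\<And>t. v t p = p" and w: "C1_saddle w q" and "locally_orbit_equivalent v p w q"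
    using assms unfolding saddle_def by blast
  then obtain U V h k where UV: "open U" "p \<in> U" "open V" "q \<in> V" "homeomorphism U V h k" "h p = q"
    and arcs: "maps_orbit_arcs h v U w" "maps_orbit_arcs k w V v"
    unfolding locally_orbit_equivalent_def by blast
  obtain N F l m and M :: "real \<times> real \<Rightarrow> real^2"
    where hyp: "hyperbolic_planar_flow F l m" and M: "linear M" and N: "linear N"
    and NM: "\<And>P. N (M P) = P" and MN: "\<And>z. M (N z) = z"
    and F: "\<And>t P. F t P = N (w t (q + M P) - q)"
    using C1_saddle_coordinates[OF w] by metis
  interpret hyperbolic_planar_flow F l m by (rule hyp)
  let ?g = "\<lambda>y. N (y - q)" and ?i = "\<lambda>P. q + M P"
  have conj: "?g (w t y) = F t (?g y)" "w t (?i P) = ?i (F t P)" for t y P by (simp_all add: F MN)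
  have hom_g: "homeomorphism V (?g ` V) ?g ?i"
    by (intro homeomorphismI) (auto simp: NM MN
        intro!: continuous_intros linear_continuous_on_compose[OF _ N] linear_continuous_on_compose[OF _ M])
  have "?g ` V = ?i -` V"
  proof (intro subset_antisym subsetI)
    fix P assume "P \<in> ?i -` V"
    then show "P \<in> ?g ` V" by (intro image_eqI[of _ _ "?i P"]) (auto simp: NM)
  qed (auto simp: MN)
  moreover have "open (?i -` V)"
    using UV(3) by (intro open_vimage continuous_intros linear_continuous_on_compose[OF _ M])
  ultimately have open_g: "open (?g ` V)" by simp
  have "0 \<in> ?g ` V" using UV(4) linear_0[OF N] by force
  then obtain W \<psi> where W: "W \<subseteq> ?g ` V" "saddle_box F 0 W \<psi>"
    using saddle_box_at_origin[OF open_g] by blast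
  have "maps_orbit_arcs (?g \<circ> h) v U F"
    using arcs(1) unfolding maps_orbit_arcs_def o_def by (metis conj(1))
  moreover have "maps_orbit_arcs (k \<circ> ?i) F (?g ` V) v"
    unfolding maps_orbit_arcs_def
  proof (intro allI impI, elim conjE)
    fix P t assume t: "0 \<le> t" and arc: "\<forall>s\<in>{0..t}. F s P \<in> ?g ` V"
    have "w s (?i P) \<in> V" if "s \<in> {0..t}" for s
      using arc that \<open>?g ` V = ?i -` V\<close> by (auto simp: conj(2))
    then obtain \<sigma> where "\<sigma> 0 = 0 \<and> continuous_on {0..t} \<sigma> \<and> strict_mono_on {0..t} \<sigma> \<and>
             (\<forall>s\<in>{0..t}. k (w s (?i P)) = v (\<sigma> s) (k (?i P)))"
      using arcs(2) t unfolding maps_orbit_arcs_def by metis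
    then show "\<exists>\<sigma>. \<sigma> 0 = 0 \<and> continuous_on {0..t} \<sigma> \<and> strict_mono_on {0..t} \<sigma> \<and>
             (\<forall>s\<in>{0..t}. (k \<circ> ?i) (F s P) = v (\<sigma> s) ((k \<circ> ?i) P))"
      by (auto simp: conj(2))
  qed
  ultimately show ?thesis
    using saddle_box_transfer[OF v flow_F homeomorphism_compose[OF UV(5) hom_g] UV(1) open_g UV(2) _ p _ _ W(2,1)]
      UV(6) linear_0[OF N] by auto
qed

section \<open>Flows on compact spaces\<close>

definition orbit :: "(real \<Rightarrow> 'a \<Rightarrow> 'a) \<Rightarrow> 'a \<Rightarrow> 'a set" where
  "orbit v x = range (\<lambda>t. v t x)"

locale compact_flow =
  fixes v :: "real \<Rightarrow> 'a::t2_space \<Rightarrow> 'a"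
  assumes flow: "flow v" and compact_space: "compact (UNIV :: 'a set)"
begin

lemma v_add: "v s (v t x) = v (s + t) x"
  by (rule flow_add[OF flow])

lemma v_0 [simp]: "v 0 x = x"
  by (rule flow_zero[OF flow])

lemma v_minus [simp]: "v (- t) (v t x) = x" "v t (v (- t) x) = x"
  by (simp_all add: v_add)

lemma v_inj: "v t x = v t y \<longleftrightarrow> x = y"
  by (metis v_minus(1))

lemma continuous_on_v [continuous_intros]:
  "continuous_on A f \<Longrightarrow> continuous_on A g \<Longrightarrow> continuous_on A (\<lambda>s. v (f s) (g s))"
  by (rule continuous_on_flow[OF flow])

lemma compact_flow_reverse: "compact_flow (\<lambda>t. v (- t))"
  by (rule compact_flow.intro[OF flow_reverse[OF flow] compact_space])

lemma closed_imp_compact: "closed (K :: 'a set) \<Longrightarrow> compact K"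
  using closed_Int_compact[OF _ compact_space] by auto

text \<open>The type is merely Hausdorff, so limit points are handled by neighbourhoods instead of
  sequences of times.\<close>

lemma omega_iff:
  "y \<in> omega_limit v x \<longleftrightarrow> (\<forall>W. open W \<and> y \<in> W \<longrightarrow> (\<forall>n. \<exists>t>n. v t x \<in> W))"
proof -
  have "y \<in> closure S \<longleftrightarrow> (\<forall>W. open W \<and> y \<in> W \<longrightarrow> W \<inter> S \<noteq> {})" for S
  proof
    assume "\<forall>W. open W \<and> y \<in> W \<longrightarrow> W \<inter> S \<noteq> {}"
    then show "y \<in> closure S" using closure_subset[of S] by (elim allE[of _ "- closure S"]) auto
  qed (use open_Int_closure_eq_empty in blast)
  moreover have "W \<inter> {v t x |t. t > n} \<noteq> {} \<longleftrightarrow> (\<exists>t>n. v t x \<in> W)" for W n by auto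
  ultimately have "y \<in> omega_limit v x \<longleftrightarrow> (\<forall>n. \<forall>W. open W \<and> y \<in> W \<longrightarrow> (\<exists>t>n. v t x \<in> W))"
    unfolding omega_limit_def INT_iff ball_UNIV by presburger
  then show ?thesis by iprover
qed

lemma alpha_omega: "alpha_limit v x = omega_limit (\<lambda>t. v (- t)) x"
proof -
  have "{v t x |t. t < n} = {v (- t) x |t. t > - n}" for n
    by (metis minus_less_iff neg_less_iff_less verit_minus_simplify(4))
  then have "alpha_limit v x = (\<Inter>n. closure {v (- t) x |t. t > - n})" by (simp add: alpha_limit_def)
  also have "\<dots> = (\<Inter>n. closure {v (- t) x |t. t > n})"
  proof -
    have "(\<Inter>n. A (- n)) = (\<Inter>n. A n)" for A :: "real \<Rightarrow> 'a set"
      by (auto, metis minus_minus)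
    then show ?thesis .
  qed
  finally show ?thesis by (simp add: omega_limit_def)
qed

lemma closed_omega: "closed (omega_limit v x)"
  unfolding omega_limit_def by (intro closed_INT ballI closed_closure)

text \<open>The complement of N is compact and covered by the increasing complements of the closed
  tails, so a single tail already avoids it.\<close>

lemma eventually_near_omega:
  assumes "open N" "omega_limit v x \<subseteq> N"
  shows "\<exists>T. \<forall>t>T. v t x \<in> N"
proof -
  let ?F = "\<lambda>n. closure {v t x |t. t > n}"
  have "compact (- N)" using assms(1) by (intro closed_imp_compact) auto
  have cover: "- N \<subseteq> (\<Union>n\<in>UNIV. - ?F n)" using assms(2) by (auto simp: omega_limit_def)
  have op: "open (- ?F n)" for n by (simp add: open_Compl)
  obtain I where I: "I \<subseteq> UNIV" "finite I" "- N \<subseteq> (\<Union>n\<in>I. - ?F n)"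
    by (rule compactE_image[OF \<open>compact (- N)\<close> op cover])
  have "v t x \<in> N" if "t > Max (insert 0 I)" for t
  proof (rule ccontr)
    assume "v t x \<notin> N"
    then obtain n where "n \<in> I" "v t x \<notin> ?F n" using I(3) by auto
    moreover have "n < t" using that I(2) \<open>n \<in> I\<close> by (meson Max_ge finite_insert insertI2 le_less_trans)
    ultimately show False using closure_subset[of "{v t x |t. t > n}"] by auto
  qed
  then show ?thesis by blast
qed

lemma omega_nonempty: "omega_limit v x \<noteq> {}"
  using eventually_near_omega[of "{}" x] gt_ex by auto

lemma omega_invariant: "y \<in> omega_limit v x \<Longrightarrow> v s y \<in> omega_limit v x"
  unfolding omega_iff
proof (intro allI impI)
  fix W n assume y: "\<forall>W. open W \<and> y \<in> W \<longrightarrow> (\<forall>n. \<exists>t>n. v t x \<in> W)" and W: "open W \<and> v s y \<in> W"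
  have "open (v s -` W)" using W by (intro open_vimage continuous_intros) auto
  then obtain t where "t > n - s" "v t x \<in> v s -` W" using y W by blast
  then show "\<exists>t>n. v t x \<in> W" by (intro exI[of _ "s + t"]) (auto simp: v_add)
qed

lemma omega_orbit [simp]: "omega_limit v (v s x) = omega_limit v x"
proof -
  have "y \<in> omega_limit v (v s x)" if y: "y \<in> omega_limit v x" for x y s
    unfolding omega_iff
  proof (intro allI impI)
    fix W n assume W: "open W \<and> y \<in> W"
    obtain t where "t > n + s" "v t x \<in> W" using y[unfolded omega_iff, rule_format, of W "n + s"] W by auto
    then show "\<exists>t>n. v t (v s x) \<in> W" by (intro exI[of _ "t - s"]) (simp add: v_add)
  qed
  then have "omega_limit v x \<subseteq> omega_limit v (v s x)" for x s by blast
  from this[of x s] this[of "v s x" "- s"] show ?thesis by simp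
qed

lemma omega_subset_closed:
  assumes "closed K" "\<And>t. t > T \<Longrightarrow> v t x \<in> K"
  shows "omega_limit v x \<subseteq> K"
proof -
  have "closure {v t x |t. t > T} \<subseteq> K" using assms by (intro closure_minimal) auto
  then show ?thesis unfolding omega_limit_def by blast
qed

lemma omega_of_omega: "y \<in> omega_limit v x \<Longrightarrow> omega_limit v y \<subseteq> omega_limit v x"
  by (rule omega_subset_closed[OF closed_omega]) (rule omega_invariant)

lemma omega_fixed: "(\<And>t. v t p = p) \<Longrightarrow> omega_limit v p = {p}"
  using omega_subset_closed[of "{p}" 0 p] omega_nonempty[of p] by auto

lemma orbit_subset_closed_invariant:
  "(\<And>y s. y \<in> A \<Longrightarrow> v s y \<in> A) \<Longrightarrow> x \<in> A \<Longrightarrow> orbit v x \<subseteq> A"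
  by (auto simp: orbit_def)

lemma orbit_eqI: "y \<in> orbit v x \<Longrightarrow> orbit v y = orbit v x"
proof -
  assume "y \<in> orbit v x"
  then obtain t where y: "y = v t x" by (auto simp: orbit_def)
  have "v s x \<in> range (\<lambda>s. v s y)" for s by (rule range_eqI[of _ _ "s - t"]) (simp add: y v_add)
  moreover have "v s y \<in> range (\<lambda>s. v s x)" for s by (rule range_eqI[of _ _ "s + t"]) (simp add: y v_add)
  ultimately show ?thesis unfolding orbit_def by blast
qed

lemma orbit_self: "x \<in> orbit v x"
  by (metis orbit_def rangeI v_0)

lemma tube:
  assumes "open W" "compact I" "\<And>s. s \<in> I \<Longrightarrow> v s z \<in> W"
  obtains N where "open N" "z \<in> N" "\<And>z' s. z' \<in> N \<Longrightarrow> s \<in> I \<Longrightarrow> v s z' \<in> W"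
proof -
  let ?W = "(\<lambda>z. v (snd z) (fst z)) -` W"
  have op: "open ?W" using assms(1) by (intro open_vimage continuous_intros)
  have sub: "{z} \<times> I \<subseteq> ?W" using assms(3) by auto
  obtain N where N: "z \<in> N" "open N" "N \<times> I \<subseteq> ?W"
    using Elementary_Topology.tube_lemma[OF assms(2) op sub] by (elim exE conjE)
  have "v s z' \<in> W" if "z' \<in> N" "s \<in> I" for z' s
    using subsetD[OF N(3), of "(z', s)"] that by simp
  then show thesis by (rule that[OF N(2,1)])
qed

lemma short_arc:
  assumes "open W" "z \<in> W"
  obtains \<epsilon> where "\<epsilon> > 0" "\<And>s. \<bar>s\<bar> \<le> \<epsilon> \<Longrightarrow> v s z \<in> W"
proof -
  have "open ((\<lambda>s. v s z) -` W)" using assms(1) by (intro open_vimage continuous_intros)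
  moreover have "0 \<in> (\<lambda>s. v s z) -` W" using assms(2) by simp
  ultimately obtain \<epsilon> where "\<epsilon> > 0" "cball 0 \<epsilon> \<subseteq> (\<lambda>s. v s z) -` W" using open_contains_cball by blast
  then show thesis by (intro that[of \<epsilon>]) (auto simp: dist_real_def)
qed

text \<open>T is the infimum of the times outside K. Closedness keeps the orbit in K up to and
  including T, so the times outside K accumulate at T from the right.\<close>

lemma first_exit:
  assumes "closed K" "z \<in> K" "t0 \<ge> 0" "v t0 z \<notin> K"
  obtains T where "0 \<le> T" "T < t0" "\<And>s. s \<in> {0..T} \<Longrightarrow> v s z \<in> K" "\<And>\<epsilon>. \<epsilon> > 0 \<Longrightarrow> \<exists>s. T < s \<and> s < T + \<epsilon> \<and> v s z \<notin> K"
proof -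
  define B where "B = {\<tau>. \<tau> \<ge> 0 \<and> v \<tau> z \<notin> K}"
  define T where "T = Inf B"
  have B: "t0 \<in> B" "bdd_below B" using assms by (auto simp: B_def intro!: bdd_belowI[of _ 0])
  have T0: "T \<ge> 0" unfolding T_def using B by (intro cInf_greatest) (auto simp: B_def)
  have before: "v s z \<in> K" if "0 \<le> s" "s < T" for s
    using that B cInf_lower[of s B] by (force simp: B_def T_def)
  have TK: "v T z \<in> K"
  proof (cases "T = 0")
    case False
    have "closed ((\<lambda>s. v s z) -` K)"
      using assms(1) by (intro closed_vimage continuous_intros)
    moreover have "{0..<T} \<subseteq> (\<lambda>s. v s z) -` K" using before by auto
    ultimately have "closure {0..<T} \<subseteq> (\<lambda>s. v s z) -` K" by (rule closure_minimal[rotated])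
    then show ?thesis using False T0 by (auto simp: closure_atLeastLessThan)
  qed (use assms in simp)
  show thesis
  proof
    show "0 \<le> T" by (rule T0)
    have "T \<le> t0" unfolding T_def using B by (intro cInf_lower)
    then show "T < t0" using TK assms(4) by (cases "T = t0") auto
    show "v s z \<in> K" if "s \<in> {0..T}" for s using before[of s] TK that by (cases "s = T") auto
    fix \<epsilon> :: real assume "\<epsilon> > 0"
    then obtain s where "s \<in> B" "s < T + \<epsilon>"
      using cInf_lessD[of B "T + \<epsilon>"] B by (auto simp: T_def)
    moreover have "v s z \<notin> K" "0 \<le> s" using \<open>s \<in> B\<close> by (auto simp: B_def)
    moreover from this have "s \<noteq> T" "\<not> s < T" using before[of s] TK by auto
    ultimately show "\<exists>s. T < s \<and> s < T + \<epsilon> \<and> v s z \<notin> K" by (intro exI[of _ s]) auto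
  qed
qed

end

text \<open>Reversing time exchanges contraction and expansion, and exchanging the coordinates
  restores the form of the box. Thus every fact about stable branches and exits has a dual about
  unstable branches and entrances.\<close>

lemma saddle_box_reverse:
  assumes flow: "flow v" and sb: "saddle_box v p U \<psi>"
  shows "saddle_box (\<lambda>t. v (- t)) p U (prod.swap \<circ> \<psi>)"
proof -
  have sq: "square c U (prod.swap \<circ> \<psi>) = square c U \<psi>" for c by (auto simp: square_def)
  have arc: "v s (v (- t) z) = v (- (t - s)) z" for s t z by (simp add: flow_add[OF flow])
  show ?thesis
    unfolding saddle_box_def sq
  proof (intro conjI allI impI)
    obtain V k where V: "open V" "homeomorphism U V \<psi> k" "{-2..2} \<times> {-2..2} \<subseteq> V"
      by (rule saddle_box_chart[OF sb])
    have "homeomorphism V (prod.swap ` V) prod.swap prod.swap"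
      by (rule homeomorphismI) (auto intro: continuous_on_swap)
    from homeomorphism_compose[OF V(2) this]
    have "homeomorphism U (prod.swap ` V) (prod.swap \<circ> \<psi>) (k \<circ> prod.swap)" .
    moreover have "prod.swap ` V = prod.swap -` V"
    proof (intro subset_antisym subsetI)
      fix P assume "P \<in> prod.swap -` V"
      then show "P \<in> prod.swap ` V" by (intro image_eqI[of _ _ "prod.swap P"]) auto
    qed auto
    then have "open (prod.swap ` V)" using open_vimage[OF V(1) continuous_on_swap] by simp
    moreover have "{-2..2} \<times> {-2..2} \<subseteq> prod.swap ` V"
      using image_mono[OF V(3), of prod.swap] by (simp add: product_swap)
    ultimately show "\<exists>V k. open V \<and> homeomorphism U V (prod.swap \<circ> \<psi>) k \<and> {-2..2} \<times> {-2..2} \<subseteq> V" by metis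
  next
    fix z t assume a: "0 < t \<and> (\<forall>s\<in>{0..t}. v (- s) z \<in> square 2 U \<psi> \<and> 1/2 \<le> \<bar>fst ((prod.swap \<circ> \<psi>) (v (- s) z))\<bar>)"
    have "\<bar>snd (\<psi> (v (- t) z))\<bar> < \<bar>snd (\<psi> (v t (v (- t) z)))\<bar>"
    proof (rule saddle_box_mono(2)[OF sb])
      fix s assume "s \<in> {0..t}"
      then have "t - s \<in> {0..t}" by auto
      with a show "v s (v (- t) z) \<in> square 2 U \<psi>" "1/2 \<le> \<bar>snd (\<psi> (v s (v (- t) z)))\<bar>"
        unfolding arc by (simp_all del: minus_diff_eq)
    qed (use a in simp)
    then show "\<bar>fst ((prod.swap \<circ> \<psi>) (v (- t) z))\<bar> < \<bar>fst ((prod.swap \<circ> \<psi>) z)\<bar>"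
      by (simp add: flow_add[OF flow] flow_zero[OF flow])
  next
    fix z t assume a: "0 < t \<and> (\<forall>s\<in>{0..t}. v (- s) z \<in> square 2 U \<psi> \<and> 1/2 \<le> \<bar>snd ((prod.swap \<circ> \<psi>) (v (- s) z))\<bar>)"
    have "\<bar>fst (\<psi> (v t (v (- t) z)))\<bar> < \<bar>fst (\<psi> (v (- t) z))\<bar>"
    proof (rule saddle_box_mono(1)[OF sb])
      fix s assume "s \<in> {0..t}"
      then have "t - s \<in> {0..t}" by auto
      with a show "v s (v (- t) z) \<in> square 2 U \<psi>" "1/2 \<le> \<bar>fst (\<psi> (v s (v (- t) z)))\<bar>"
        unfolding arc by (simp_all del: minus_diff_eq)
    qed (use a in simp)
    then show "\<bar>snd ((prod.swap \<circ> \<psi>) z)\<bar> < \<bar>snd ((prod.swap \<circ> \<psi>) (v (- t) z))\<bar>"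
      by (simp add: flow_add[OF flow] flow_zero[OF flow])
  next
    fix z z' assume a: "z \<noteq> z' \<and> (\<forall>t\<ge>0. v (- t) z \<in> square 1 U \<psi> \<and> v (- t) z' \<in> square 1 U \<psi>)"
    have "\<bar>fst (\<psi> z) - fst (\<psi> z')\<bar> < \<bar>snd (\<psi> z) - snd (\<psi> z')\<bar>"
    proof (rule saddle_box_stay(2)[OF sb])
      fix t :: real assume "t \<le> 0"
      then show "v t z \<in> square 1 U \<psi> \<and> v t z' \<in> square 1 U \<psi>" using a by (metis minus_minus neg_0_le_iff_le)
    qed (use a in simp)
    then show "\<bar>snd ((prod.swap \<circ> \<psi>) z) - snd ((prod.swap \<circ> \<psi>) z')\<bar> < \<bar>fst ((prod.swap \<circ> \<psi>) z) - fst ((prod.swap \<circ> \<psi>) z')\<bar>"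
      by simp
  next
    fix z z' assume a: "z \<noteq> z' \<and> (\<forall>t\<le>0. v (- t) z \<in> square 1 U \<psi> \<and> v (- t) z' \<in> square 1 U \<psi>)"
    have "\<bar>snd (\<psi> z) - snd (\<psi> z')\<bar> < \<bar>fst (\<psi> z) - fst (\<psi> z')\<bar>"
    proof (rule saddle_box_stay(1)[OF sb])
      fix t :: real assume "t \<ge> 0"
      then show "v t z \<in> square 1 U \<psi> \<and> v t z' \<in> square 1 U \<psi>" using a by (metis minus_minus neg_le_0_iff_le)
    qed (use a in simp)
    then show "\<bar>fst ((prod.swap \<circ> \<psi>) z) - fst ((prod.swap \<circ> \<psi>) z')\<bar> < \<bar>snd ((prod.swap \<circ> \<psi>) z) - snd ((prod.swap \<circ> \<psi>) z')\<bar>"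
      by simp
  qed (use saddle_boxD[OF sb] in simp_all)
qed

section \<open>The flow near a saddle\<close>

locale box_flow = compact_flow v for v :: "real \<Rightarrow> 'a::t2_space \<Rightarrow> 'a" +
  fixes p :: "'a::t2_space" and U :: "'a set" and \<psi> :: "'a \<Rightarrow> real \<times> real"
  assumes saddle_box: "saddle_box v p U \<psi>"
begin

abbreviation "X z \<equiv> fst (\<psi> z)"
abbreviation "Y z \<equiv> snd (\<psi> z)"
abbreviation "B \<equiv> square 1 U \<psi>"

definition pt :: "real \<times> real \<Rightarrow> 'a" where "pt = inv_into U \<psi>"

definition stay :: "'a set" where "stay = {z. \<forall>t\<ge>0. v t z \<in> B}"

lemma box_flow_reverse: "box_flow (\<lambda>t. v (- t)) p U (prod.swap \<circ> \<psi>)"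
  by (rule box_flow.intro[OF compact_flow_reverse box_flow_axioms.intro[OF saddle_box_reverse[OF flow saddle_box]]])

lemma square_swap [simp]: "square c U (prod.swap \<circ> \<psi>) = square c U \<psi>"
  by (auto simp: square_def)

lemma p_fixed [simp]: "v t p = p" and p_U: "p \<in> U" and \<psi>_p [simp]: "\<psi> p = (0, 0)"
  using saddle_boxD[OF saddle_box] by auto

lemma coords:
  shows continuous_on_coord: "continuous_on U \<psi>"
    and coord_eqD: "\<And>z z'. z \<in> U \<Longrightarrow> z' \<in> U \<Longrightarrow> \<psi> z = \<psi> z' \<Longrightarrow> z = z'"
    and pt_mem: "\<And>x y. \<bar>x\<bar> \<le> 2 \<Longrightarrow> \<bar>y\<bar> \<le> 2 \<Longrightarrow> pt (x, y) \<in> U"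
    and coord_pt: "\<And>x y. \<bar>x\<bar> \<le> 2 \<Longrightarrow> \<bar>y\<bar> \<le> 2 \<Longrightarrow> \<psi> (pt (x, y)) = (x, y)"
    and continuous_on_pt: "continuous_on ({-2..2} \<times> {-2..2}) pt"
proof -
  obtain V k where V: "homeomorphism U V \<psi> k" "{-2..2} \<times> {-2..2} \<subseteq> V"
    by (rule saddle_box_chart[OF saddle_box])
  show "continuous_on U \<psi>" by (rule homeomorphism_cont1[OF V(1)])
  show inj: "z = z'" if "z \<in> U" "z' \<in> U" "\<psi> z = \<psi> z'" for z z'
    using homeomorphism_apply1[OF V(1)] that by metis
  have k: "k P \<in> U" "\<psi> (k P) = P" if "P \<in> {-2..2} \<times> {-2..2}" for P
    using homeomorphism_mem(2)[OF V(1)] homeomorphism_apply2[OF V(1)] subsetD[OF V(2) that] by simp_all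
  have eq: "pt P = k P" if P: "P \<in> {-2..2} \<times> {-2..2}" for P
  proof -
    have "P \<in> \<psi> ` U" using k[OF P] by (metis imageI)
    then have "pt P \<in> U" "\<psi> (pt P) = P" by (simp_all add: pt_def inv_into_into f_inv_into_f)
    then show ?thesis using inj k[OF P] by simp
  qed
  show "pt (x, y) \<in> U" "\<psi> (pt (x, y)) = (x, y)" if "\<bar>x\<bar> \<le> 2" "\<bar>y\<bar> \<le> 2" for x y
  proof -
    have "(x, y) \<in> {-2..2} \<times> {-2..2}" using that by auto
    then show "pt (x, y) \<in> U" "\<psi> (pt (x, y)) = (x, y)" using k[of "(x, y)"] eq[of "(x, y)"] by simp_all
  qed
  have "continuous_on ({-2..2} \<times> {-2..2}) k"
    by (rule continuous_on_subset[OF homeomorphism_cont2[OF V(1)] V(2)])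
  then show "continuous_on ({-2..2} \<times> {-2..2}) pt"
    by (rule continuous_on_eq) (simp add: eq)
qed

lemma pt_coord: "z \<in> U \<Longrightarrow> \<bar>X z\<bar> \<le> 2 \<Longrightarrow> \<bar>Y z\<bar> \<le> 2 \<Longrightarrow> pt (X z, Y z) = z"
  using coord_eqD[of "pt (X z, Y z)" z] pt_mem[of "X z" "Y z"] coord_pt[of "X z" "Y z"] by simp

lemma open_coord: "open A \<Longrightarrow> open {z \<in> U. \<psi> z \<in> A}"
proof -
  assume "open A"
  then have "open (\<psi> -` A \<inter> U)"
    using continuous_on_open_vimage[OF saddle_boxD(1)[OF saddle_box]] continuous_on_coord by blast
  then show ?thesis by (simp add: vimage_def Int_def conj_commute)
qed

lemma compact_B: "compact B" and closed_B: "closed B"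
proof -
  show "compact B" by (rule compact_square[OF saddle_box]) simp
  then show "closed B" by (rule compact_imp_closed)
qed

lemma continuous_X [continuous_intros]:
    "continuous_on A f \<Longrightarrow> f ` A \<subseteq> U \<Longrightarrow> continuous_on A (\<lambda>s. X (f s))"
  and continuous_Y [continuous_intros]:
    "continuous_on A f \<Longrightarrow> f ` A \<subseteq> U \<Longrightarrow> continuous_on A (\<lambda>s. Y (f s))"
  by (intro continuous_intros continuous_on_compose2[OF continuous_on_coord]; simp)+

lemma B_iff: "z \<in> B \<longleftrightarrow> z \<in> U \<and> \<bar>X z\<bar> \<le> 1 \<and> \<bar>Y z\<bar> \<le> 1"
  by (simp add: square_def)

text \<open>Neighbourhoods of the sides of the square B. The box is controlled up to half-width 2,
  so an orbit crossing a side can be followed a little outside B as well; closer to the axes than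
  1/2 no monotonicity is available.\<close>

definition "WX = {z \<in> U. 1/2 < \<bar>X z\<bar> \<and> \<bar>X z\<bar> < 2 \<and> \<bar>Y z\<bar> < 2}"
definition "WY = {z \<in> U. 1/2 < \<bar>Y z\<bar> \<and> \<bar>Y z\<bar> < 2 \<and> \<bar>X z\<bar> < 2}"

lemma open_WX: "open WX"
proof -
  have "open ({-2<..<-1/2} \<times> {-2<..<2} \<union> {1/2<..<2} \<times> {-2<..<(2::real)} :: (real \<times> real) set)"
    by (intro open_Un open_Times open_greaterThanLessThan)
  moreover have "WX = {z \<in> U. \<psi> z \<in> {-2<..<-1/2} \<times> {-2<..<2} \<union> {1/2<..<2} \<times> {-2<..<2}}"
    by (auto simp: WX_def mem_Times_iff)
  ultimately show ?thesis by (simp only: open_coord)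
qed

lemma open_WY: "open WY"
proof -
  have "open ({-2<..<2} \<times> {-2<..<-1/2} \<union> {-2<..<2} \<times> {1/2<..<(2::real)} :: (real \<times> real) set)"
    by (intro open_Un open_Times open_greaterThanLessThan)
  moreover have "WY = {z \<in> U. \<psi> z \<in> {-2<..<2} \<times> {-2<..<-1/2} \<union> {-2<..<2} \<times> {1/2<..<2}}"
    by (auto simp: WY_def mem_Times_iff)
  ultimately show ?thesis by (simp only: open_coord)
qed

lemma X_decreasing:
  assumes "s < t" "\<And>r. r \<in> {s..t} \<Longrightarrow> v r z \<in> WX"
  shows "\<bar>X (v t z)\<bar> < \<bar>X (v s z)\<bar>"
proof -
  have "\<bar>X (v (t - s) (v s z))\<bar> < \<bar>X (v s z)\<bar>"
  proof (rule saddle_box_mono(1)[OF saddle_box])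
    fix r assume "r \<in> {0..t - s}"
    then have "v r (v s z) \<in> WX" using assms(2)[of "r + s"] by (simp add: v_add)
    then show "v r (v s z) \<in> square 2 U \<psi>" "1/2 \<le> \<bar>X (v r (v s z))\<bar>" by (auto simp: WX_def square_def)
  qed (use assms in simp)
  then show ?thesis by (simp add: v_add)
qed

lemma Y_increasing:
  assumes "s < t" "\<And>r. r \<in> {s..t} \<Longrightarrow> v r z \<in> WY"
  shows "\<bar>Y (v s z)\<bar> < \<bar>Y (v t z)\<bar>"
proof -
  have "\<bar>Y (v s z)\<bar> < \<bar>Y (v (t - s) (v s z))\<bar>"
  proof (rule saddle_box_mono(2)[OF saddle_box])
    fix r assume "r \<in> {0..t - s}"
    then have "v r (v s z) \<in> WY" using assms(2)[of "r + s"] by (simp add: v_add)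
    then show "v r (v s z) \<in> square 2 U \<psi>" "1/2 \<le> \<bar>Y (v r (v s z))\<bar>" by (auto simp: WY_def square_def)
  qed (use assms in simp)
  then show ?thesis by (simp add: v_add)
qed

text \<open>A substitute for transversality: strict monotonicity of \<open>|X|\<close> carries the
  orbit through the side from outside to inside at a single instant.\<close>

lemma cross_X:
  assumes "z \<in> U" "\<bar>X z\<bar> = 1" "\<bar>Y z\<bar> < 2"
  obtains \<epsilon> where "\<epsilon> > 0" "\<And>s. \<bar>s\<bar> \<le> \<epsilon> \<Longrightarrow> v s z \<in> WX"
    "\<And>s. 0 < s \<Longrightarrow> s \<le> \<epsilon> \<Longrightarrow> \<bar>X (v s z)\<bar> < 1" "\<And>s. - \<epsilon> \<le> s \<Longrightarrow> s < 0 \<Longrightarrow> 1 < \<bar>X (v s z)\<bar>"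
proof -
  have "z \<in> WX" using assms by (auto simp: WX_def)
  then obtain \<epsilon> where \<epsilon>: "\<epsilon> > 0" "\<And>s. \<bar>s\<bar> \<le> \<epsilon> \<Longrightarrow> v s z \<in> WX" by (rule short_arc[OF open_WX]) (rule that)
  show thesis
  proof (rule that[OF \<epsilon>])
    show "\<bar>X (v s z)\<bar> < 1" if "0 < s" "s \<le> \<epsilon>" for s
      using X_decreasing[of 0 s z] \<epsilon>(2) that assms by auto
    show "1 < \<bar>X (v s z)\<bar>" if "- \<epsilon> \<le> s" "s < 0" for s
      using X_decreasing[of s 0 z] \<epsilon>(2) that assms by auto
  qed
qed

lemma cross_Y:
  assumes "z \<in> U" "\<bar>Y z\<bar> = 1" "\<bar>X z\<bar> < 2"
  obtains \<epsilon> where "\<epsilon> > 0" "\<And>s. \<bar>s\<bar> \<le> \<epsilon> \<Longrightarrow> v s z \<in> WY"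
    "\<And>s. 0 < s \<Longrightarrow> s \<le> \<epsilon> \<Longrightarrow> 1 < \<bar>Y (v s z)\<bar>" "\<And>s. - \<epsilon> \<le> s \<Longrightarrow> s < 0 \<Longrightarrow> \<bar>Y (v s z)\<bar> < 1"
proof -
  have "z \<in> WY" using assms by (auto simp: WY_def)
  then obtain \<epsilon> where \<epsilon>: "\<epsilon> > 0" "\<And>s. \<bar>s\<bar> \<le> \<epsilon> \<Longrightarrow> v s z \<in> WY" by (rule short_arc[OF open_WY]) (rule that)
  show thesis
  proof (rule that[OF \<epsilon>])
    show "1 < \<bar>Y (v s z)\<bar>" if "0 < s" "s \<le> \<epsilon>" for s
      using Y_increasing[of 0 s z] \<epsilon>(2) that assms by auto
    show "\<bar>Y (v s z)\<bar> < 1" if "- \<epsilon> \<le> s" "s < 0" for s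
      using Y_increasing[of s 0 z] \<epsilon>(2) that assms by auto
  qed
qed

text \<open>On the sides \<open>|X| = 1\<close> the flow enters the square, so a point can leave it
  at once only where \<open>|Y| = 1\<close>.\<close>

lemma remain_in_B:
  assumes "z \<in> B" "\<bar>Y z\<bar> < 1"
  obtains \<epsilon> where "\<epsilon> > 0" "\<And>s. 0 \<le> s \<Longrightarrow> s \<le> \<epsilon> \<Longrightarrow> v s z \<in> B"
proof -
  have z: "z \<in> U" "\<bar>X z\<bar> \<le> 1" using assms by (auto simp: B_iff)
  let ?W = "{z \<in> U. \<psi> z \<in> {-2<..<2} \<times> {-1<..<1}}"
  have W: "open ?W" by (intro open_coord open_Times open_greaterThanLessThan)
  have "z \<in> ?W" using z assms by (auto simp: mem_Times_iff)
  then obtain \<epsilon>1 where \<epsilon>1: "\<epsilon>1 > 0" "\<And>s. \<bar>s\<bar> \<le> \<epsilon>1 \<Longrightarrow> v s z \<in> ?W" by (rule short_arc[OF W]) (rule that)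
  obtain \<epsilon>2 where \<epsilon>2: "\<epsilon>2 > 0" "\<And>s. 0 \<le> s \<Longrightarrow> s \<le> \<epsilon>2 \<Longrightarrow> v s z \<in> U \<longrightarrow> \<bar>X (v s z)\<bar> \<le> 1"
  proof (cases "\<bar>X z\<bar> = 1")
    case True
    then obtain \<epsilon> where "\<epsilon> > 0" "\<And>s. 0 < s \<Longrightarrow> s \<le> \<epsilon> \<Longrightarrow> \<bar>X (v s z)\<bar> < 1"
      using assms(2) by (elim cross_X[OF z(1)]) auto
    then show thesis using True by (intro that[of \<epsilon>]) (auto simp: le_less)
  next
    case False
    let ?W' = "{z \<in> U. \<psi> z \<in> {-1<..<1} \<times> UNIV}"
    have W': "open ?W'" by (intro open_coord open_Times open_greaterThanLessThan open_UNIV)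
    have "z \<in> ?W'" using z False by (auto simp: mem_Times_iff)
    then obtain \<epsilon> where "\<epsilon> > 0" "\<And>s. \<bar>s\<bar> \<le> \<epsilon> \<Longrightarrow> v s z \<in> ?W'" by (rule short_arc[OF W']) (rule that)
    then show thesis by (intro that[of \<epsilon>]) (auto simp: mem_Times_iff abs_le_iff less_imp_le)
  qed
  show thesis
  proof (rule that[of "min \<epsilon>1 \<epsilon>2"])
    show "v s z \<in> B" if "0 \<le> s" "s \<le> min \<epsilon>1 \<epsilon>2" for s
      using \<epsilon>1(2)[of s] \<epsilon>2(2)[of s] that by (auto simp: B_iff mem_Times_iff)
  qed (use \<epsilon>1 \<epsilon>2 in auto)
qed

lemma exit_time:
  assumes "z \<in> B" "t0 \<ge> 0" "v t0 z \<notin> B"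
  obtains T where "0 \<le> T" "T < t0" "\<And>s. s \<in> {0..T} \<Longrightarrow> v s z \<in> B" "\<bar>Y (v T z)\<bar> = 1"
proof -
  obtain T where T: "0 \<le> T" "T < t0" "\<And>s. s \<in> {0..T} \<Longrightarrow> v s z \<in> B"
    and exit: "\<And>\<epsilon>. \<epsilon> > 0 \<Longrightarrow> \<exists>s. T < s \<and> s < T + \<epsilon> \<and> v s z \<notin> B"
    by (rule first_exit[OF closed_B assms]) (rule that)
  have "v T z \<in> B" using T by simp
  have "\<not> \<bar>Y (v T z)\<bar> < 1"
  proof
    assume "\<bar>Y (v T z)\<bar> < 1"
    then obtain \<epsilon> where \<epsilon>: "\<epsilon> > 0" "\<And>s. 0 \<le> s \<Longrightarrow> s \<le> \<epsilon> \<Longrightarrow> v s (v T z) \<in> B"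
      by (rule remain_in_B[OF \<open>v T z \<in> B\<close>]) (rule that)
    then obtain s where "T < s" "s < T + \<epsilon>" "v s z \<notin> B" using exit by metis
    then show False using \<epsilon>(2)[of "s - T"] by (simp add: v_add)
  qed
  then have "\<bar>Y (v T z)\<bar> = 1" using \<open>v T z \<in> B\<close> by (simp add: B_iff)
  then show thesis using T by (intro that[of T])
qed

lemma exit_unique:
  assumes "\<And>s. s \<in> {0..t} \<Longrightarrow> v s z \<in> B" "0 \<le> r" "r < t"
  shows "\<bar>Y (v r z)\<bar> < 1"
proof (rule ccontr)
  assume "\<not> ?thesis"
  then have "\<bar>Y (v r z)\<bar> = 1" "v r z \<in> U" "\<bar>X (v r z)\<bar> < 2" using assms(1)[of r] assms(2,3) by (auto simp: B_iff)
  then obtain \<epsilon> where \<epsilon>: "\<epsilon> > 0" "\<And>s. 0 < s \<Longrightarrow> s \<le> \<epsilon> \<Longrightarrow> 1 < \<bar>Y (v s (v r z))\<bar>"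
    by (elim cross_Y) auto
  define s where "s = min \<epsilon> (t - r)"
  have "v (s + r) z \<in> B" using assms \<epsilon> by (intro assms(1)) (auto simp: s_def)
  then show False using \<epsilon>(2)[of s] assms \<epsilon>(1) by (auto simp: s_def v_add B_iff)
qed

lemma stay_B: "z \<in> stay \<Longrightarrow> z \<in> B"
  unfolding stay_def using v_0 by (metis (mono_tags) mem_Collect_eq order_refl)

lemma stay_forward_invariant: "z \<in> stay \<Longrightarrow> 0 \<le> t \<Longrightarrow> v t z \<in> stay"
  by (simp add: stay_def v_add)

lemma p_B: "p \<in> B"
  by (simp add: B_iff p_U)

lemma p_stay: "p \<in> stay"
  by (simp add: stay_def p_B)

lemma arc_stay:
  assumes "\<And>s. s \<in> {0..t} \<Longrightarrow> v s z \<in> B" "v t z \<in> stay"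
  shows "z \<in> stay"
  unfolding stay_def
proof (intro CollectI allI impI)
  fix s :: real assume "0 \<le> s"
  show "v s z \<in> B"
  proof (cases "s \<le> t")
    case False
    then have "v (s - t) (v t z) \<in> B" using assms(2) by (simp add: stay_def)
    then show ?thesis by (simp add: v_add)
  qed (use assms(1) \<open>0 \<le> s\<close> in simp)
qed

lemma stay_unique: "z \<in> stay \<Longrightarrow> z' \<in> stay \<Longrightarrow> z \<noteq> z' \<Longrightarrow> \<bar>Y z - Y z'\<bar> < \<bar>X z - X z'\<bar>"
  by (rule saddle_box_stay(1)[OF saddle_box]) (simp_all add: stay_def)

lemma stay_Y: "z \<in> stay \<Longrightarrow> \<bar>Y z\<bar> < 1"
  using exit_unique[of 1 z 0] by (simp add: stay_def)

text \<open>Compared with p, such a point satisfies the forward and the backward graph condition,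
  which are opposite strict inequalities unless the two points coincide. So \<open>{p}\<close> is
  the largest invariant subset of the square.\<close>

lemma full_orbit_in_B: "(\<And>t. v t z \<in> B) \<Longrightarrow> z = p"
  using saddle_box_stay[OF saddle_box, of z p] p_B by fastforce

lemma omega_eq_p_if:
  assumes "\<And>t. t > T \<Longrightarrow> v t z \<in> B"
  shows "omega_limit v z = {p}"
proof -
  have "y = p" if "y \<in> omega_limit v z" for y
    using omega_invariant[OF that] omega_subset_closed[OF closed_B assms] by (intro full_orbit_in_B) auto
  then show ?thesis using omega_nonempty[of z] by blast
qed

lemma stay_omega: "z \<in> stay \<Longrightarrow> omega_limit v z = {p}"
  by (rule omega_eq_p_if[of 0]) (simp add: stay_def)

lemma p_interior: "open {z \<in> U. \<psi> z \<in> {-c<..<c} \<times> {-c<..<c}}"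
  by (intro open_coord open_Times open_greaterThanLessThan)

lemma omega_imp_eventually:
  assumes "omega_limit v z = {p}" "c > 0"
  obtains T where "T \<ge> 0" "\<And>t. t \<ge> T \<Longrightarrow> v t z \<in> U \<and> \<bar>X (v t z)\<bar> < c \<and> \<bar>Y (v t z)\<bar> < c"
proof -
  let ?W = "{z \<in> U. \<psi> z \<in> {-c<..<c} \<times> {-c<..<c}}"
  have "omega_limit v z \<subseteq> ?W" using assms p_U by simp
  from eventually_near_omega[OF p_interior this] obtain T where T: "\<And>t. t > T \<Longrightarrow> v t z \<in> ?W" by auto
  show thesis
  proof (rule that[of "max 0 (T + 1)"])
    fix t assume "t \<ge> max 0 (T + 1)"
    then have "v t z \<in> ?W" by (intro T) auto
    then show "v t z \<in> U \<and> \<bar>X (v t z)\<bar> < c \<and> \<bar>Y (v t z)\<bar> < c" by (auto simp: mem_Times_iff)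
  qed simp
qed

lemma omega_eq_p_iff: "omega_limit v z = {p} \<longleftrightarrow> (\<exists>T\<ge>0. v T z \<in> stay)"
proof
  assume "omega_limit v z = {p}"
  then obtain T where T: "T \<ge> 0" "\<And>t. t \<ge> T \<Longrightarrow> v t z \<in> U \<and> \<bar>X (v t z)\<bar> < 1 \<and> \<bar>Y (v t z)\<bar> < 1"
    by (rule omega_imp_eventually[of _ 1]) (simp, rule that)
  have "v t (v T z) \<in> B" if "t \<ge> 0" for t
    using T(2)[of "t + T"] that by (simp add: v_add B_iff less_imp_le)
  then have "v T z \<in> stay" by (simp add: stay_def)
  then show "\<exists>T\<ge>0. v T z \<in> stay" using T by blast
next
  assume "\<exists>T\<ge>0. v T z \<in> stay"
  then obtain T where "v T z \<in> stay" by blast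
  from stay_omega[OF this] show "omega_limit v z = {p}" by simp
qed

text \<open>Shortly after leaving through side b the orbit has \<open>|Y| > 1\<close>, and until
  then \<open>b * Y > -1\<close>. Both persist for nearby points, which therefore have left the
  square by then, and not through the opposite side.\<close>

lemma exit_side_open:
  assumes b: "b = 1 \<or> b = -1" and z0: "z0 \<in> B" and T: "0 \<le> T" "\<And>s. s \<in> {0..T} \<Longrightarrow> v s z0 \<in> B" "Y (v T z0) = b"
  obtains N where "open N" "z0 \<in> N"
    "\<And>z. z \<in> N \<Longrightarrow> z \<in> B \<Longrightarrow> \<exists>T\<ge>0. (\<forall>s\<in>{0..T}. v s z \<in> B) \<and> Y (v T z) = b"
proof -
  have zT: "v T z0 \<in> U" "\<bar>X (v T z0)\<bar> < 2" "\<bar>Y (v T z0)\<bar> = 1" using T(1) T(2)[of T] T(3) b by (auto simp: B_iff)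
  obtain \<epsilon>1 where \<epsilon>1: "\<epsilon>1 > 0" "\<And>s. \<bar>s\<bar> \<le> \<epsilon>1 \<Longrightarrow> v s (v T z0) \<in> WY"
      "\<And>s. 0 < s \<Longrightarrow> s \<le> \<epsilon>1 \<Longrightarrow> 1 < \<bar>Y (v s (v T z0))\<bar>"
    by (rule cross_Y[OF zT(1,3,2)]) (rule that)
  let ?W = "{z \<in> U. \<psi> z \<in> UNIV \<times> {y. - 1 < b * y}}"
  have W: "open ?W" by (intro open_coord open_Times open_UNIV open_Collect_less continuous_intros)
  have WT: "v T z0 \<in> ?W" using zT(1) T(3) b by (auto simp: mem_Times_iff)
  obtain \<epsilon>2 where \<epsilon>2: "\<epsilon>2 > 0" "\<And>s. \<bar>s\<bar> \<le> \<epsilon>2 \<Longrightarrow> v s (v T z0) \<in> ?W"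
    by (rule short_arc[OF W WT]) (rule that)
  define \<epsilon> where "\<epsilon> = min \<epsilon>1 \<epsilon>2"
  define s0 where "s0 = \<epsilon> + T"
  have \<epsilon>: "\<epsilon> > 0" "\<epsilon> \<le> \<epsilon>1" "\<epsilon> \<le> \<epsilon>2" using \<epsilon>1 \<epsilon>2 by (auto simp: \<epsilon>_def)
  have arc: "v s z0 \<in> ?W" if s: "s \<in> {0..s0}" for s
  proof (cases "s < T")
    case True
    then have "\<bar>Y (v s z0)\<bar> < 1" "v s z0 \<in> U"
      using exit_unique[OF T(2), where r = s] T(2)[of s] s by (auto simp: B_iff)
    then show ?thesis using b by (auto simp: mem_Times_iff)
  next
    case False
    then have "v (s - T) (v T z0) \<in> ?W" using s \<epsilon> by (intro \<epsilon>2) (auto simp: s0_def)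
    then show ?thesis by (simp add: v_add)
  qed
  obtain N1 where N1: "open N1" "z0 \<in> N1" "\<And>z s. z \<in> N1 \<Longrightarrow> s \<in> {0..s0} \<Longrightarrow> v s z \<in> ?W"
    by (rule tube[OF W compact_Icc[of 0 s0] arc]) (assumption, rule that)
  let ?V = "{z \<in> U. \<psi> z \<in> UNIV \<times> {y. 1 < \<bar>y\<bar>}}"
  have V: "open ?V" by (intro open_coord open_Times open_UNIV open_Collect_less continuous_intros)
  have N2: "open (v s0 -` ?V)" using V by (intro open_vimage continuous_intros) auto
  have "v \<epsilon> (v T z0) \<in> ?V" using \<epsilon>1(2)[of \<epsilon>] \<epsilon>1(3)[of \<epsilon>] \<epsilon> by (auto simp: WY_def mem_Times_iff)
  then have z0V: "v s0 z0 \<in> ?V" by (simp add: v_add s0_def)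
  show thesis
  proof (rule that[of "N1 \<inter> v s0 -` ?V"])
    show "open (N1 \<inter> v s0 -` ?V)" using N1(1) N2 by (rule open_Int)
    show "z0 \<in> N1 \<inter> v s0 -` ?V" using N1(2) z0V by simp
    fix z assume z: "z \<in> N1 \<inter> v s0 -` ?V" "z \<in> B"
    have "v s0 z \<notin> B" using z(1) by (auto simp: B_iff mem_Times_iff)
    moreover have "s0 \<ge> 0" using T \<epsilon> by (simp add: s0_def)
    ultimately obtain T' where T': "0 \<le> T'" "T' < s0" "\<And>s. s \<in> {0..T'} \<Longrightarrow> v s z \<in> B" "\<bar>Y (v T' z)\<bar> = 1"
      using exit_time[OF z(2)] by metis
    have "v T' z \<in> ?W" using N1(3) z T' by auto
    then have "Y (v T' z) = b" using T'(4) b by (auto simp: mem_Times_iff)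
    then show "\<exists>T\<ge>0. (\<forall>s\<in>{0..T}. v s z \<in> B) \<and> Y (v T z) = b" using T' by blast
  qed
qed

lemma exit_side_unique:
  assumes T: "T \<ge> 0" "\<And>s. s \<in> {0..T} \<Longrightarrow> v s z \<in> B" "Y (v T z) = 1"
    and T': "T' \<ge> 0" "\<And>s. s \<in> {0..T'} \<Longrightarrow> v s z \<in> B" "Y (v T' z) = -1"
  shows False
proof -
  have "\<not> T < T'" using exit_unique[OF T'(2), where r = T] T by auto
  moreover have "\<not> T' < T" using exit_unique[OF T(2), where r = T'] T' by auto
  ultimately have "T = T'" by simp
  then show False using T(3) T'(3) by simp
qed

text \<open>A connectedness argument in the manner of Wazewski: the ends of the vertical segment
  leave the square through opposite sides, leaving through a given side is an open condition on the
  segment, and every point outside \<open>stay\<close> leaves. A connected segment cannot consist of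
  leaving points only.\<close>

lemma stay_exists:
  assumes x: "\<bar>x\<bar> \<le> 1"
  shows "\<exists>z\<in>stay. X z = x"
proof (rule ccontr)
  assume none: "\<not> ?thesis"
  let ?z = "\<lambda>y. pt (x, y)"
  have zB: "?z y \<in> B" "X (?z y) = x" "Y (?z y) = y" if "y \<in> {-1..1}" for y
    using pt_mem[of x y] coord_pt[of x y] x that by (auto simp: B_iff)
  let ?E = "\<lambda>b y. \<exists>T\<ge>0. (\<forall>s\<in>{0..T}. v s (?z y) \<in> B) \<and> Y (v T (?z y)) = b"
  have cases: "?E 1 y \<or> ?E (-1) y" if y: "y \<in> {-1..1}" for y
  proof -
    have "?z y \<notin> stay" using none zB(2)[OF y] by blast
    then obtain t where "t \<ge> 0" "v t (?z y) \<notin> B" by (auto simp: stay_def)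
    then obtain T where "0 \<le> T" "\<And>s. s \<in> {0..T} \<Longrightarrow> v s (?z y) \<in> B" "\<bar>Y (v T (?z y))\<bar> = 1"
      using exit_time[OF zB(1)[OF y]] by metis
    then show ?thesis by (auto simp: abs_if split: if_splits)
  qed
  have excl: False if "?E 1 y" "?E (-1) y" for y
    using that by (elim exE conjE) (rule exit_side_unique[of _ "?z y"]; simp)
  have cont: "continuous_on {-1..1} ?z"
    using x by (intro continuous_on_compose2[OF continuous_on_pt] continuous_intros) auto
  have loc: "eventually (?E b) (at y0 within {-1..1})" if b: "b = 1 \<or> b = -1" and y0: "y0 \<in> {-1..1}" and E: "?E b y0" for b y0
  proof -
    obtain T where T: "T \<ge> 0" "\<forall>s\<in>{0..T}. v s (?z y0) \<in> B" "Y (v T (?z y0)) = b" using E by (elim exE conjE)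
    have arc: "\<And>s. s \<in> {0..T} \<Longrightarrow> v s (?z y0) \<in> B" using T(2) by (rule bspec)
    obtain N where N: "open N" "?z y0 \<in> N" "\<And>z. z \<in> N \<Longrightarrow> z \<in> B \<Longrightarrow> \<exists>T\<ge>0. (\<forall>s\<in>{0..T}. v s z \<in> B) \<and> Y (v T z) = b"
      by (rule exit_side_open[OF b zB(1)[OF y0] T(1) arc T(3)]) (assumption, rule that)
    have "(?z \<longlongrightarrow> ?z y0) (at y0 within {-1..1})" using cont y0 by (simp add: continuous_on_def)
    then have "eventually (\<lambda>y. ?z y \<in> N) (at y0 within {-1..1})" using N(1,2) by (rule topological_tendstoD)
    moreover have "eventually (\<lambda>y. y \<in> {-1..1}) (at y0 within {-1..1})" by (simp add: eventually_at_filter)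
    ultimately show ?thesis
      by eventually_elim (rule N(3), assumption, rule zB(1))
  qed
  have "?E 1 (1 :: real) = ?E 1 (-1)"
  proof (rule connected_local_const[of "{-1..1}" 1 "-1" "?E 1"])
    show "\<forall>a\<in>{-1..1}. eventually (\<lambda>b. ?E 1 a = ?E 1 b) (at a within {-1..1})"
    proof
      fix a :: real assume a: "a \<in> {-1..1}"
      show "eventually (\<lambda>b. ?E 1 a = ?E 1 b) (at a within {-1..1})"
      proof (cases "?E 1 a")
        case True
        from loc[OF _ a True] have "eventually (?E 1) (at a within {-1..1})" by simp
        then show ?thesis by eventually_elim (simp only: True)
      next
        case False
        then have "?E (-1) a" using cases[OF a] by blast
        from loc[OF _ a this] have "eventually (?E (-1)) (at a within {-1..1})" by simp
        then show ?thesis by eventually_elim (use False excl in blast)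
      qed
    qed
  qed (simp_all add: connected_Icc)
  moreover have "?E 1 1" "?E (-1) (-1)" using zB[of 1] zB[of "-1"] by (auto intro!: exI[of _ 0])
  ultimately show False using excl by blast
qed

end

lemma sgn_constant_if_nonzero:
  fixes f :: "real \<Rightarrow> real"
  assumes f: "continuous_on {0..t} f" and ne: "\<And>s. s \<in> {0..t} \<Longrightarrow> f s \<noteq> 0" and "0 \<le> t"
  shows "sgn (f t) = sgn (f 0)"
proof -
  have "\<not> (f 0 < 0 \<and> 0 < f t)"
    using IVT'[of f 0 0 t] f ne \<open>0 \<le> t\<close> by fastforce
  moreover have "\<not> (f t < 0 \<and> 0 < f 0)"
    using IVT2'[of f t 0 0] f ne \<open>0 \<le> t\<close> by fastforce
  ultimately show ?thesis using ne[of 0] ne[of t] \<open>0 \<le> t\<close> by (auto simp: sgn_real_def)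
qed

section \<open>The local stable set as a Lipschitz graph\<close>

context box_flow begin

interpretation rev: box_flow "\<lambda>t. v (- t)" p U "prod.swap \<circ> \<psi>"
  by (rule box_flow_reverse)

text \<open>The function whose graph over [-1, 1] is \<open>stay\<close>. There the choice exists by
  \<open>stay_exists\<close> and is unique by \<open>stay_unique\<close>; outside the interval the
  value is arbitrary.\<close>

definition g :: "real \<Rightarrow> real" where "g x = Y (SOME z. z \<in> stay \<and> X z = x)"

lemma stay_eqI: "z \<in> stay \<Longrightarrow> z' \<in> stay \<Longrightarrow> X z = X z' \<Longrightarrow> z = z'"
  using stay_unique[of z z'] by auto

lemma Y_stay: "z \<in> stay \<Longrightarrow> Y z = g (X z)"
proof -
  assume z: "z \<in> stay"
  then have "(SOME z'. z' \<in> stay \<and> X z' = X z) = z"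
    by (intro some_equality) (auto intro: stay_eqI)
  then show ?thesis by (simp add: g_def)
qed

definition zs :: "real \<Rightarrow> 'a" where "zs x = pt (x, g x)"

lemma zs:
  assumes "\<bar>x\<bar> \<le> 1"
  shows zs_stay: "zs x \<in> stay" and X_zs: "X (zs x) = x" and Y_zs: "Y (zs x) = g x" and g_less: "\<bar>g x\<bar> < 1"
proof -
  obtain z where z: "z \<in> stay" "X z = x" using stay_exists[OF assms] by auto
  have "Y z = g x" using Y_stay[OF z(1)] z(2) by simp
  moreover have "\<bar>Y z\<bar> < 1" by (rule stay_Y[OF z(1)])
  moreover have "z \<in> U" using stay_B[OF z(1)] by (simp add: B_iff)
  ultimately have "zs x = z" using pt_coord[of z] z(2) assms by (simp add: zs_def)
  then show "zs x \<in> stay" "X (zs x) = x" "Y (zs x) = g x" "\<bar>g x\<bar> < 1"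
    using z \<open>Y z = g x\<close> \<open>\<bar>Y z\<bar> < 1\<close> by auto
qed

lemma stay_iff: "z \<in> B \<Longrightarrow> z \<in> stay \<longleftrightarrow> Y z = g (X z)"
proof
  assume "z \<in> B" "Y z = g (X z)"
  then have "z = zs (X z)" using pt_coord[of z] by (simp add: zs_def B_iff)
  then show "z \<in> stay" using zs_stay[of "X z"] \<open>z \<in> B\<close> by (simp add: B_iff)
qed (rule Y_stay)

lemma stay_zs: "z \<in> stay \<Longrightarrow> zs (X z) = z"
  using stay_eqI[OF zs_stay, of "X z" z] stay_B[of z] by (simp add: B_iff X_zs)

lemma g_lipschitz: "\<bar>x\<bar> \<le> 1 \<Longrightarrow> \<bar>x'\<bar> \<le> 1 \<Longrightarrow> \<bar>g x - g x'\<bar> \<le> \<bar>x - x'\<bar>"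
  using stay_unique[OF zs_stay zs_stay, of x x'] by (cases "zs x = zs x'") (auto simp: X_zs Y_zs dest: arg_cong[of _ _ X])

lemma continuous_on_g: "continuous_on {-1..1} g"
  by (rule lipschitz_on_continuous_on[of 1]) (auto intro!: lipschitz_onI g_lipschitz simp: dist_real_def)

text \<open>Along an orbit the abscissa tends to \<open>0\<close>, so it takes all values in between.\<close>

lemma stay_in_branch:
  assumes z: "z \<in> stay" "X z \<noteq> 0"
  obtains t where "t \<ge> 0" "v t (zs (sgn (X z))) = z"
proof -
  define a where "a = sgn (X z)"
  have a: "\<bar>a\<bar> \<le> 1" "a * X z = \<bar>X z\<bar>" "a * a = 1" "\<bar>X z\<bar> \<le> 1"
    using z stay_B[OF z(1)] by (auto simp: a_def sgn_mult_abs B_iff mult_sgn_abs sgn_real_def split: if_splits)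
  have arc: "v s (zs a) \<in> stay" if "0 \<le> s" for s
    using that by (intro stay_forward_invariant zs_stay a)
  have U: "v s (zs a) \<in> U" if "0 \<le> s" for s using stay_B[OF arc[OF that]] by (simp add: B_iff)
  obtain T where T: "T \<ge> 0" "\<And>t. t \<ge> T \<Longrightarrow> v t (zs a) \<in> U \<and> \<bar>X (v t (zs a))\<bar> < \<bar>X z\<bar> \<and> \<bar>Y (v t (zs a))\<bar> < \<bar>X z\<bar>"
    by (rule omega_imp_eventually[OF stay_omega[OF zs_stay[OF a(1)]], of "\<bar>X z\<bar>"]) (use z in simp, rule that)
  have "continuous_on {0..T} (\<lambda>s. a * X (v s (zs a)))"
    by (intro continuous_intros) (auto simp: U)
  moreover have "a * X (v T (zs a)) \<le> \<bar>X z\<bar>"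
  proof -
    have "a * X (v T (zs a)) \<le> \<bar>a\<bar> * \<bar>X (v T (zs a))\<bar>" by (simp flip: abs_mult)
    also have "\<dots> \<le> 1 * \<bar>X (v T (zs a))\<bar>" using a(1) by (intro mult_right_mono) auto
    finally show ?thesis using T(2)[of T] by simp
  qed
  moreover have "\<bar>X z\<bar> \<le> a * X (v 0 (zs a))" using a by (simp add: X_zs)
  ultimately obtain t where t: "0 \<le> t" "t \<le> T" "a * X (v t (zs a)) = \<bar>X z\<bar>"
    using IVT2'[of "\<lambda>s. a * X (v s (zs a))" T "\<bar>X z\<bar>" 0] T(1) by auto
  have "a * (a * X (v t (zs a))) = a * (a * X z)" using t(3) a(2) by simp
  then have "X (v t (zs a)) = X z" using a(3) by (simp flip: mult.assoc)
  then have "v t (zs a) = z" by (rule stay_eqI[OF arc[OF t(1)] z(1)])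
  then show thesis using that[of t] t(1) by (simp add: a_def)
qed

text \<open>On \<open>stay\<close> only p has abscissa 0, and an orbit that meets the fixed point p
  is p itself.\<close>

lemma X_sign_stay:
  assumes "z \<in> stay" "z \<noteq> p" "0 \<le> t"
  shows "sgn (X (v t z)) = sgn (X z)"
proof -
  have ne: "X (v s z) \<noteq> 0" if "s \<ge> 0" for s
  proof
    assume "X (v s z) = 0"
    then have "v s z = p" using stay_eqI[OF stay_forward_invariant[OF assms(1) that] p_stay] by simp
    then show False using assms(2) by (metis p_fixed v_inj)
  qed
  have "continuous_on {0..t} (\<lambda>s. X (v s z))"
    using stay_B[OF stay_forward_invariant[OF assms(1)]] by (intro continuous_intros) (auto simp: B_iff)
  from sgn_constant_if_nonzero[OF this] ne assms(3) show ?thesis by simp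
qed

text \<open>An orbit converging to p is eventually in \<open>stay\<close>, and each half of
  \<open>stay\<close> is traced by the forward orbit of its entry point \<open>zs 1\<close> or
  \<open>zs (-1)\<close>.\<close>

lemma stable_set_eq: "stable_set v p = {p} \<union> orbit v (zs 1) \<union> orbit v (zs (-1))"
proof (intro subset_antisym subsetI)
  fix z assume "z \<in> stable_set v p"
  then obtain T where T: "v T z \<in> stay" using omega_eq_p_iff by (auto simp: stable_set_def)
  show "z \<in> {p} \<union> orbit v (zs 1) \<union> orbit v (zs (-1))"
  proof (cases "X (v T z) = 0")
    case True
    then have "v T z = v T p" using stay_eqI[OF T p_stay] by simp
    then show ?thesis by (simp add: v_inj del: p_fixed)
  next
    case False
    obtain t where "v t (zs (sgn (X (v T z)))) = v T z" by (rule stay_in_branch[OF T False])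
    then have "v (- T) (v t (zs (sgn (X (v T z))))) = z" by simp
    then have "z \<in> orbit v (zs (sgn (X (v T z))))" by (metis orbit_def rangeI v_add)
    then show ?thesis using False by (auto simp: sgn_real_def split: if_splits)
  qed
next
  fix z assume "z \<in> {p} \<union> orbit v (zs 1) \<union> orbit v (zs (-1))"
  then obtain z' t where "z' \<in> stay" "z = v t z'"
  proof (elim UnE)
    assume "z \<in> {p}"
    then show thesis using that[of p 0] p_stay by simp
  next
    assume "z \<in> orbit v (zs 1)"
    then obtain t where "z = v t (zs 1)" by (auto simp: orbit_def)
    then show thesis by (rule that[OF zs_stay, rotated]) simp
  next
    assume "z \<in> orbit v (zs (-1))"
    then obtain t where "z = v t (zs (-1))" by (auto simp: orbit_def)
    then show thesis by (rule that[OF zs_stay, rotated]) simp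
  qed
  then show "z \<in> stable_set v p" by (simp add: stable_set_def stay_omega)
qed

lemma zs_ne_p: "x \<noteq> 0 \<Longrightarrow> \<bar>x\<bar> \<le> 1 \<Longrightarrow> zs x \<noteq> p"
  by (metis X_zs \<psi>_p fst_conv)

lemma branches_distinct: "orbit v (zs 1) \<noteq> orbit v (zs (-1))"
proof
  assume "orbit v (zs 1) = orbit v (zs (-1))"
  then have "zs 1 \<in> orbit v (zs (-1))" using orbit_self by metis
  then obtain t where t: "zs 1 = v t (zs (-1))" by (auto simp: orbit_def)
  show False
  proof (cases "t \<ge> 0")
    case True
    then show False using X_sign_stay[OF zs_stay[of "-1"] zs_ne_p True] by (simp add: X_zs flip: t)
  next
    case False
    have "zs (-1) = v (- t) (zs 1)" using t by simp
    then show False using X_sign_stay[OF zs_stay[of 1] zs_ne_p, of "- t"] False by (simp add: X_zs flip: \<open>zs (-1) = v (- t) (zs 1)\<close>)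
  qed
qed

end

lemma abs_eq_1_cases: "\<bar>a\<bar> = 1 \<longleftrightarrow> a = 1 \<or> a = -1" for a :: real
  by auto

context box_flow begin

text \<open>
  With \<open>\<bar>a\<bar> = \<bar>b\<bar> = 1\<close>, \<open>a\<close> selects a stable branch and \<open>b\<close> one of its sides; \<open>t = 0\<close> is the branch itself.
\<close>

definition sec :: "real \<Rightarrow> real \<Rightarrow> real \<Rightarrow> 'a" where "sec a b t = pt (a, g a + b * t)"

lemma sec:
  assumes "\<bar>a\<bar> = 1" "\<bar>g a + b * t\<bar> \<le> 2"
  shows sec_U: "sec a b t \<in> U" and X_sec: "X (sec a b t) = a" and Y_sec: "Y (sec a b t) = g a + b * t"
  using assms pt_mem[of a "g a + b * t"] coord_pt[of a "g a + b * t"] by (simp_all add: sec_def)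

lemma sec_0: "sec a b 0 = zs a"
  by (simp add: sec_def zs_def)

lemma sec_eqI:
  assumes "\<bar>a\<bar> = 1" "z \<in> U" "X z = a" "Y z = g a + b * t" "\<bar>Y z\<bar> \<le> 2"
  shows "sec a b t = z"
  using pt_coord[of z] assms by (auto simp: sec_def)

text \<open>The distance from the branch point to the nearer vertex of the square; for smaller
  parameters the section lies in B on either side.\<close>

definition depth :: "real \<Rightarrow> real" where "depth a = 1 - \<bar>g a\<bar>"

lemma depth: "\<bar>a\<bar> = 1 \<Longrightarrow> 0 < depth a" "depth a \<le> 1"
  using g_less[of a] by (auto simp: depth_def)

lemma sec_depth:
  assumes "\<bar>a\<bar> = 1" "\<bar>b\<bar> = 1" "0 \<le> t" "t < depth a"
  shows "\<bar>g a + b * t\<bar> < 1" "sec a b t \<in> U" "X (sec a b t) = a" "Y (sec a b t) = g a + b * t" "sec a b t \<in> B"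
proof -
  show "\<bar>g a + b * t\<bar> < 1" using assms by (auto simp: depth_def abs_eq_1_cases)
  then show "sec a b t \<in> U" "X (sec a b t) = a" "Y (sec a b t) = g a + b * t" "sec a b t \<in> B"
    using sec[of a b t] assms by (auto simp: B_iff)
qed

lemma continuous_on_sec:
  assumes "\<bar>a\<bar> = 1" "\<bar>b\<bar> = 1" "\<delta> < depth a"
  shows "continuous_on {0..\<delta>} (sec a b)"
  unfolding sec_def
proof (rule continuous_on_compose2[OF continuous_on_pt])
  show "(\<lambda>t. (a, g a + b * t)) ` {0..\<delta>} \<subseteq> {-2..2} \<times> {-2..2}"
  proof (intro image_subsetI)
    fix t assume "t \<in> {0..\<delta>}"
    then have "\<bar>g a + b * t\<bar> < 1" using assms by (intro sec_depth(1)) auto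
    then show "(a, g a + b * t) \<in> {-2..2} \<times> {-2..2}" using assms by auto
  qed
qed (intro continuous_intros)

lemma sec_near:
  assumes a: "\<bar>a\<bar> = 1" and b: "\<bar>b\<bar> = 1" and N: "open N" "zs a \<in> N"
  obtains \<epsilon> where "\<epsilon> > 0" "\<And>t. 0 \<le> t \<Longrightarrow> t < \<epsilon> \<Longrightarrow> sec a b t \<in> N"
proof -
  define d where "d = depth a / 2"
  have d: "0 < d" "d < depth a" using depth(1)[OF a] by (auto simp: d_def)
  have "(sec a b \<longlongrightarrow> sec a b 0) (at 0 within {0..d})"
    using continuous_on_sec[OF a b d(2)] d(1) by (simp add: continuous_on_def)
  then have "eventually (\<lambda>t. sec a b t \<in> N) (at 0 within {0..d})"
    using N by (auto simp: sec_0 dest: topological_tendstoD)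
  then obtain e where e: "e > 0" "\<And>t. t \<in> {0..d} \<Longrightarrow> t \<noteq> 0 \<Longrightarrow> dist t 0 < e \<Longrightarrow> sec a b t \<in> N"
    unfolding eventually_at by auto
  show thesis
  proof (rule that[of "min d e"])
    fix t assume "0 \<le> t" "t < min d e"
    then show "sec a b t \<in> N" using e(2)[of t] N(2) by (cases "t = 0") (auto simp: sec_0 dist_real_def)
  qed (use d e in simp)
qed

end

section \<open>The corner map past a saddle\<close>

context box_flow begin

interpretation rev: box_flow "\<lambda>t. v (- t)" p U "prod.swap \<circ> \<psi>"
  by (rule box_flow_reverse)

text \<open>
  An orbit enters the square through the section of the stable branch \<open>a\<close> on the side \<open>b\<close> and leaves
  it along the unstable branch \<open>b\<close> on the side \<open>a\<close>.
\<close>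

definition corner :: "real \<Rightarrow> real \<Rightarrow> real \<Rightarrow> real \<Rightarrow> real \<Rightarrow> bool" where
  "corner a b t t' T \<longleftrightarrow> 0 \<le> T \<and> \<bar>rev.g b + a * t'\<bar> \<le> 1 \<and> (\<forall>s\<in>{0..T}. v s (sec a b t) \<in> B) \<and>
     v T (sec a b t) = rev.sec b a t'"

text \<open>Just before the entrance the orbit is outside the square, so no point of the arc has its
  whole past in it.\<close>

lemma entrance_not_stay_backward:
  assumes "z \<in> B" "\<bar>X z\<bar> = 1" "\<And>s. s \<in> {0..t} \<Longrightarrow> v s z \<in> B" "0 \<le> t"
  shows "v t z \<notin> rev.stay"
proof
  assume st: "v t z \<in> rev.stay"
  have "z \<in> U" "\<bar>Y z\<bar> < 2" using assms by (auto simp: B_iff)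
  obtain \<epsilon> where \<epsilon>: "\<epsilon> > 0" "\<And>s. - \<epsilon> \<le> s \<Longrightarrow> s < 0 \<Longrightarrow> 1 < \<bar>X (v s z)\<bar>"
    by (rule cross_X[OF \<open>z \<in> U\<close> assms(2) \<open>\<bar>Y z\<bar> < 2\<close>]) (rule that)
  have "v (- (t + \<epsilon>)) (v t z) \<in> B" using st assms(4) \<epsilon>(1) by (simp add: rev.stay_def del: minus_add_distrib)
  then show False using \<epsilon>(2)[of "- \<epsilon>"] \<epsilon>(1) by (simp add: v_add B_iff)
qed

text \<open>The entering point is off the stable branch, so the orbit leaves. On the way it meets
  neither \<open>stay\<close> nor \<open>rev.stay\<close>, so \<open>Y - g X\<close> and
  \<open>X - rev.g Y\<close> keep their signs; the first decides the exit side b, the second the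
  side a of the unstable branch.\<close>

lemma corner_exists:
  assumes a: "\<bar>a\<bar> = 1" and b: "\<bar>b\<bar> = 1" and t: "0 < t" "t < depth a"
  obtains t' T where "corner a b t t' T" "0 < t'"
proof -
  define z where "z = sec a b t"
  have z: "z \<in> B" "X z = a" "Y z = g a + b * t" using sec_depth[OF a b, of t] t by (simp_all add: z_def)
  have "z \<notin> stay" using stay_iff[OF z(1)] z t b by auto
  then obtain t0 where t0: "t0 \<ge> 0" "v t0 z \<notin> B" by (auto simp: stay_def)
  obtain T where T: "0 \<le> T" "\<And>s. s \<in> {0..T} \<Longrightarrow> v s z \<in> B" "\<bar>Y (v T z)\<bar> = 1"
    by (rule exit_time[OF z(1) t0]) (rule that)
  have inU: "v s z \<in> U" "\<bar>X (v s z)\<bar> \<le> 1" "\<bar>Y (v s z)\<bar> \<le> 1" if "s \<in> {0..T}" for s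
    using T(2)[OF that] by (auto simp: B_iff)
  have sub: "(\<lambda>s. v s z) ` {0..T} \<subseteq> U" using inU(1) by auto
  have "sgn (Y (v T z) - g (X (v T z))) = sgn (Y (v 0 z) - g (X (v 0 z)))"
  proof (rule sgn_constant_if_nonzero)
    show "continuous_on {0..T} (\<lambda>s. Y (v s z) - g (X (v s z)))"
      using inU by (intro continuous_intros sub continuous_on_compose2[OF continuous_on_g]) (auto simp: abs_le_iff)
    fix s assume s: "s \<in> {0..T}"
    have "v s z \<notin> stay" using arc_stay[of s z] T(2) s \<open>z \<notin> stay\<close> by auto
    then show "Y (v s z) - g (X (v s z)) \<noteq> 0" using stay_iff[OF T(2)[OF s]] by simp
  qed (rule T)
  also have "\<dots> = sgn (b * t)" using z by simp
  finally have s1: "sgn (Y (v T z) - g (X (v T z))) = sgn (b * t)" .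
  have "\<bar>g (X (v T z))\<bar> < 1" using inU(2)[of T] T(1) by (intro g_less) simp
  then have Yb: "Y (v T z) = b" using s1 T(3) b t by (auto simp: abs_eq_1_cases sgn_real_def split: if_splits)
  have rg: "\<bar>rev.g (Y (v s z))\<bar> < 1" if "s \<in> {0..T}" for s using inU(3)[OF that] by (rule rev.g_less)
  have "sgn (X (v T z) - rev.g (Y (v T z))) = sgn (X (v 0 z) - rev.g (Y (v 0 z)))"
  proof (rule sgn_constant_if_nonzero)
    show "continuous_on {0..T} (\<lambda>s. X (v s z) - rev.g (Y (v s z)))"
      using inU by (intro continuous_intros sub continuous_on_compose2[OF rev.continuous_on_g]) (auto simp: abs_le_iff)
    fix s assume s: "s \<in> {0..T}"
    have "v s z \<notin> rev.stay"
      using s T(2) z a by (intro entrance_not_stay_backward[OF z(1)]) auto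
    then show "X (v s z) - rev.g (Y (v s z)) \<noteq> 0" using rev.stay_iff[of "v s z"] T(2)[OF s] by simp
  qed (rule T)
  also have "\<dots> = sgn a" using rg[of 0] T(1) z(2) a by (auto simp: abs_eq_1_cases sgn_real_def)
  finally have s2: "sgn (X (v T z) - rev.g b) = sgn a" by (simp add: Yb)
  define t' where "t' = a * (X (v T z) - rev.g b)"
  have aa: "a * a = 1" using a by (auto simp: abs_eq_1_cases)
  have X: "rev.g b + a * t' = X (v T z)" using aa by (simp add: t'_def flip: mult.assoc)
  have "rev.sec b a t' = v T z"
    using inU[of T] T(1) b X by (intro rev.sec_eqI) (auto simp: Yb)
  then have "corner a b t t' T"
    unfolding corner_def X using T inU(2)[of T] by (auto simp: z_def)
  moreover have "0 < t'" using s2 a by (auto simp: t'_def abs_eq_1_cases sgn_real_def split: if_splits)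
  ultimately show thesis by (rule that)
qed

lemma cornerD:
  assumes "corner a b t t' T" "\<bar>b\<bar> = 1"
  shows "v T (sec a b t) \<in> U" "X (v T (sec a b t)) = rev.g b + a * t'" "Y (v T (sec a b t)) = b"
  using rev.sec[of b a t'] assms by (auto simp: corner_def)

lemma corner_unique:
  assumes b: "\<bar>b\<bar> = 1" and a: "\<bar>a\<bar> = 1" and c: "corner a b t t1 T1" "corner a b t t2 T2"
  shows "t1 = t2"
proof -
  have Y: "\<bar>Y (v T1 (sec a b t))\<bar> = 1" "\<bar>Y (v T2 (sec a b t))\<bar> = 1"
    using cornerD[OF c(1) b] cornerD[OF c(2) b] b by auto
  have arcs: "\<And>s. s \<in> {0..T1} \<Longrightarrow> v s (sec a b t) \<in> B" "\<And>s. s \<in> {0..T2} \<Longrightarrow> v s (sec a b t) \<in> B" "0 \<le> T1" "0 \<le> T2"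
    using c by (auto simp: corner_def)
  have "\<not> T1 < T2" using exit_unique[OF arcs(2), where r = T1] Y arcs by auto
  moreover have "\<not> T2 < T1" using exit_unique[OF arcs(1), where r = T2] Y arcs by auto
  ultimately have "T1 = T2" by simp
  then have "rev.g b + a * t1 = rev.g b + a * t2" using cornerD(2)[OF c(1) b] cornerD(2)[OF c(2) b] by metis
  then show ?thesis using a by auto
qed

text \<open>The passage can be read backward: like the exit, the entrance happens at a single
  instant, because just before it the orbit is outside the square.\<close>

lemma corner_injective:
  assumes a: "\<bar>a\<bar> = 1" and b: "\<bar>b\<bar> = 1" and c: "corner a b t1 t' T1" "corner a b t2 t' T2"
    and t: "0 \<le> t1" "t1 < depth a" "0 \<le> t2" "t2 < depth a"
  shows "t1 = t2"
proof -
  have le: "\<not> T1 < T2" if c: "corner a b t1 t' T1" "corner a b t2 t' T2" and t: "0 \<le> t1" "t1 < depth a" for t1 t2 T1 T2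
  proof
    assume "T1 < T2"
    note s = sec_depth[OF a b t]
    have eq: "v T1 (sec a b t1) = v T2 (sec a b t2)" and arc: "\<And>s. s \<in> {0..T2} \<Longrightarrow> v s (sec a b t2) \<in> B"
      and T1: "0 \<le> T1" using c by (auto simp: corner_def)
    have "v (- T1) (v T1 (sec a b t1)) = v (- T1) (v T2 (sec a b t2))" by (simp only: eq)
    then have z1: "sec a b t1 = v (T2 - T1) (sec a b t2)" by (simp add: v_add)
    have "\<bar>X (sec a b t1)\<bar> = 1" "\<bar>Y (sec a b t1)\<bar> < 2" using s a by auto
    obtain \<epsilon> where \<epsilon>: "\<epsilon> > 0" "\<And>s. - \<epsilon> \<le> s \<Longrightarrow> s < 0 \<Longrightarrow> 1 < \<bar>X (v s (sec a b t1))\<bar>"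
      by (rule cross_X[OF s(2) \<open>\<bar>X (sec a b t1)\<bar> = 1\<close> \<open>\<bar>Y (sec a b t1)\<bar> < 2\<close>]) (rule that)
    define r where "r = min \<epsilon> (T2 - T1)"
    have "v (T2 - T1 - r) (sec a b t2) \<in> B" using \<epsilon> \<open>T1 < T2\<close> T1 by (intro arc) (auto simp: r_def)
    moreover have "v (T2 - T1 - r) (sec a b t2) = v (- r) (sec a b t1)" by (simp add: z1 v_add)
    ultimately have "v (- r) (sec a b t1) \<in> B" by simp
    then show False using \<epsilon>(2)[of "- r"] \<epsilon>(1) \<open>T1 < T2\<close> by (auto simp: r_def B_iff)
  qed
  have "T1 = T2" using le[OF c t(1,2)] le[OF c(2,1) t(3,4)] by simp
  then have "sec a b t1 = sec a b t2" using c by (metis corner_def v_inj)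
  then have "b * t1 = b * t2" using sec_depth(4)[OF a b] t by (metis add_left_cancel)
  then show ?thesis using b by auto
qed

text \<open>The branch point never reaches \<open>|Y| = 1\<close>, and nearby points imitate it for
  any prescribed time.\<close>

lemma corner_time:
  assumes a: "\<bar>a\<bar> = 1" and b: "\<bar>b\<bar> = 1"
  obtains \<epsilon> where "\<epsilon> > 0" "\<And>t t' T. 0 \<le> t \<Longrightarrow> t < \<epsilon> \<Longrightarrow> corner a b t t' T \<Longrightarrow> T > K"
proof -
  let ?W = "{z \<in> U. \<psi> z \<in> UNIV \<times> {-1<..<1}}"
  have W: "open ?W" by (intro open_coord open_Times open_UNIV open_greaterThanLessThan)
  have st: "zs a \<in> stay" using a by (intro zs_stay) simp
  have arc: "v s (zs a) \<in> ?W" if "s \<in> {0..K}" for s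
  proof -
    have "v s (zs a) \<in> stay" using stay_forward_invariant[OF st] that by simp
    from stay_Y[OF this] stay_B[OF this] show ?thesis by (auto simp: B_iff mem_Times_iff)
  qed
  obtain N where N: "open N" "zs a \<in> N" "\<And>z s. z \<in> N \<Longrightarrow> s \<in> {0..K} \<Longrightarrow> v s z \<in> ?W"
    by (rule tube[OF W compact_Icc[of 0 K] arc]) (assumption, rule that)
  obtain \<epsilon> where \<epsilon>: "\<epsilon> > 0" "\<And>t. 0 \<le> t \<Longrightarrow> t < \<epsilon> \<Longrightarrow> sec a b t \<in> N"
    by (rule sec_near[OF a b N(1,2)]) (rule that)
  show thesis
  proof (rule that[OF \<epsilon>(1)])
    fix t t' T assume t: "0 \<le> t" "t < \<epsilon>" and c: "corner a b t t' T"
    show "T > K"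
    proof (rule ccontr)
      assume "\<not> T > K"
      then have "v T (sec a b t) \<in> ?W" using c t by (intro N(3) \<epsilon>(2)) (auto simp: corner_def)
      then show False using cornerD(3)[OF c b] b by (auto simp: mem_Times_iff)
    qed
  qed
qed

end

lemma (in compact_flow) tendsto_v:
  assumes "(f \<longlongrightarrow> a) F" "(h \<longlongrightarrow> b) F"
  shows "((\<lambda>s. v (f s) (h s)) \<longlongrightarrow> v a b) F"
proof -
  have "continuous_on UNIV (\<lambda>z. v (fst z) (snd z))" by (intro continuous_intros)
  from continuous_on_tendsto_compose[OF this tendsto_Pair[OF assms]] show ?thesis by simp
qed

lemma infinitely_often_subseq:
  assumes "\<exists>\<^sub>F n in sequentially. Q n"
  shows "\<exists>r :: nat \<Rightarrow> nat. strict_mono r \<and> (\<forall>n. Q (r n))"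
proof -
  have "infinite {n. Q n}" using assms by (simp add: frequently_cofinite flip: cofinite_eq_sequentially)
  from infinite_enumerate[OF this] show ?thesis by (auto simp: strict_mono_def)
qed

context box_flow begin

lemma tendsto_sec:
  assumes "\<bar>a\<bar> = 1" "t \<longlonglongrightarrow> t0" "\<And>n. \<bar>g a + b * t n\<bar> \<le> 1"
  shows "(\<lambda>n. sec a b (t n)) \<longlonglongrightarrow> sec a b t0" "\<bar>g a + b * t0\<bar> \<le> 1"
proof -
  have lim: "(\<lambda>n. g a + b * t n) \<longlonglongrightarrow> g a + b * t0" by (intro tendsto_intros assms)
  show le: "\<bar>g a + b * t0\<bar> \<le> 1"
    by (rule LIMSEQ_le_const2[OF tendsto_rabs[OF lim]]) (use assms in auto)
  show "(\<lambda>n. sec a b (t n)) \<longlonglongrightarrow> sec a b t0"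
    unfolding sec_def
  proof (rule continuous_on_tendsto_compose[OF continuous_on_pt])
    show "(\<lambda>n. (a, g a + b * t n)) \<longlonglongrightarrow> (a, g a + b * t0)" by (intro tendsto_Pair lim tendsto_const)
    have "(a, g a + b * t n) \<in> {-2..2} \<times> {-2..2}" for n using assms(1) assms(3)[of n] by (auto simp: abs_le_iff)
    then show "\<forall>\<^sub>F n in sequentially. (a, g a + b * t n) \<in> {-2..2} \<times> {-2..2}" by (rule always_eventually[OF allI])
    show "(a, g a + b * t0) \<in> {-2..2} \<times> {-2..2}" using assms(1) le by (auto simp: abs_le_iff)
  qed
qed

end

context box_flow begin

interpretation rev: box_flow "\<lambda>t. v (- t)" p U "prod.swap \<circ> \<psi>"
  by (rule box_flow_reverse)

text \<open>Either the passage times are bounded along a subsequence, and the limit is again a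
  passage, or they tend to infinity. In the second case the limiting entrance stays in the square
  for all future and the limiting exit for all past, so both lie on the branches. This closes the
  graph of the corner map, including the point (0, 0).\<close>

lemma corner_limit:
  assumes a: "\<bar>a\<bar> = 1" and b: "\<bar>b\<bar> = 1" and c: "\<And>n. corner a b (t n) (t' n) (T n)"
    and t: "t \<longlonglongrightarrow> t0" "\<And>n. 0 \<le> t n" "\<And>n. t n < depth a" "0 \<le> t0" "t0 < depth a" and t': "t' \<longlonglongrightarrow> l"
  shows "t0 = 0 \<and> l = 0 \<or> 0 < t0 \<and> (\<exists>T. corner a b t0 l T)"
proof -
  note cD = c[unfolded corner_def]
  have le1: "\<bar>g a + b * t n\<bar> \<le> 1" for n using sec_depth(1)[OF a b t(2)[of n] t(3)[of n]] by simp
  have z: "(\<lambda>n. sec a b (t n)) \<longlonglongrightarrow> sec a b t0" by (rule tendsto_sec[OF a t(1) le1])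
  have le2: "\<bar>rev.g b + a * t' n\<bar> \<le> 1" for n using cD[of n] by simp
  have e: "(\<lambda>n. rev.sec b a (t' n)) \<longlonglongrightarrow> rev.sec b a l" "\<bar>rev.g b + a * l\<bar> \<le> 1"
    using rev.tendsto_sec[OF b t' le2] by auto
  have lim_B: "y \<in> B" if "f \<longlonglongrightarrow> y" "eventually (\<lambda>n. f n \<in> B) sequentially" for f :: "nat \<Rightarrow> 'a" and y
    by (rule Lim_in_closed_set[OF closed_B that(2) sequentially_bot that(1)])
  note s0 = sec_depth[OF a b t(4,5)]
  show ?thesis
  proof (cases "\<exists>K. \<exists>\<^sub>F n in sequentially. T n \<le> K")
    case True
    then obtain K where K: "\<exists>\<^sub>F n in sequentially. T n \<le> K" by blast
    obtain r :: "nat \<Rightarrow> nat" where r: "strict_mono r" "\<forall>n. T (r n) \<le> K" using infinitely_often_subseq[OF K] by (elim exE conjE) (rule that)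
    have "\<forall>n. T (r n) \<in> {0..K}" using r cD by auto
    then obtain T0 r' where r': "strict_mono r'" "((\<lambda>n. T (r n)) \<circ> r') \<longlonglongrightarrow> T0"
      using compact_Icc[of 0 K, unfolded compact_eq_seq_compact_metric seq_compact_def] by metis
    define q where "q = r \<circ> r'"
    have q: "strict_mono q" "(\<lambda>n. T (q n)) \<longlonglongrightarrow> T0" using r r' by (auto simp: q_def o_def strict_mono_def)
    have zq: "(\<lambda>n. sec a b (t (q n))) \<longlonglongrightarrow> sec a b t0" using LIMSEQ_subseq_LIMSEQ[OF z q(1)] by (simp add: o_def)
    have eq: "(\<lambda>n. rev.sec b a (t' (q n))) \<longlonglongrightarrow> rev.sec b a l" using LIMSEQ_subseq_LIMSEQ[OF e(1) q(1)] by (simp add: o_def)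
    have "(\<lambda>n. v (T (q n)) (sec a b (t (q n)))) \<longlonglongrightarrow> v T0 (sec a b t0)" by (rule tendsto_v[OF q(2) zq])
    moreover have "v (T (q n)) (sec a b (t (q n))) = rev.sec b a (t' (q n))" for n using cD by simp
    ultimately have hit: "v T0 (sec a b t0) = rev.sec b a l" using eq by (simp add: LIMSEQ_unique)
    have T0: "0 \<le> T0" by (rule LIMSEQ_le_const[OF q(2)]) (use cD in auto)
    have arc: "v s (sec a b t0) \<in> B" if s: "s \<in> {0..T0}" for s
    proof (rule lim_B)
      have "(\<lambda>n. min s (T (q n))) \<longlonglongrightarrow> min s T0" by (intro tendsto_min tendsto_const q)
      then show "(\<lambda>n. v (min s (T (q n))) (sec a b (t (q n)))) \<longlonglongrightarrow> v s (sec a b t0)"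
        using tendsto_v[OF _ zq] s by (simp add: min_absorb1)
      show "\<forall>\<^sub>F n in sequentially. v (min s (T (q n))) (sec a b (t (q n))) \<in> B"
        using cD s by (intro always_eventually) (auto simp: min_def)
    qed
    have c0: "corner a b t0 l T0" using T0 e(2) arc hit by (simp add: corner_def)
    have "t0 \<noteq> 0"
    proof
      assume "t0 = 0"
      then have "v T0 (sec a b t0) \<in> stay" using a T0 by (simp add: sec_0 stay_forward_invariant zs_stay)
      then show False using stay_Y cornerD(3)[OF c0 b] b by fastforce
    qed
    then show ?thesis using c0 t(4) by auto
  next
    case False
    then have big: "eventually (\<lambda>n. T n > K) sequentially" for K by (simp add: not_frequently not_le)
    have "v s (sec a b t0) \<in> B" if "s \<ge> 0" for s
    proof (rule lim_B[OF tendsto_v[OF tendsto_const z]])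
      show "\<forall>\<^sub>F n in sequentially. v s (sec a b (t n)) \<in> B"
        using big[of s] by eventually_elim (use cD that in auto)
    qed
    then have "sec a b t0 \<in> stay" by (simp add: stay_def)
    then have "t0 = 0" using stay_iff[OF s0(5)] s0 b by auto
    have "v (- s) (rev.sec b a l) \<in> B" if "s \<ge> 0" for s
    proof (rule lim_B[OF tendsto_v[OF tendsto_const e(1)]])
      show "\<forall>\<^sub>F n in sequentially. v (- s) (rev.sec b a (t' n)) \<in> B"
        using big[of s]
      proof eventually_elim
        fix n assume "s < T n"
        then have "v (T n - s) (sec a b (t n)) \<in> B" using cD[of n] that by auto
        moreover have "v (- s) (rev.sec b a (t' n)) = v (T n - s) (sec a b (t n))"
          using cD[of n] by (metis v_add add.commute uminus_add_conv_diff)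
        ultimately show "v (- s) (rev.sec b a (t' n)) \<in> B" by simp
      qed
    qed
    then have st: "rev.sec b a l \<in> rev.stay" by (simp add: rev.stay_def)
    have "\<bar>rev.g b + a * l\<bar> \<le> 2" using e(2) by simp
    from rev.Y_stay[OF st] rev.sec[OF b this] have "a * l = 0" by simp
    then show ?thesis using \<open>t0 = 0\<close> a by auto
  qed
qed

lemma corner_map:
  assumes a: "\<bar>a\<bar> = 1" and b: "\<bar>b\<bar> = 1"
  obtains \<delta> D where "0 < \<delta>" "\<delta> < depth a" "continuous_on {0..\<delta>} D" "strict_mono_on {0..\<delta>} D" "D 0 = 0"
    "\<And>t. 0 < t \<Longrightarrow> t \<le> \<delta> \<Longrightarrow> \<exists>T. corner a b t (D t) T"
proof -
  define \<delta> where "\<delta> = depth a / 2"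
  have \<delta>: "0 < \<delta>" "\<delta> < depth a" using depth(1)[OF a] by (auto simp: \<delta>_def)
  \<comment> \<open>The branch itself never leaves the square; the value 0 at 0 is the limit
    supplied by \<open>corner_limit\<close>.\<close>
  define D where "D t = (if t = 0 then 0 else SOME t'. \<exists>T. corner a b t t' T \<and> 0 < t')" for t
  have D0: "D 0 = 0" by (simp add: D_def)
  have D: "\<exists>T. corner a b t (D t) T \<and> 0 < D t" if t: "0 < t" "t \<le> \<delta>" for t
  proof -
    obtain t' T where "corner a b t t' T" "0 < t'"
      using corner_exists[OF a b t(1)] t \<delta> by (metis le_less_trans)
    then have "\<exists>t' T. corner a b t t' T \<and> 0 < t'" by blast
    from someI_ex[OF this] show ?thesis using t by (simp add: D_def)
  qed
  \<comment> \<open>Continuity follows from a closed graph only for a compact range; 2 is the side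
    length of the square.\<close>
  have D2: "D t \<in> {0..2}" if t: "t \<in> {0..\<delta>}" for t
  proof (cases "t = 0")
    case False
    then obtain T where "corner a b t (D t) T" "0 < D t" using D[of t] t by auto
    then have "\<bar>rev.g b + a * D t\<bar> \<le> 1" by (simp add: corner_def)
    moreover have "\<bar>rev.g b\<bar> < 1" using b by (intro rev.g_less) simp
    ultimately have "\<bar>a * D t\<bar> \<le> 2" by linarith
    then show ?thesis using \<open>0 < D t\<close> a by (auto simp: abs_mult)
  qed (simp add: D0)
  have "closed ((\<lambda>t. (t, D t)) ` {0..\<delta>})"
    unfolding closed_sequential_limits
  proof (intro allI impI, elim conjE)
    fix f and y :: "real \<times> real" assume f: "\<forall>n. f n \<in> (\<lambda>t. (t, D t)) ` {0..\<delta>}" and lim: "f \<longlonglongrightarrow> y"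
    define t where "t n = fst (f n)" for n :: nat
    have ft: "f n = (t n, D (t n))" "t n \<in> {0..\<delta>}" for n using f by (auto simp: t_def image_iff dest!: spec[of _ n])
    obtain t0 l where y: "y = (t0, l)" by (cases y)
    have lim1: "t \<longlonglongrightarrow> t0" using tendsto_fst[OF lim] by (simp add: y t_def[abs_def])
    have lim2: "(\<lambda>n. D (t n)) \<longlonglongrightarrow> l" using tendsto_snd[OF lim] by (simp add: y ft(1))
    have t0: "t0 \<in> {0..\<delta>}" by (rule closed_sequentially[OF _ _ lim1]) (use ft(2) in auto)
    have "l = D t0"
    proof (cases "\<exists>\<^sub>F n in sequentially. t n = 0")
      case True
      obtain r :: "nat \<Rightarrow> nat" where r: "strict_mono r" "\<forall>n. t (r n) = 0" using infinitely_often_subseq[OF True] by (elim exE conjE) (rule that)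
      have "(\<lambda>n. t (r n)) \<longlonglongrightarrow> t0" "(\<lambda>n. D (t (r n))) \<longlonglongrightarrow> l"
        using LIMSEQ_subseq_LIMSEQ[OF lim1 r(1)] LIMSEQ_subseq_LIMSEQ[OF lim2 r(1)] by (simp_all add: o_def)
      then show ?thesis using r(2) by (simp add: D0 LIMSEQ_const_iff)
    next
      case False
      then obtain n0 where n0: "\<And>n. n \<ge> n0 \<Longrightarrow> t n \<noteq> 0" by (auto simp: not_frequently eventually_sequentially)
      define u where "u n = t (n + n0)" for n
      have u: "0 < u n" "u n \<le> \<delta>" for n using n0[of "n + n0"] ft(2)[of "n + n0"] by (auto simp: u_def)
      have ul: "u \<longlonglongrightarrow> t0" "(\<lambda>n. D (u n)) \<longlonglongrightarrow> l"
        using LIMSEQ_ignore_initial_segment[OF lim1] LIMSEQ_ignore_initial_segment[OF lim2] by (simp_all add: u_def[abs_def])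
      define S where "S n = (SOME T. corner a b (u n) (D (u n)) T)" for n
      have S: "corner a b (u n) (D (u n)) (S n)" for n
        unfolding S_def using D[OF u] by (metis someI_ex)
      have "t0 = 0 \<and> l = 0 \<or> 0 < t0 \<and> (\<exists>T. corner a b t0 l T)"
        by (rule corner_limit[OF a b S ul(1) _ _ _ _ ul(2)]) (use u t0 \<delta> less_imp_le le_less_trans in \<open>auto intro: le_less_trans less_imp_le\<close>)
      then show ?thesis
      proof (elim disjE conjE exE)
        fix T assume "0 < t0" "corner a b t0 l T"
        then show "l = D t0" using D[of t0] t0 corner_unique[OF b a] by auto
      qed (simp add: D0)
    qed
    then show "y \<in> (\<lambda>t. (t, D t)) ` {0..\<delta>}" using t0 y by blast
  qed
  then have cl: "closedin (top_of_set ({0..\<delta>} \<times> {0..2})) ((\<lambda>t. (t, D t)) ` {0..\<delta>})"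
    using D2 by (intro closed_subset) auto
  have cont: "continuous_on {0..\<delta>} D"
    using continuous_closed_graph_eq[of "{0..2::real}" D "{0..\<delta>}"] D2 cl by (simp add: Pi_def)
  have inj: "inj_on D {0..\<delta>}"
  proof (rule inj_onI)
    fix t1 t2 assume t: "t1 \<in> {0..\<delta>}" "t2 \<in> {0..\<delta>}" "D t1 = D t2"
    show "t1 = t2"
    proof (cases "t1 = 0 \<or> t2 = 0")
      case True
      then show ?thesis using t D[of t1] D[of t2] D0 by (cases "t1 = 0"; cases "t2 = 0") auto
    next
      case False
      then obtain T1 T2 where "corner a b t1 (D t1) T1" "corner a b t2 (D t1) T2"
        using t D[of t1] D[of t2] by auto
      then show ?thesis by (rule corner_injective[OF a b]) (use t \<delta> in auto)
    qed
  qed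
  have "strict_mono_on {0..\<delta>} D \<or> strict_antimono_on {0..\<delta>} D"
    using injective_eq_monotone_map[OF is_interval_cc cont] inj by blast
  moreover have "\<not> strict_antimono_on {0..\<delta>} D"
  proof
    assume "strict_antimono_on {0..\<delta>} D"
    then have "D \<delta> < D 0" using \<delta> by (auto simp: monotone_on_def)
    then show False using D[of \<delta>] \<delta> D0 by auto
  qed
  ultimately show thesis using that[OF \<delta> cont _ D0] D by blast
qed

text \<open>A point of the square outside N leaves the square, in one direction of time, within a
  uniform time K0. On a corner arc it would be within K0 of the entrance or of the exit, where a
  deep arc still follows a branch and therefore lies in N.\<close>

lemma corner_close:
  assumes a: "\<bar>a\<bar> = 1" and b: "\<bar>b\<bar> = 1" and N: "open N" "p \<in> N"
    and fwd: "\<And>s. s \<ge> 0 \<Longrightarrow> v s (zs a) \<in> N" and bwd: "\<And>s. s \<ge> 0 \<Longrightarrow> v (- s) (rev.zs b) \<in> N"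
  obtains \<epsilon> where "\<epsilon> > 0"
    "\<And>t t' T. 0 \<le> t \<Longrightarrow> t < \<epsilon> \<Longrightarrow> 0 \<le> t' \<Longrightarrow> t' < \<epsilon> \<Longrightarrow> corner a b t t' T \<Longrightarrow> T > K \<and> (\<forall>s\<in>{0..T}. v s (sec a b t) \<in> N)"
proof -
  let ?O = "\<lambda>K :: real. \<Union>r\<in>{-K..K}. v r -` (- B)"
  have "compact (B - N)" using compact_B N(1) by (intro compact_diff)
  moreover have op: "open (?O K)" for K
    using closed_B by (intro open_UN ballI open_vimage continuous_intros) auto
  moreover have cover: "B - N \<subseteq> (\<Union>K\<in>UNIV. ?O K)"
  proof
    fix y assume "y \<in> B - N"
    then have "y \<noteq> p" using N(2) by auto
    then obtain r where "v r y \<notin> B" using full_orbit_in_B by blast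
    then show "y \<in> (\<Union>K\<in>UNIV. ?O K)" by (intro UN_I[of "\<bar>r\<bar>"] UN_I[of r]) auto
  qed
  obtain I where I: "I \<subseteq> UNIV" "finite I" "B - N \<subseteq> (\<Union>K\<in>I. ?O K)"
    by (rule compactE_image[OF \<open>compact (B - N)\<close> op cover])
  define K0 where "K0 = Max (insert 0 I)"
  have K0: "\<exists>r. \<bar>r\<bar> \<le> K0 \<and> v r y \<notin> B" if y: "y \<in> B" "y \<notin> N" for y
  proof -
    have "y \<in> (\<Union>K\<in>I. ?O K)" using I(3) y by blast
    then obtain k r where "k \<in> I" "r \<in> {-k..k}" "v r y \<notin> B" by auto
    moreover have "k \<le> K0" using I(2) \<open>k \<in> I\<close> by (simp add: K0_def)
    ultimately show ?thesis by (intro exI[of _ r]) auto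
  qed
  obtain N1 where N1: "open N1" "zs a \<in> N1" "\<And>z s. z \<in> N1 \<Longrightarrow> s \<in> {0..K0} \<Longrightarrow> v s z \<in> N"
    by (rule tube[OF N(1) compact_Icc[of 0 K0] fwd]) (simp, rule that)
  obtain N2 where N2: "open N2" "rev.zs b \<in> N2" "\<And>z s. z \<in> N2 \<Longrightarrow> s \<in> {0..K0} \<Longrightarrow> v (- s) z \<in> N"
    by (rule rev.tube[OF N(1) compact_Icc[of 0 K0] bwd]) (simp, rule that)
  obtain \<epsilon>1 where \<epsilon>1: "\<epsilon>1 > 0" "\<And>t. 0 \<le> t \<Longrightarrow> t < \<epsilon>1 \<Longrightarrow> sec a b t \<in> N1"
    by (rule sec_near[OF a b N1(1,2)]) (rule that)
  obtain \<epsilon>2 where \<epsilon>2: "\<epsilon>2 > 0" "\<And>t. 0 \<le> t \<Longrightarrow> t < \<epsilon>2 \<Longrightarrow> rev.sec b a t \<in> N2"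
    by (rule rev.sec_near[OF b a N2(1,2)]) (rule that)
  obtain \<epsilon>3 where \<epsilon>3: "\<epsilon>3 > 0" "\<And>t t' T. 0 \<le> t \<Longrightarrow> t < \<epsilon>3 \<Longrightarrow> corner a b t t' T \<Longrightarrow> T > K"
    by (rule corner_time[OF a b]) (rule that)
  show thesis
  proof (rule that[of "Min {\<epsilon>1, \<epsilon>2, \<epsilon>3}"])
    show "0 < Min {\<epsilon>1, \<epsilon>2, \<epsilon>3}" using \<epsilon>1 \<epsilon>2 \<epsilon>3 by simp
    fix t t' T assume t: "0 \<le> t" "t < Min {\<epsilon>1, \<epsilon>2, \<epsilon>3}" "0 \<le> t'" "t' < Min {\<epsilon>1, \<epsilon>2, \<epsilon>3}" and c: "corner a b t t' T"
    have zN: "sec a b t \<in> N1" "rev.sec b a t' \<in> N2" using t by (auto intro!: \<epsilon>1 \<epsilon>2)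
    have "v s (sec a b t) \<in> N" if s: "s \<in> {0..T}" for s
    proof (rule ccontr)
      assume no: "v s (sec a b t) \<notin> N"
      then obtain r where r: "\<bar>r\<bar> \<le> K0" "v r (v s (sec a b t)) \<notin> B"
        using K0[of "v s (sec a b t)"] c s by (auto simp: corner_def)
      then have "r + s \<notin> {0..T}" using c by (auto simp: corner_def v_add)
      then have "s \<in> {0..K0} \<or> T - s \<in> {0..K0}" using r(1) s by auto
      moreover have "v (- (T - s)) (rev.sec b a t') = v s (sec a b t)"
      proof -
        have "v (- (T - s)) (v T (sec a b t)) = v s (sec a b t)" by (simp add: v_add)
        then show ?thesis using c by (simp add: corner_def)
      qed
      ultimately show False using N1(3)[OF zN(1), of s] N2(3)[OF zN(2), of "T - s"] no by auto
    qed
    moreover have "T > K" using t by (intro \<epsilon>3(2)[OF _ _ c]) auto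
    ultimately show "T > K \<and> (\<forall>s\<in>{0..T}. v s (sec a b t) \<in> N)" by blast
  qed
qed

end

section \<open>Passages between sections\<close>

context compact_flow begin

lemma uniform_short_arc:
  assumes "compact K" "open W" "K \<subseteq> W"
  obtains \<epsilon> where "\<epsilon> > 0" "\<And>z s. z \<in> K \<Longrightarrow> \<bar>s\<bar> \<le> \<epsilon> \<Longrightarrow> v s z \<in> W"
proof -
  let ?W = "(\<lambda>z. v (fst z) (snd z)) -` W"
  have op: "open ?W" using assms(2) by (intro open_vimage continuous_intros)
  have sub: "{0} \<times> K \<subseteq> ?W" using assms(3) by auto
  obtain N where N: "0 \<in> N" "open N" "N \<times> K \<subseteq> ?W"
    using Elementary_Topology.tube_lemma[OF assms(1) op sub] by (elim exE conjE)
  obtain \<epsilon> where \<epsilon>: "\<epsilon> > 0" "cball 0 \<epsilon> \<subseteq> N" using N open_contains_cball by blast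
  show thesis
  proof (rule that[OF \<epsilon>(1)])
    fix z s assume "z \<in> K" "\<bar>s\<bar> \<le> \<epsilon>"
    then have "(s, z) \<in> N \<times> K" using \<epsilon>(2) by (auto simp: dist_real_def)
    then show "v s z \<in> W" using subsetD[OF N(3), of "(s, z)"] by simp
  qed
qed

text \<open>The germ at 0 of a transition map between parametrised sections, with what its iteration
  requires: it is increasing, orbits with small parameters travel close to \<open>\<Lambda>\<close>,
  and their travel time exceeds any bound because they pass a saddle. The last clause omits the
  parameter 0, since the branch itself converges to the saddle.\<close>

definition passage :: "'a set \<Rightarrow> (real \<Rightarrow> 'a) \<Rightarrow> (real \<Rightarrow> 'a) \<Rightarrow> (real \<Rightarrow> real) \<Rightarrow> bool" where
  "passage \<Lambda> c c' P \<longleftrightarrow> P 0 = 0 \<and> (\<exists>\<delta>>0. continuous_on {0..\<delta>} P \<and> strict_mono_on {0..\<delta>} P) \<and>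
     (\<forall>N K. open N \<and> \<Lambda> \<subseteq> N \<longrightarrow>
        (\<exists>\<epsilon>>0. \<forall>t\<in>{0<..<\<epsilon>}. \<exists>\<tau>\<ge>K. v \<tau> (c t) = c' (P t) \<and> (\<forall>s\<in>{0..\<tau>}. v s (c t) \<in> N)))"

lemma passage_zero: "passage \<Lambda> c c' P \<Longrightarrow> P 0 = 0"
  by (simp add: passage_def)

lemma passage_germ:
  assumes "passage \<Lambda> c c' P"
  obtains \<delta> where "\<delta> > 0" "continuous_on {0..\<delta>} P" "strict_mono_on {0..\<delta>} P"
  using assms by (auto simp: passage_def)

lemma passage_time:
  assumes "passage \<Lambda> c c' P" "open N" "\<Lambda> \<subseteq> N"
  obtains \<epsilon> where "\<epsilon> > 0"
    "\<And>t. 0 < t \<Longrightarrow> t < \<epsilon> \<Longrightarrow> \<exists>\<tau>\<ge>K. v \<tau> (c t) = c' (P t) \<and> (\<forall>s\<in>{0..\<tau>}. v s (c t) \<in> N)"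
proof -
  have "\<exists>\<epsilon>>0. \<forall>t\<in>{0<..<\<epsilon>}. \<exists>\<tau>\<ge>K. v \<tau> (c t) = c' (P t) \<and> (\<forall>s\<in>{0..\<tau>}. v s (c t) \<in> N)"
    using assms unfolding passage_def by simp
  then show thesis using that by auto
qed

lemma strict_mono_germ_near_zero:
  assumes P: "continuous_on {0..\<delta>} P" "strict_mono_on {0..\<delta>} P" "P 0 = (0::real)" and "\<delta> > (0::real)" "\<eta> > 0"
  obtains \<epsilon> where "0 < \<epsilon>" "\<epsilon> \<le> \<delta>" "\<And>t. 0 < t \<Longrightarrow> t \<le> \<epsilon> \<Longrightarrow> 0 < P t \<and> P t < \<eta>"
proof -
  have "(P \<longlongrightarrow> P 0) (at 0 within {0..\<delta>})" using P(1) \<open>\<delta> > 0\<close> by (simp add: continuous_on_def)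
  then have "eventually (\<lambda>t. P t < \<eta>) (at 0 within {0..\<delta>})"
    using \<open>\<eta> > 0\<close> P(3) by (intro order_tendstoD) auto
  then obtain e where e: "e > 0" "\<And>t. t \<in> {0..\<delta>} \<Longrightarrow> t \<noteq> 0 \<Longrightarrow> dist t 0 < e \<Longrightarrow> P t < \<eta>"
    unfolding eventually_at by auto
  define \<epsilon> where "\<epsilon> = min \<delta> (e / 2)"
  have \<epsilon>: "0 < \<epsilon>" "\<epsilon> \<le> \<delta>" using \<open>\<delta> > 0\<close> e(1) by (auto simp: \<epsilon>_def)
  have "0 < P t \<and> P t < \<eta>" if t: "0 < t" "t \<le> \<epsilon>" for t
  proof -
    have "P 0 < P t" using t \<epsilon> by (intro strict_mono_onD[OF P(2)]) auto
    moreover have "P t < \<eta>" using t e(1) by (intro e(2)) (auto simp: dist_real_def \<epsilon>_def)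
    ultimately show ?thesis using P(3) by simp
  qed
  then show thesis by (rule that[OF \<epsilon>])
qed

lemma passage_compose:
  assumes 1: "passage \<Lambda> c c' P" and 2: "passage \<Lambda> c' c'' P'"
  shows "passage \<Lambda> c c'' (P' \<circ> P)"
proof -
  obtain \<delta> where \<delta>: "\<delta> > 0" "continuous_on {0..\<delta>} P" "strict_mono_on {0..\<delta>} P" by (rule passage_germ[OF 1])
  obtain \<delta>' where \<delta>': "\<delta>' > 0" "continuous_on {0..\<delta>'} P'" "strict_mono_on {0..\<delta>'} P'" by (rule passage_germ[OF 2])
  note zero = passage_zero[OF 1] passage_zero[OF 2]
  obtain \<epsilon> where \<epsilon>: "0 < \<epsilon>" "\<epsilon> \<le> \<delta>" "\<And>t. 0 < t \<Longrightarrow> t \<le> \<epsilon> \<Longrightarrow> 0 < P t \<and> P t < \<delta>'"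
    by (rule strict_mono_germ_near_zero[OF \<delta>(2,3) zero(1) \<delta>(1) \<delta>'(1)]) (rule that)
  have img: "P t \<in> {0..\<delta>'}" if "t \<in> {0..\<epsilon>}" for t
    using \<epsilon>(3)[of t] that zero \<delta>'(1) by (cases "t = 0") auto
  have "continuous_on {0..\<epsilon>} (P' \<circ> P)"
    unfolding o_def
    by (rule continuous_on_compose2[OF \<delta>'(2) continuous_on_subset[OF \<delta>(2)]]) (use \<epsilon>(2) img in auto)
  moreover have "strict_mono_on {0..\<epsilon>} (P' \<circ> P)"
  proof (rule strict_mono_onI)
    fix r s assume rs: "r \<in> {0..\<epsilon>}" "s \<in> {0..\<epsilon>}" "r < s"
    then have "P r < P s" using \<epsilon>(2) by (intro strict_mono_onD[OF \<delta>(3)]) auto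
    then show "(P' \<circ> P) r < (P' \<circ> P) s" using img[OF rs(1)] img[OF rs(2)] by (auto intro: strict_mono_onD[OF \<delta>'(3)])
  qed
  moreover have "\<exists>\<epsilon>>0. \<forall>t\<in>{0<..<\<epsilon>}. \<exists>\<tau>\<ge>K. v \<tau> (c t) = c'' ((P' \<circ> P) t) \<and> (\<forall>s\<in>{0..\<tau>}. v s (c t) \<in> N)"
    if N: "open N \<and> \<Lambda> \<subseteq> N" for N K
  proof -
    \<comment> \<open>K may be negative; nonnegative travel times are what allows the two arcs to be
      concatenated.\<close>
    obtain e1 where e1: "e1 > 0"
      "\<And>t. 0 < t \<Longrightarrow> t < e1 \<Longrightarrow> \<exists>\<tau>\<ge>max 0 K. v \<tau> (c t) = c' (P t) \<and> (\<forall>s\<in>{0..\<tau>}. v s (c t) \<in> N)"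
      using passage_time[OF 1 conjunct1[OF N] conjunct2[OF N]] by metis
    obtain e2 where e2: "e2 > 0"
      "\<And>t. 0 < t \<Longrightarrow> t < e2 \<Longrightarrow> \<exists>\<tau>\<ge>0. v \<tau> (c' t) = c'' (P' t) \<and> (\<forall>s\<in>{0..\<tau>}. v s (c' t) \<in> N)"
      using passage_time[OF 2 conjunct1[OF N] conjunct2[OF N]] by metis
    obtain e3 where e3: "0 < e3" "\<And>t. 0 < t \<Longrightarrow> t \<le> e3 \<Longrightarrow> 0 < P t \<and> P t < e2"
      using strict_mono_germ_near_zero[OF \<delta>(2,3) zero(1) \<delta>(1) e2(1)] by metis
    show ?thesis
    proof (rule exI[of _ "min e1 e3"], rule conjI[OF _ ballI])
      show "0 < min e1 e3" using e1(1) e3(1) by simp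
      fix t assume t: "t \<in> {0<..<min e1 e3}"
      obtain \<tau>1 where \<tau>1: "\<tau>1 \<ge> max 0 K" "v \<tau>1 (c t) = c' (P t)" "\<forall>s\<in>{0..\<tau>1}. v s (c t) \<in> N"
        using e1(2)[of t] t by auto
      obtain \<tau>2 where \<tau>2: "\<tau>2 \<ge> 0" "v \<tau>2 (c' (P t)) = c'' (P' (P t))" "\<forall>s\<in>{0..\<tau>2}. v s (c' (P t)) \<in> N"
        using e2(2)[of "P t"] e3(2)[of t] t by auto
      show "\<exists>\<tau>\<ge>K. v \<tau> (c t) = c'' ((P' \<circ> P) t) \<and> (\<forall>s\<in>{0..\<tau>}. v s (c t) \<in> N)"
      proof (intro exI[of _ "\<tau>2 + \<tau>1"] conjI ballI)
        show "v (\<tau>2 + \<tau>1) (c t) = c'' ((P' \<circ> P) t)" using \<tau>1(2) \<tau>2(2) by (simp flip: v_add)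
        fix s assume s: "s \<in> {0..\<tau>2 + \<tau>1}"
        show "v s (c t) \<in> N"
        proof (cases "s \<le> \<tau>1")
          case False
          then have "v (s - \<tau>1) (v \<tau>1 (c t)) \<in> N" using \<tau>2(3) s by (simp add: \<tau>1(2))
          then show ?thesis by (simp add: v_add)
        qed (use \<tau>1(3) s in auto)
      qed (use \<tau>1(1) \<tau>2(1) in auto)
    qed
  qed
  ultimately show ?thesis unfolding passage_def using \<epsilon>(1) zero by (auto simp: o_def)
qed

end

section \<open>Transit along a saddle connection\<close>

context box_flow begin

text \<open>On the section \<open>|X|\<close> is 1, while along an orbit in \<open>WX\<close> it
  changes strictly. Compactness of the section makes the length of time in \<open>WX\<close>
  uniform.\<close>

lemma sec_transversal:
  assumes a: "\<bar>a\<bar> = 1" and b: "\<bar>b\<bar> = 1" and \<delta>: "\<delta> < depth a"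
  obtains \<epsilon> where "\<epsilon> > 0"
    "\<And>t1 t2 s. t1 \<in> {0..\<delta>} \<Longrightarrow> t2 \<in> {0..\<delta>} \<Longrightarrow> \<bar>s\<bar> \<le> \<epsilon> \<Longrightarrow> v s (sec a b t1) = sec a b t2 \<Longrightarrow> s = 0"
proof -
  have s: "sec a b t \<in> WX" "\<bar>X (sec a b t)\<bar> = 1" if "t \<in> {0..\<delta>}" for t
    using sec_depth[OF a b, of t] that \<delta> a by (auto simp: WX_def)
  have "compact (sec a b ` {0..\<delta>})" by (intro compact_continuous_image continuous_on_sec[OF a b \<delta>] compact_Icc)
  then obtain \<epsilon> where \<epsilon>: "\<epsilon> > 0" "\<And>z s. z \<in> sec a b ` {0..\<delta>} \<Longrightarrow> \<bar>s\<bar> \<le> \<epsilon> \<Longrightarrow> v s z \<in> WX"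
    by (rule uniform_short_arc[OF _ open_WX]) (use s(1) in blast, rule that)
  show thesis
  proof (rule that[OF \<epsilon>(1)])
    fix t1 t2 r assume t: "t1 \<in> {0..\<delta>}" "t2 \<in> {0..\<delta>}" and r: "\<bar>r\<bar> \<le> \<epsilon>" "v r (sec a b t1) = sec a b t2"
    have arc: "v s (sec a b t1) \<in> WX" if "\<bar>s\<bar> \<le> \<epsilon>" for s using \<epsilon>(2) t(1) that by blast
    have "\<not> 0 < r" using X_decreasing[of 0 r "sec a b t1"] arc r s(2) t by auto
    moreover have "\<not> r < 0" using X_decreasing[of r 0 "sec a b t1"] arc r s(2) t by auto
    ultimately show "r = 0" by simp
  qed
qed

lemma inj_on_sec:
  assumes "\<bar>a\<bar> = 1" "\<bar>b\<bar> = 1" "\<delta> < depth a"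
  shows "inj_on (sec a b) {0..\<delta>}"
proof (rule inj_onI)
  fix t1 t2 assume t: "t1 \<in> {0..\<delta>}" "t2 \<in> {0..\<delta>}" "sec a b t1 = sec a b t2"
  then have "g a + b * t1 = g a + b * t2"
    using sec_depth(4)[OF assms(1,2), of t1] sec_depth(4)[OF assms(1,2), of t2] assms(3) by auto
  then show "t1 = t2" using assms(2) by auto
qed

text \<open>A flow box without an implicit function theorem: near time T the function
  \<open>a * X\<close> decreases strictly along the orbits, so each of them meets the section
  exactly once. The hitting time has a closed graph and is thus continuous, and transversality of c
  makes the hitting map injective.\<close>

lemma transit:
  fixes c :: "real \<Rightarrow> 'a"
  assumes a: "\<bar>a\<bar> = 1" and \<delta>: "0 < \<delta>" and c: "continuous_on {0..\<delta>} c" "inj_on c {0..\<delta>}"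
    and \<epsilon>0: "\<epsilon>0 > 0" "\<And>t1 t2 s. t1 \<in> {0..\<delta>} \<Longrightarrow> t2 \<in> {0..\<delta>} \<Longrightarrow> \<bar>s\<bar> \<le> \<epsilon>0 \<Longrightarrow> v s (c t1) = c t2 \<Longrightarrow> s = 0"
    and T: "v T (c 0) = zs a"
  obtains b \<delta>' P where "\<bar>b\<bar> = 1" "0 < \<delta>'" "\<delta>' \<le> \<delta>" "continuous_on {0..\<delta>'} P" "strict_mono_on {0..\<delta>'} P" "P 0 = 0"
    "\<And>t. t \<in> {0..\<delta>'} \<Longrightarrow> \<exists>\<tau>. \<bar>\<tau> - T\<bar> \<le> 1 \<and> v \<tau> (c t) = sec a b (P t)"
proof -
  have z: "zs a \<in> U" "X (zs a) = a" "\<bar>Y (zs a)\<bar> < 1"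
    using zs_stay[of a] X_zs[of a] Y_zs[of a] g_less[of a] stay_B[of "zs a"] a by (auto simp: B_iff)
  let ?W = "{z \<in> U. \<psi> z \<in> {x. 1/2 < a * x \<and> a * x < 2} \<times> {-1<..<1}}"
  have W: "open ?W" by (intro open_coord open_Times open_greaterThanLessThan open_Collect_conj open_Collect_less continuous_intros)
  have aa: "a * a = 1" "a = 1 \<or> a = -1" using a by (auto simp: abs_eq_1_cases)
  have WX: "z \<in> WX" "\<bar>X z\<bar> = a * X z" if "z \<in> ?W" for z using that aa(2) by (auto simp: WX_def mem_Times_iff)
  have "zs a \<in> ?W" using z aa by (auto simp: mem_Times_iff)
  then obtain \<epsilon>1 where \<epsilon>1: "\<epsilon>1 > 0" "\<And>s. \<bar>s\<bar> \<le> \<epsilon>1 \<Longrightarrow> v s (zs a) \<in> ?W" by (rule short_arc[OF W]) (rule that)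
  \<comment> \<open>Half of \<open>\<epsilon>0\<close>, so that two hitting times differ by at most
    \<open>\<epsilon>0\<close>; at most 1 for the bound on \<open>\<tau> - T\<close> in the
    conclusion.\<close>
  define \<epsilon> where "\<epsilon> = Min {\<epsilon>1, \<epsilon>0 / 2, 1}"
  have \<epsilon>: "\<epsilon> > 0" "\<epsilon> \<le> \<epsilon>1" "2 * \<epsilon> \<le> \<epsilon>0" "\<epsilon> \<le> 1" using \<epsilon>1 \<epsilon>0(1) by (auto simp: \<epsilon>_def)
  let ?I = "{T - \<epsilon>..T + \<epsilon>}"
  have arc0: "v s (c 0) \<in> ?W" if "s \<in> ?I" for s
  proof -
    have "v (s - T) (zs a) \<in> ?W" using that \<epsilon> by (intro \<epsilon>1(2)) auto
    then show ?thesis by (simp add: v_add flip: T)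
  qed
  obtain N where N: "open N" "c 0 \<in> N" "\<And>z s. z \<in> N \<Longrightarrow> s \<in> ?I \<Longrightarrow> v s z \<in> ?W"
    by (rule tube[OF W compact_Icc[of "T - \<epsilon>" "T + \<epsilon>"] arc0]) (assumption, rule that)
  let ?V = "{z \<in> U. \<psi> z \<in> {x. 1 < a * x} \<times> UNIV}" and ?V' = "{z \<in> U. \<psi> z \<in> {x. a * x < 1} \<times> UNIV}"
  have V: "open ?V" "open ?V'" by (intro open_coord open_Times open_UNIV open_Collect_less continuous_intros)+
  define M where "M = N \<inter> v (T - \<epsilon>) -` ?V \<inter> v (T + \<epsilon>) -` ?V'"
  have M: "open M" unfolding M_def using N(1) V by (intro open_Int open_vimage continuous_intros)
  have mono0: "a * X (v s' (c 0)) < a * X (v s (c 0))" if "s \<in> ?I" "s' \<in> ?I" "s < s'" for s s'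
  proof -
    have "\<bar>X (v s' (c 0))\<bar> < \<bar>X (v s (c 0))\<bar>" using that WX(1) arc0 by (intro X_decreasing) auto
    then show ?thesis using WX(2)[OF arc0[OF that(1)]] WX(2)[OF arc0[OF that(2)]] by simp
  qed
  have at_T: "a * X (v T (c 0)) = 1" using T z(2) aa by simp
  have I: "T - \<epsilon> \<in> ?I" "T + \<epsilon> \<in> ?I" "T \<in> ?I" using \<epsilon> by auto
  have "c 0 \<in> M"
    unfolding M_def using N(2) mono0[OF I(1,3)] mono0[OF I(3,2)] arc0[OF I(1)] arc0[OF I(2)] at_T \<epsilon>(1) by (auto simp: mem_Times_iff)
  moreover have "(c \<longlongrightarrow> c 0) (at 0 within {0..\<delta>})" using c(1) \<delta> by (simp add: continuous_on_def)
  ultimately have "eventually (\<lambda>t. c t \<in> M) (at 0 within {0..\<delta>})" using M by (auto dest: topological_tendstoD)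
  then obtain e where e: "e > 0" "\<And>t. t \<in> {0..\<delta>} \<Longrightarrow> t \<noteq> 0 \<Longrightarrow> dist t 0 < e \<Longrightarrow> c t \<in> M"
    unfolding eventually_at by auto
  define \<delta>' where "\<delta>' = min \<delta> (e / 2)"
  have \<delta>': "0 < \<delta>'" "\<delta>' \<le> \<delta>" using \<delta> e(1) by (auto simp: \<delta>'_def)
  have cM: "c t \<in> M" if "t \<in> {0..\<delta>'}" for t
    using e(2)[of t] e(1) that \<open>c 0 \<in> M\<close> by (cases "t = 0") (auto simp: \<delta>'_def dist_real_def)
  have arc: "v s (c t) \<in> ?W" if "t \<in> {0..\<delta>'}" "s \<in> ?I" for t s
    using cM[OF that(1)] that(2) by (intro N(3)) (auto simp: M_def)
  have mono: "a * X (v s' (c t)) < a * X (v s (c t))" if t: "t \<in> {0..\<delta>'}" and s: "s \<in> ?I" "s' \<in> ?I" "s < s'" for t s s'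
  proof -
    have "\<bar>X (v s' (c t))\<bar> < \<bar>X (v s (c t))\<bar>" using s WX(1) arc[OF t] by (intro X_decreasing) auto
    then show ?thesis using WX(2)[OF arc[OF t s(1)]] WX(2)[OF arc[OF t s(2)]] by simp
  qed
  have ex: "\<exists>\<tau>\<in>?I. a * X (v \<tau> (c t)) = 1" if t: "t \<in> {0..\<delta>'}" for t
  proof -
    have "1 \<le> a * X (v (T - \<epsilon>) (c t))" "a * X (v (T + \<epsilon>) (c t)) \<le> 1"
      using cM[OF t] by (auto simp: M_def mem_Times_iff)
    moreover have "continuous_on ?I (\<lambda>s. a * X (v s (c t)))"
      using arc[OF t] by (intro continuous_intros) auto
    ultimately show ?thesis using IVT2'[of "\<lambda>s. a * X (v s (c t))" "T + \<epsilon>" 1 "T - \<epsilon>"] \<epsilon>(1) by auto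
  qed
  define \<tau> where "\<tau> t = (SOME \<tau>. \<tau> \<in> ?I \<and> a * X (v \<tau> (c t)) = 1)" for t
  have \<tau>: "\<tau> t \<in> ?I" "a * X (v (\<tau> t) (c t)) = 1" if "t \<in> {0..\<delta>'}" for t
    using someI_ex[of "\<lambda>\<tau>. \<tau> \<in> ?I \<and> a * X (v \<tau> (c t)) = 1"] ex[OF that] unfolding \<tau>_def by blast+
  have uniq: "s = \<tau> t" if "t \<in> {0..\<delta>'}" "s \<in> ?I" "a * X (v s (c t)) = 1" for t s
    using mono[OF that(1,2) \<tau>(1)[OF that(1)]] mono[OF that(1) \<tau>(1)[OF that(1)] that(2)] \<tau>(2)[OF that(1)] that(3)
    by (cases s "\<tau> t" rule: linorder_cases) auto
  have graph: "(\<lambda>t. (t, \<tau> t)) ` {0..\<delta>'} = ({0..\<delta>'} \<times> ?I) \<inter> (\<lambda>q. a * X (v (snd q) (c (fst q)))) -` {1}"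
    using \<tau> uniq by auto
  have cont2: "continuous_on ({0..\<delta>'} \<times> ?I) (\<lambda>q. v (snd q) (c (fst q)))"
    by (intro continuous_intros continuous_on_compose2[OF c(1)]) (use \<delta>' in auto)
  have cont3: "continuous_on ({0..\<delta>'} \<times> ?I) (\<lambda>q. a * X (v (snd q) (c (fst q))))"
    using arc by (intro continuous_on_mult continuous_on_const continuous_X cont2) auto
  have "closedin (top_of_set ({0..\<delta>'} \<times> ?I)) ((\<lambda>t. (t, \<tau> t)) ` {0..\<delta>'})"
    unfolding graph by (rule continuous_closedin_preimage[OF cont3]) simp
  then have cont_\<tau>: "continuous_on {0..\<delta>'} \<tau>"
    using continuous_closed_graph_eq[of ?I \<tau> "{0..\<delta>'}"] \<tau>(1) by auto
  define w where "w t = v (\<tau> t) (c t)" for t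
  have w: "w t \<in> U" "X (w t) = a" "\<bar>Y (w t)\<bar> < 1" if "t \<in> {0..\<delta>'}" for t
  proof -
    show "w t \<in> U" "\<bar>Y (w t)\<bar> < 1" using arc[OF that \<tau>(1)[OF that]] by (auto simp: w_def mem_Times_iff)
    have "a * (a * X (w t)) = a * 1" using \<tau>(2)[OF that] by (simp add: w_def)
    then show "X (w t) = a" using aa(1) by (simp flip: mult.assoc)
  qed
  define Q where "Q t = Y (w t) - g a" for t
  have "continuous_on {0..\<delta>'} w"
    unfolding w_def by (intro continuous_intros cont_\<tau> continuous_on_subset[OF c(1)]) (use \<delta>' in auto)
  then have cont_Q: "continuous_on {0..\<delta>'} Q"
    unfolding Q_def using w(1) by (intro continuous_intros) auto
  have z0: "0 \<in> {0..\<delta>'}" using \<delta>'(1) by simp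
  have "T = \<tau> 0" using uniq[OF z0 I(3) at_T] .
  then have Q0: "Q 0 = 0" using T Y_zs[of a] a by (simp add: Q_def w_def)
  have inj: "inj_on Q {0..\<delta>'}"
  proof (rule inj_onI)
    fix t1 t2 assume t: "t1 \<in> {0..\<delta>'}" "t2 \<in> {0..\<delta>'}" "Q t1 = Q t2"
    have "\<psi> (w t1) = \<psi> (w t2)" using w(2)[OF t(1)] w(2)[OF t(2)] t(3) by (simp add: Q_def prod_eq_iff)
    then have "w t1 = w t2" by (rule coord_eqD[OF w(1)[OF t(1)] w(1)[OF t(2)]])
    then have "v (- \<tau> t2) (v (\<tau> t1) (c t1)) = v (- \<tau> t2) (v (\<tau> t2) (c t2))" by (simp only: w_def)
    then have eq: "v (\<tau> t1 - \<tau> t2) (c t1) = c t2" by (simp add: v_add)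
    moreover have "\<bar>\<tau> t1 - \<tau> t2\<bar> \<le> \<epsilon>0" using \<tau>(1)[OF t(1)] \<tau>(1)[OF t(2)] \<epsilon>(3) by auto
    ultimately have "\<tau> t1 - \<tau> t2 = 0" using t \<delta>' by (intro \<epsilon>0(2)[of t1 t2]) auto
    then have "c t1 = c t2" using eq by simp
    then show "t1 = t2" using inj_onD[OF c(2)] t \<delta>' by auto
  qed
  \<comment> \<open>The curve arrives on one side of the branch; b is the sign that makes the
    distance from the branch an increasing parameter.\<close>
  obtain b where b: "\<bar>b\<bar> = 1" "strict_mono_on {0..\<delta>'} (\<lambda>t. b * Q t)"
  proof -
    have "strict_mono_on {0..\<delta>'} Q \<or> strict_antimono_on {0..\<delta>'} Q"
      using injective_eq_monotone_map[OF is_interval_cc cont_Q] inj by blast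
    then show thesis
    proof
      assume "strict_mono_on {0..\<delta>'} Q"
      then show thesis by (intro that[of 1]) simp_all
    next
      assume "strict_antimono_on {0..\<delta>'} Q"
      then show thesis by (intro that[of "-1"]) (auto simp: monotone_on_def)
    qed
  qed
  show thesis
  proof (rule that[OF b(1) \<delta>' _ b(2)])
    show "continuous_on {0..\<delta>'} (\<lambda>t. b * Q t)" by (intro continuous_intros cont_Q)
    show "b * Q 0 = 0" by (simp add: Q0)
    fix t assume t: "t \<in> {0..\<delta>'}"
    have bb: "b * (b * Q t) = Q t" using b(1) by (auto simp: abs_eq_1_cases)
    have "sec a b (b * Q t) = w t"
      using w[OF t] by (intro sec_eqI[OF a]) (simp_all only: bb, simp_all add: Q_def)
    moreover have "\<bar>\<tau> t - T\<bar> \<le> 1" using \<tau>(1)[OF t] \<epsilon>(4) by auto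
    ultimately show "\<exists>\<tau>. \<bar>\<tau> - T\<bar> \<le> 1 \<and> v \<tau> (c t) = sec a b (b * Q t)" by (auto simp: w_def)
  qed
qed

end

context box_flow begin

interpretation rev: box_flow "\<lambda>t. v (- t)" p U "prod.swap \<circ> \<psi>"
  by (rule box_flow_reverse)

text \<open>The corner map at p followed by the transit along the connection from the unstable
  branch b to the stable branch \<open>a'\<close> of q. Long travel times come from the corner; the
  transit takes a time close to T.\<close>

lemma corner_passage:
  assumes a: "\<bar>a\<bar> = 1" and b: "\<bar>b\<bar> = 1" and Q: "box_flow v q U' \<psi>'" and a': "\<bar>a'\<bar> = 1"
    and \<Lambda>: "p \<in> \<Lambda>" "\<And>s. v s (zs a) \<in> \<Lambda>" "\<And>s. v s (rev.zs b) \<in> \<Lambda>"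
    and T: "v T (rev.zs b) = box_flow.zs v U' \<psi>' a'"
  shows "\<exists>b' P. \<bar>b'\<bar> = 1 \<and> passage \<Lambda> (sec a b) (box_flow.sec v U' \<psi>' a' b') P"
proof -
  interpret Q: box_flow v q U' \<psi>' by (rule Q)
  obtain \<delta>1 D where D: "0 < \<delta>1" "\<delta>1 < depth a" "continuous_on {0..\<delta>1} D" "strict_mono_on {0..\<delta>1} D" "D 0 = 0"
    "\<And>t. 0 < t \<Longrightarrow> t \<le> \<delta>1 \<Longrightarrow> \<exists>T. corner a b t (D t) T"
    by (rule corner_map[OF a b]) (rule that)
  let ?c = "rev.sec b a"
  define \<delta>2 where "\<delta>2 = rev.depth b / 2"
  have \<delta>2: "0 < \<delta>2" "\<delta>2 < rev.depth b" using rev.depth(1)[OF b] by (auto simp: \<delta>2_def)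
  obtain \<epsilon>0 where \<epsilon>0: "\<epsilon>0 > 0"
    "\<And>t1 t2 s. t1 \<in> {0..\<delta>2} \<Longrightarrow> t2 \<in> {0..\<delta>2} \<Longrightarrow> \<bar>s\<bar> \<le> \<epsilon>0 \<Longrightarrow> v (- s) (?c t1) = ?c t2 \<Longrightarrow> s = 0"
    by (rule rev.sec_transversal[OF b a \<delta>2(2)]) (rule that)
  have trans: "s = 0" if "t1 \<in> {0..\<delta>2}" "t2 \<in> {0..\<delta>2}" "\<bar>s\<bar> \<le> \<epsilon>0" "v s (?c t1) = ?c t2" for t1 t2 s
    using \<epsilon>0(2)[of t1 t2 "- s"] that by simp
  have c0: "?c 0 = rev.zs b" by (rule rev.sec_0)
  have T0: "v T (?c 0) = Q.zs a'" by (simp add: c0 T)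
  obtain b' \<delta>' P where P: "\<bar>b'\<bar> = 1" "0 < \<delta>'" "\<delta>' \<le> \<delta>2" "continuous_on {0..\<delta>'} P" "strict_mono_on {0..\<delta>'} P" "P 0 = 0"
    "\<And>t. t \<in> {0..\<delta>'} \<Longrightarrow> \<exists>\<tau>. \<bar>\<tau> - T\<bar> \<le> 1 \<and> v \<tau> (?c t) = Q.sec a' b' (P t)"
    by (rule Q.transit[OF a' \<delta>2(1) rev.continuous_on_sec[OF b a \<delta>2(2)] rev.inj_on_sec[OF b a \<delta>2(2)] \<epsilon>0(1) trans T0])
      (assumption+, rule that)
  obtain \<epsilon> where \<epsilon>: "0 < \<epsilon>" "\<epsilon> \<le> \<delta>1" "\<And>t. 0 < t \<Longrightarrow> t \<le> \<epsilon> \<Longrightarrow> 0 < D t \<and> D t < \<delta>'"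
    by (rule strict_mono_germ_near_zero[OF D(3,4,5,1) P(2)]) (rule that)
  have img: "D t \<in> {0..\<delta>'}" if "t \<in> {0..\<epsilon>}" for t
    using \<epsilon>(3)[of t] that D(5) P(2) by (cases "t = 0") auto
  have "continuous_on {0..\<epsilon>} (\<lambda>t. P (D t))"
    by (rule continuous_on_compose2[OF P(4) continuous_on_subset[OF D(3)]]) (use \<epsilon>(2) img in auto)
  moreover have "strict_mono_on {0..\<epsilon>} (\<lambda>t. P (D t))"
  proof (rule strict_mono_onI)
    fix r s assume rs: "r \<in> {0..\<epsilon>}" "s \<in> {0..\<epsilon>}" "r < s"
    then have "D r < D s" using \<epsilon>(2) by (intro strict_mono_onD[OF D(4)]) auto
    then show "P (D r) < P (D s)" using img[OF rs(1)] img[OF rs(2)] by (auto intro: strict_mono_onD[OF P(5)])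
  qed
  moreover have "\<exists>\<epsilon>>0. \<forall>t\<in>{0<..<\<epsilon>}. \<exists>\<tau>\<ge>K. v \<tau> (sec a b t) = Q.sec a' b' (P (D t)) \<and> (\<forall>s\<in>{0..\<tau>}. v s (sec a b t) \<in> N)"
    if N: "open N \<and> \<Lambda> \<subseteq> N" for N K
  proof -
    \<comment> \<open>Bounds the transit time, which may be negative; a corner time beyond
      \<open>|K| + L\<close> therefore leaves at least K in total.\<close>
    define L where "L = \<bar>T\<bar> + 1"
    have N': "open N" "p \<in> N" "\<And>s. v s (zs a) \<in> N" "\<And>s. v s (rev.zs b) \<in> N" using N \<Lambda> by auto
    obtain e1 where e1: "e1 > 0" "\<And>t t' T. 0 \<le> t \<Longrightarrow> t < e1 \<Longrightarrow> 0 \<le> t' \<Longrightarrow> t' < e1 \<Longrightarrow> corner a b t t' T \<Longrightarrow>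
        T > \<bar>K\<bar> + L \<and> (\<forall>s\<in>{0..T}. v s (sec a b t) \<in> N)"
      by (rule corner_close[OF a b N']) (rule that)
    obtain M where M: "open M" "rev.zs b \<in> M" "\<And>z s. z \<in> M \<Longrightarrow> s \<in> {-L..L} \<Longrightarrow> v s z \<in> N"
      by (rule tube[OF N'(1) compact_Icc[of "-L" L] N'(4)]) (rule that)
    obtain e2 where e2: "e2 > 0" "\<And>t. 0 \<le> t \<Longrightarrow> t < e2 \<Longrightarrow> ?c t \<in> M"
      by (rule rev.sec_near[OF b a M(1,2)]) (rule that)
    have "0 < min e1 e2" using e1(1) e2(1) by simp
    obtain e3 where e3: "0 < e3" "e3 \<le> \<delta>1" "\<And>t. 0 < t \<Longrightarrow> t \<le> e3 \<Longrightarrow> 0 < D t \<and> D t < min e1 e2"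
      by (rule strict_mono_germ_near_zero[OF D(3,4,5,1) \<open>0 < min e1 e2\<close>]) (rule that)
    define e where "e = Min {e1, e3, \<epsilon>}"
    show ?thesis
    proof (rule exI[of _ e], rule conjI[OF _ ballI])
      show "0 < e" using e1(1) e3(1) \<epsilon>(1) by (simp add: e_def)
      fix t assume "t \<in> {0<..<e}"
      then have t: "0 < t" "t < e1" "t \<le> e3" "t \<le> \<epsilon>" by (auto simp: e_def)
      have Dt: "0 < D t" "D t < e1" "D t < e2" "D t \<in> {0..\<delta>'}" using e3(3)[OF t(1,3)] img[of t] t by auto
      have "t \<le> \<delta>1" using t(4) \<epsilon>(2) by simp
      from D(6)[OF t(1) this] obtain T1 where c: "corner a b t (D t) T1" by blast
      have T1: "T1 > \<bar>K\<bar> + L" "\<forall>s\<in>{0..T1}. v s (sec a b t) \<in> N"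
        using e1(2)[OF _ t(2) _ Dt(2) c] t(1) Dt(1) by auto
      obtain \<tau> where \<tau>: "\<bar>\<tau> - T\<bar> \<le> 1" "v \<tau> (?c (D t)) = Q.sec a' b' (P (D t))" using P(7)[OF Dt(4)] by blast
      have hit: "v T1 (sec a b t) = ?c (D t)" using c by (simp add: corner_def)
      show "\<exists>\<tau>\<ge>K. v \<tau> (sec a b t) = Q.sec a' b' (P (D t)) \<and> (\<forall>s\<in>{0..\<tau>}. v s (sec a b t) \<in> N)"
      proof (rule exI[of _ "\<tau> + T1"], intro conjI ballI)
        show "K \<le> \<tau> + T1" using \<tau>(1) T1(1) by (simp add: L_def)
        show "v (\<tau> + T1) (sec a b t) = Q.sec a' b' (P (D t))" using \<tau>(2) hit by (simp flip: v_add)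
        fix s assume s: "s \<in> {0..\<tau> + T1}"
        show "v s (sec a b t) \<in> N"
        proof (cases "s \<le> T1")
          case False
          then have "v (s - T1) (?c (D t)) \<in> N"
            using s \<tau>(1) Dt by (intro M(3) e2(2)) (auto simp: L_def)
          then show ?thesis by (simp add: v_add flip: hit)
        qed (use T1(2) s in auto)
      qed
    qed
  qed
  ultimately have "passage \<Lambda> (sec a b) (Q.sec a' b') (\<lambda>t. P (D t))"
    unfolding passage_def using \<epsilon>(1) D(5) P(6) by auto
  then show ?thesis using P(1) by blast
qed

end

section \<open>Extended orbits\<close>

text \<open>The least set closed under the two rules stands in for the ordinal stages, with which it
  is identified at the end. The set \<open>Sd\<close> of saddles is a parameter, so that reversing
  time changes only \<open>v\<close> and only boxes, not the saddle property, have to be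
  transported.\<close>

inductive_set ext_fwd :: "(real \<Rightarrow> 'a \<Rightarrow> 'a::topological_space) \<Rightarrow> 'a set \<Rightarrow> 'a \<Rightarrow> 'a set"
  for v Sd x where
  orb: "0 \<le> t \<Longrightarrow> v t x \<in> ext_fwd v Sd x"
| sad: "x' \<in> ext_fwd v Sd x \<Longrightarrow> p \<in> Sd \<Longrightarrow> omega_limit v x' = {p} \<Longrightarrow> alpha_limit v z = {p} \<Longrightarrow> z \<in> ext_fwd v Sd x"

definition ext :: "(real \<Rightarrow> 'a \<Rightarrow> 'a::topological_space) \<Rightarrow> 'a set \<Rightarrow> 'a \<Rightarrow> 'a set" where
  "ext v Sd x = ext_fwd v Sd x \<union> ext_fwd (\<lambda>t. v (- t)) Sd x"

definition cl_ext :: "(real \<Rightarrow> 'a \<Rightarrow> 'a::topological_space) \<Rightarrow> 'a set \<Rightarrow> 'a \<Rightarrow> 'a set" where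
  "cl_ext v Sd x = closure (ext v Sd x)"

lemma ext_reverse: "ext (\<lambda>t. v (- t)) Sd x = ext v Sd x"
  by (simp add: ext_def Un_commute)

lemma cl_ext_reverse: "cl_ext (\<lambda>t. v (- t)) Sd x = cl_ext v Sd x"
  by (simp add: cl_ext_def ext_reverse)

lemma orbit_reverse: "orbit (\<lambda>t. v (- t)) x = orbit v x"
proof -
  have "v t x \<in> range (\<lambda>t. v (- t) x)" for t :: real by (rule range_eqI[of _ _ "- t"]) simp
  then show ?thesis by (auto simp: orbit_def)
qed

section \<open>Alpha limits by time reversal\<close>

context compact_flow begin

lemma omega_reverse: "omega_limit (\<lambda>t. v (- t)) x = alpha_limit v x"
  by (simp add: alpha_omega)

lemma alpha_reverse: "alpha_limit (\<lambda>t. v (- t)) x = omega_limit v x"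
  using compact_flow.alpha_omega[OF compact_flow_reverse] by simp

lemma alpha_orbit [simp]: "alpha_limit v (v s x) = alpha_limit v x"
  using compact_flow.omega_orbit[OF compact_flow_reverse, of "- s" x] by (simp add: omega_reverse)

lemma alpha_fixed: "(\<And>t. v t p = p) \<Longrightarrow> alpha_limit v p = {p}"
  using compact_flow.omega_fixed[OF compact_flow_reverse, of p] by (simp add: omega_reverse)

lemma alpha_invariant: "y \<in> alpha_limit v x \<Longrightarrow> v s y \<in> alpha_limit v x"
  using compact_flow.omega_invariant[OF compact_flow_reverse, of y x "- s"] by (simp add: omega_reverse)

lemma closed_alpha: "closed (alpha_limit v x)"
  by (simp add: alpha_limit_def closed_INT)

lemma limits_same_orbit:
  assumes "orbit v x = orbit v y"
  shows "omega_limit v x = omega_limit v y" "alpha_limit v x = alpha_limit v y"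
proof -
  obtain t where "x = v t y" using assms orbit_self[of x] by (auto simp: orbit_def)
  then show "omega_limit v x = omega_limit v y" "alpha_limit v x = alpha_limit v y" by simp_all
qed

lemma omega_subset_closure_orbit: "omega_limit v x \<subseteq> closure (orbit v x)"
  by (rule omega_subset_closed[of _ 0]) (auto simp: orbit_def intro: subsetD[OF closure_subset])

lemma alpha_subset_closure_orbit: "alpha_limit v x \<subseteq> closure (orbit v x)"
  using compact_flow.omega_subset_closure_orbit[OF compact_flow_reverse, of x]
  by (simp add: omega_reverse orbit_reverse)

text \<open>A point outside both limit sets is outside the closures of some two tails of the orbit,
  and what remains of the orbit is a compact arc.\<close>

lemma closed_limits_orbit: "closed (orbit v x \<union> omega_limit v x \<union> alpha_limit v x)"
proof -
  have "y \<in> orbit v x" if y: "y \<in> closure (orbit v x)" "y \<notin> omega_limit v x" "y \<notin> alpha_limit v x" for y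
  proof -
    obtain n where n: "y \<notin> closure {v t x |t. t > n}" using y(2) by (auto simp: omega_limit_def)
    obtain m where m: "y \<notin> closure {v t x |t. t < m}" using y(3) by (auto simp: alpha_limit_def)
    have "orbit v x \<subseteq> closure {v t x |t. t > n} \<union> closure {v t x |t. t < m} \<union> (\<lambda>t. v t x) ` {m..n}"
    proof
      fix y assume "y \<in> orbit v x"
      then obtain t where t: "y = v t x" by (auto simp: orbit_def)
      consider "t > n" | "t < m" | "t \<in> {m..n}" by fastforce
      then show "y \<in> closure {v t x |t. t > n} \<union> closure {v t x |t. t < m} \<union> (\<lambda>t. v t x) ` {m..n}"
        by cases (auto simp: t intro: subsetD[OF closure_subset])
    qed
    moreover have "compact ((\<lambda>t. v t x) ` {m..n})" by (intro compact_continuous_image continuous_intros) auto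
    ultimately have "closure (orbit v x) \<subseteq> closure {v t x |t. t > n} \<union> closure {v t x |t. t < m} \<union> (\<lambda>t. v t x) ` {m..n}"
      by (intro closure_minimal closed_Un closed_closure compact_imp_closed)
    then show ?thesis using y(1) n m by (auto simp: orbit_def)
  qed
  then have "closure (orbit v x) \<subseteq> orbit v x \<union> omega_limit v x \<union> alpha_limit v x" by blast
  moreover have "orbit v x \<union> omega_limit v x \<union> alpha_limit v x \<subseteq> closure (orbit v x)"
    using closure_subset omega_subset_closure_orbit alpha_subset_closure_orbit by blast
  ultimately show ?thesis by (metis closed_closure subset_antisym)
qed

end

section \<open>Extended orbits for a set of saddles with boxes\<close>

locale saddle_flow = compact_flow v for v :: "real \<Rightarrow> 'a::t2_space \<Rightarrow> 'a" +
  fixes Sd :: "'a set"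
  assumes box_exists: "p \<in> Sd \<Longrightarrow> \<exists>U \<psi>. saddle_box v p U \<psi>"
begin

abbreviation "rv \<equiv> \<lambda>t. v (- t)"
abbreviation "fwd \<equiv> ext_fwd v Sd"
abbreviation "bwd \<equiv> ext_fwd rv Sd"
abbreviation "E \<equiv> ext v Sd"
abbreviation "C \<equiv> cl_ext v Sd"

lemma saddle_flow_reverse: "saddle_flow rv Sd"
  using saddle_box_reverse[OF flow] box_exists
  by (intro saddle_flow.intro compact_flow_reverse saddle_flow_axioms.intro) blast

lemma obtain_box:
  assumes "p \<in> Sd"
  obtains U \<psi> where "box_flow v p U \<psi>"
  using box_exists[OF assms] box_flow.intro[OF compact_flow_axioms box_flow_axioms.intro] by blast

lemma Sd_fixed: "p \<in> Sd \<Longrightarrow> v t p = p"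
  using box_exists saddle_boxD(4) by metis

lemma omega_Sd: "p \<in> Sd \<Longrightarrow> omega_limit v p = {p}"
  and alpha_Sd: "p \<in> Sd \<Longrightarrow> alpha_limit v p = {p}"
  by (simp_all add: omega_fixed alpha_fixed Sd_fixed)

lemma fwd_self: "x \<in> fwd x"
  using ext_fwd.orb[of 0 v x Sd] by simp

lemma fwd_forward: "y \<in> fwd x \<Longrightarrow> 0 \<le> t \<Longrightarrow> v t y \<in> fwd x"
proof (induction rule: ext_fwd.induct)
  case (orb s)
  then show ?case using ext_fwd.orb[of "t + s" v x Sd] by (simp add: v_add)
next
  case (sad x' p z)
  then show ?case using ext_fwd.sad[of x' v Sd x p "v t z"] by simp
qed

lemma fwd_trans: "z \<in> fwd y \<Longrightarrow> y \<in> fwd x \<Longrightarrow> z \<in> fwd x"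
proof (induction rule: ext_fwd.induct)
  case (orb s)
  then show ?case by (simp add: fwd_forward)
next
  case (sad x' p z)
  then show ?case using ext_fwd.sad[of x' v Sd x p z] by simp
qed

text \<open>A saddle step from x' through p to z is, in reversed time, a step from z through p to
  x'. This makes belonging to an extended orbit a symmetric relation.\<close>

lemma fwd_reverse: "y \<in> fwd x \<Longrightarrow> x \<in> bwd y"
proof (induction rule: ext_fwd.induct)
  case (orb t)
  then show ?case using ext_fwd.orb[of t rv "v t x" Sd] by simp
next
  case (sad x' p z)
  have "z \<in> bwd z" by (rule saddle_flow.fwd_self[OF saddle_flow_reverse])
  then have "x' \<in> bwd z"
    using ext_fwd.sad[of z rv Sd z p x'] sad by (simp add: omega_reverse alpha_reverse)
  then show ?case using saddle_flow.fwd_trans[OF saddle_flow_reverse] sad.IH by blast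
qed

lemma bwd_iff: "x \<in> bwd y \<longleftrightarrow> y \<in> fwd x"
  using fwd_reverse[of y x] saddle_flow.fwd_reverse[OF saddle_flow_reverse, of x y] by auto

lemma ext_sym: "y \<in> E x \<longleftrightarrow> x \<in> E y"
  by (auto simp: ext_def bwd_iff)

text \<open>The set \<open>fwd x\<close> alone need not be invariant: flowing back past x leads into
  the negative orbit of x.\<close>

lemma fwd_orbit_ext: "y \<in> fwd x \<Longrightarrow> v s y \<in> E x"
proof (cases rule: ext_fwd.cases, assumption)
  fix t assume y: "y = v t x" "0 \<le> t"
  show ?thesis
  proof (cases "0 \<le> s + t")
    case True
    then show ?thesis using ext_fwd.orb[of "s + t" v x Sd] y by (simp add: ext_def v_add add.commute)
  next
    case False
    then show ?thesis using ext_fwd.orb[of "- (s + t)" rv x Sd] y by (simp add: ext_def v_add add.commute)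
  qed
next
  fix x' p assume "x' \<in> fwd x" "p \<in> Sd" "omega_limit v x' = {p}" "alpha_limit v y = {p}"
  then show ?thesis using ext_fwd.sad[of x' v Sd x p "v s y"] by (simp add: ext_def)
qed

lemma ext_invariant: "y \<in> E x \<Longrightarrow> v s y \<in> E x"
  using fwd_orbit_ext[of y x s] saddle_flow.fwd_orbit_ext[OF saddle_flow_reverse, of y x "- s"]
  by (auto simp: ext_def Un_commute)

lemma ext_self: "x \<in> E x"
  by (simp add: ext_def fwd_self)

lemma closed_C: "closed (C x)" and ext_subset_C: "E x \<subseteq> C x"
  by (simp_all add: cl_ext_def closure_subset)

lemma C_invariant: "y \<in> C x \<Longrightarrow> v s y \<in> C x"
proof -
  assume "y \<in> C x"
  moreover have "closed (v s -` C x)" by (intro closed_vimage closed_C continuous_intros)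
  moreover have "E x \<subseteq> v s -` C x" using ext_invariant ext_subset_C by blast
  ultimately show ?thesis using closure_minimal[of "E x" "v s -` C x"] by (auto simp: cl_ext_def)
qed

lemma C_self: "x \<in> C x"
  using ext_self ext_subset_C by blast

lemma orbit_subset_C: "y \<in> C x \<Longrightarrow> closure (orbit v y) \<subseteq> C x"
  by (rule closure_minimal[OF orbit_subset_closed_invariant[OF C_invariant] closed_C])

lemma omega_subset_C: "y \<in> C x \<Longrightarrow> omega_limit v y \<subseteq> C x"
  and alpha_subset_C: "y \<in> C x \<Longrightarrow> alpha_limit v y \<subseteq> C x"
  using orbit_subset_C omega_subset_closure_orbit alpha_subset_closure_orbit by blast+

definition generic :: "'a \<Rightarrow> bool" where
  "generic x \<longleftrightarrow> (\<forall>p\<in>Sd. omega_limit v x \<noteq> {p} \<and> alpha_limit v x \<noteq> {p})"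

lemma fwd_no_saddle: "(\<And>p. p \<in> Sd \<Longrightarrow> omega_limit v x \<noteq> {p}) \<Longrightarrow> y \<in> fwd x \<Longrightarrow> \<exists>t\<ge>0. y = v t x"
proof (rotate_tac, induction rule: ext_fwd.induct)
  case (sad x' p z)
  then obtain t where "x' = v t x" by auto
  then have "omega_limit v x = {p}" using sad.hyps by simp
  then show ?case using sad by blast
qed auto

text \<open>A chain can leave the orbit of x only through p, the omega limit of that orbit; from
  then on it continues inside \<open>fwd p\<close>.\<close>

lemma fwd_saddle:
  assumes "p \<in> Sd" "omega_limit v x = {p}" "y \<in> fwd x"
  shows "(\<exists>t\<ge>0. y = v t x) \<or> y \<in> fwd p"
  using assms(3)
proof (induction rule: ext_fwd.induct)
  case (sad x' q z)
  show ?case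
  proof (cases "x' \<in> fwd p")
    case True
    then show ?thesis using ext_fwd.sad sad.hyps by blast
  next
    case False
    then obtain t where "x' = v t x" using sad.IH by auto
    then have "q = p" using sad.hyps assms by simp
    then show ?thesis using ext_fwd.sad[OF fwd_self _ omega_Sd] sad.hyps by blast
  qed
qed auto

lemma generic_reverse: "saddle_flow.generic rv Sd x \<longleftrightarrow> generic x"
  unfolding saddle_flow.generic_def[OF saddle_flow_reverse] generic_def by (auto simp: omega_reverse alpha_reverse)

lemma ext_generic: "generic x \<Longrightarrow> E x = orbit v x"
proof (intro subset_antisym subsetI)
  fix y assume x: "generic x" and "y \<in> E x"
  then consider "y \<in> fwd x" | "y \<in> bwd x" by (auto simp: ext_def)
  then show "y \<in> orbit v x"
  proof cases
    case 1
    then show ?thesis using fwd_no_saddle[of x y] x by (auto simp: generic_def orbit_def)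
  next
    case 2
    then show ?thesis using saddle_flow.fwd_no_saddle[OF saddle_flow_reverse, of x y] x
      by (auto simp: generic_def orbit_def omega_reverse)
  qed
next
  fix y assume "y \<in> orbit v x"
  then show "y \<in> E x" using ext_invariant[OF ext_self] by (auto simp: orbit_def)
qed

lemma C_generic: "generic x \<Longrightarrow> C x = closure (orbit v x)"
  by (simp add: cl_ext_def ext_generic)

lemma C_generic_subset: "generic y \<Longrightarrow> y \<in> C x \<Longrightarrow> C y \<subseteq> C x"
  by (simp add: C_generic orbit_subset_C)

text \<open>Sets of orbits rather than of points, so that the separatrices of a saddle can be
  counted.\<close>

definition In :: "'a \<Rightarrow> 'a set set" where "In p = orbit v ` (stable_set v p - {p})"
definition Out :: "'a \<Rightarrow> 'a set set" where "Out p = orbit v ` (unstable_set v p - {p})"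

lemma orbit_fixed: "(\<And>t. v t p = p) \<Longrightarrow> orbit v p = {p}"
  by (auto simp: orbit_def)

lemma orbit_image: "orbit v ` orbit v z = {orbit v z}"
proof (intro subset_antisym subsetI)
  fix A assume "A \<in> orbit v ` orbit v z"
  then show "A \<in> {orbit v z}" using orbit_eqI by blast
qed (use orbit_self[of z] in blast)

lemma card_In:
  assumes "p \<in> Sd"
  shows "finite (In p)" "card (In p) = 2"
proof -
  obtain U \<psi> where "box_flow v p U \<psi>" by (rule obtain_box[OF assms])
  then interpret box_flow v p U \<psi> .
  have ne: "zs 1 \<noteq> p" "zs (-1) \<noteq> p" by (simp_all add: zs_ne_p)
  have "p \<notin> orbit v (zs a)" if "zs a \<noteq> p" for a
    using that orbit_eqI[of p "zs a"] orbit_fixed[of p] orbit_self[of "zs a"] by auto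
  then have "stable_set v p - {p} = orbit v (zs 1) \<union> orbit v (zs (-1))" using stable_set_eq ne by auto
  then have "In p = {orbit v (zs 1), orbit v (zs (-1))}"
    unfolding In_def by (simp only: image_Un orbit_image Un_insert_left Un_empty_left)
  then show "finite (In p)" "card (In p) = 2" using branches_distinct by simp_all
qed

lemma In_reverse: "saddle_flow.In rv p = Out p"
  unfolding saddle_flow.In_def[OF saddle_flow_reverse] Out_def
  by (simp add: orbit_reverse[abs_def] stable_set_def unstable_set_def omega_reverse)

lemma card_Out: "p \<in> Sd \<Longrightarrow> finite (Out p)" "p \<in> Sd \<Longrightarrow> card (Out p) = 2"
  using saddle_flow.card_In[OF saddle_flow_reverse, of p] by (simp_all add: In_reverse)

end

section \<open>Extended R-closed flows\<close>

locale saddle_R_closed = saddle_flow v Sd for v :: "real \<Rightarrow> 'a::t2_space \<Rightarrow> 'a" and Sd +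
  assumes R_closed: "closed {(x, y). y \<in> cl_ext v Sd x}"
begin

lemma saddle_R_closed_reverse: "saddle_R_closed rv Sd"
  by (intro saddle_R_closed.intro saddle_flow_reverse saddle_R_closed_axioms.intro) (simp add: cl_ext_reverse R_closed)

text \<open>For fixed x the points y with \<open>x \<in> C y\<close> form a closed set by
  R-closedness. As extended orbits are symmetric, this set contains \<open>E x\<close>, hence its
  closure.\<close>

lemma C_sym: "y \<in> C x \<Longrightarrow> x \<in> C y"
proof -
  assume y: "y \<in> C x"
  have "closed ((\<lambda>y. (y, x)) -` {(x, y). y \<in> C x})"
    by (intro closed_vimage R_closed continuous_intros)
  moreover have "E x \<subseteq> (\<lambda>y. (y, x)) -` {(x, y). y \<in> C x}" using ext_sym ext_subset_C by blast
  ultimately have "closure (E x) \<subseteq> (\<lambda>y. (y, x)) -` {(x, y). y \<in> C x}" by (intro closure_minimal)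
  then show "x \<in> C y" using y by (auto simp: cl_ext_def)
qed

text \<open>Excludes fixed points outside \<open>Sd\<close>. Such a point is its own class, so by
  \<open>C_sym\<close> it lies in no other class; hence all fixed points in the class of a proper
  point belong to \<open>Sd\<close>.\<close>

definition proper :: "'a \<Rightarrow> bool" where "proper x \<longleftrightarrow> \<not> ((\<forall>t. v t x = x) \<and> x \<notin> Sd)"

lemma proper_reverse: "saddle_R_closed.proper rv Sd x \<longleftrightarrow> proper x"
proof -
  have "(\<forall>t. v (- t) x = x) \<longleftrightarrow> (\<forall>t. v t x = x)" by (metis minus_minus)
  then show ?thesis unfolding saddle_R_closed.proper_def[OF saddle_R_closed_reverse] proper_def by simp
qed

lemma not_proper_C:
  assumes "\<not> proper f"
  shows "C f = {f}" "generic f"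
proof -
  have f: "\<And>t. v t f = f" "f \<notin> Sd" using assms by (auto simp: proper_def)
  show "generic f" using f omega_fixed[of f] alpha_fixed[of f] by (auto simp: generic_def)
  then show "C f = {f}" by (simp add: C_generic orbit_fixed f)
qed

lemma proper_C: "proper x \<Longrightarrow> y \<in> C x \<Longrightarrow> proper y"
  using not_proper_C C_sym by (metis singletonD)

lemma nongeneric_proper: "\<not> generic x \<Longrightarrow> proper x"
  using not_proper_C by blast

lemma fixed_in_Sd: "proper x \<Longrightarrow> (\<And>t. v t x = x) \<Longrightarrow> x \<in> Sd"
  by (auto simp: proper_def)

text \<open>An accumulation point of saddles in the compact class is a fixed point, hence itself a
  saddle, but a saddle is the only fixed point in its square.\<close>

lemma finite_saddles:
  assumes "proper x"
  shows "finite (C x \<inter> Sd)"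
proof (rule ccontr)
  assume inf: "infinite (C x \<inter> Sd)"
  have "compact (C x)" by (rule closed_imp_compact[OF closed_C])
  then obtain y where y: "y \<in> C x" "y islimpt (C x \<inter> Sd)"
    using Heine_Borel_imp_Bolzano_Weierstrass[of "C x" "C x \<inter> Sd"] inf by blast
  have "v t y = y" for t
  proof -
    have "closed {z. v t z = z}" by (intro closed_Collect_eq continuous_intros)
    moreover have "C x \<inter> Sd \<subseteq> {z. v t z = z}" using Sd_fixed by auto
    ultimately have "y \<in> {z. v t z = z}"
      using y(2) islimpt_subset closed_limpt by blast
    then show ?thesis by simp
  qed
  then have "y \<in> Sd" using proper_C[OF assms y(1)] by (intro fixed_in_Sd)
  then obtain U \<psi> where "box_flow v y U \<psi>" by (rule obtain_box)
  then interpret box_flow v y U \<psi> .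
  let ?W = "{z \<in> U. \<psi> z \<in> {-1<..<1} \<times> {-1<..<1}}"
  have W: "open ?W" "y \<in> ?W" using p_interior p_U by simp_all
  obtain z where z: "z \<in> C x \<inter> Sd" "z \<in> ?W" "z \<noteq> y" by (rule islimptE[OF y(2) W(2,1)])
  have "z \<in> B" using z(2) by (auto simp: B_iff mem_Times_iff)
  then have "z = y" using Sd_fixed[of z] z(1) by (intro full_orbit_in_B) simp
  then show False using z(3) by simp
qed

lemma nongeneric_cases:
  assumes "\<not> generic z"
  obtains p where "p \<in> Sd" "z \<in> stable_set v p" | p where "p \<in> Sd" "z \<in> unstable_set v p"
  using assms by (auto simp: generic_def stable_set_def unstable_set_def)

text \<open>Such an orbit is a saddle of the class or one of the at most four separatrices of such a
  saddle.\<close>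

lemma finite_nongeneric_orbits:
  assumes "proper x"
  shows "finite (orbit v ` {z \<in> C x. \<not> generic z})"
proof (rule finite_subset)
  let ?S = "\<Union>p\<in>C x \<inter> Sd. insert {p} (In p \<union> Out p)"
  show "finite ?S" using card_In(1) card_Out(1) by (intro finite_UN_I finite_saddles[OF assms]) auto
  show "orbit v ` {z \<in> C x. \<not> generic z} \<subseteq> ?S"
  proof (intro image_subsetI, elim CollectE conjE)
    fix z assume z: "z \<in> C x" "\<not> generic z"
    from z(2) show "orbit v z \<in> ?S"
    proof (cases rule: nongeneric_cases)
      case (1 p)
      then have "p \<in> C x" using omega_subset_C[OF z(1)] by (simp add: stable_set_def)
      moreover have "orbit v z \<in> insert {p} (In p)"
        using 1 orbit_fixed[of p] Sd_fixed[of p] by (cases "z = p") (auto simp: In_def)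
      ultimately show ?thesis using 1 by blast
    next
      case (2 p)
      then have "p \<in> C x" using alpha_subset_C[OF z(1)] by (simp add: unstable_set_def)
      moreover have "orbit v z \<in> insert {p} (Out p)"
        using 2 orbit_fixed[of p] Sd_fixed[of p] by (cases "z = p") (auto simp: Out_def)
      ultimately show ?thesis using 2 by blast
    qed
  qed
qed

section \<open>Extended orbits all of whose orbits end in saddles\<close>

lemma saddle_chain_limits:
  assumes p: "p \<in> Sd" and x: "x \<in> fwd p"
  shows "\<exists>q\<in>fwd p \<inter> Sd. alpha_limit v x = {q}"
    and "q \<in> Sd \<Longrightarrow> omega_limit v x = {q} \<Longrightarrow> q \<in> fwd p"
    and "x \<in> Sd \<Longrightarrow> alpha_limit v z = {x} \<Longrightarrow> z \<in> fwd p"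
proof -
  show "q \<in> fwd p" if "q \<in> Sd" "omega_limit v x = {q}" for q
    by (rule ext_fwd.sad[OF x that alpha_Sd[OF that(1)]])
  show "z \<in> fwd p" if "x \<in> Sd" "alpha_limit v z = {x}" for z
    by (rule ext_fwd.sad[OF x that(1) omega_Sd[OF that(1)] that(2)])
  show "\<exists>q\<in>fwd p \<inter> Sd. alpha_limit v x = {q}"
    using x
  proof cases
    case (orb t)
    then show ?thesis using p Sd_fixed[OF p] alpha_Sd[OF p] fwd_self by auto
  next
    case (sad x' q)
    have "q \<in> fwd p" by (rule ext_fwd.sad[OF sad(1,2,3) alpha_Sd[OF sad(2)]])
    then show ?thesis using sad by auto
  qed
qed

text \<open>
  If no orbit leads out of the saddles reachable from \<open>p\<close>, then, each saddle having two incoming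
  and two outgoing orbits, none leads in from outside.
\<close>

lemma finite_type_backward:
  assumes p: "p \<in> Sd" and FT: "\<And>x. x \<in> fwd p \<Longrightarrow> \<exists>q\<in>Sd. omega_limit v x = {q}"
  shows "stable_set v p \<subseteq> fwd p" "y \<in> bwd x \<Longrightarrow> x \<in> fwd p \<Longrightarrow> y \<in> fwd p"
proof -
  define PS where "PS = fwd p \<inter> Sd"
  have PSD: "q \<in> fwd p" "q \<in> Sd" if "q \<in> PS" for q using that by (auto simp: PS_def)
  have sad: "z \<in> fwd p" if "q \<in> PS" "alpha_limit v z = {q}" for q z
    using saddle_chain_limits(3)[OF p PSD(1)[OF that(1)] PSD(2)[OF that(1)] that(2)] .
  have om: "\<exists>q\<in>PS. omega_limit v x = {q}" if x: "x \<in> fwd p" for x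
    using FT[OF x] saddle_chain_limits(2)[OF p x] by (auto simp: PS_def)
  have al: "\<exists>q\<in>PS. alpha_limit v x = {q}" if x: "x \<in> fwd p" for x
    using saddle_chain_limits(1)[OF p x] by (simp add: PS_def)
  have "PS \<subseteq> C p \<inter> Sd" using ext_subset_C by (auto simp: PS_def ext_def)
  moreover have "proper p" using p by (simp add: proper_def)
  ultimately have fin: "finite PS" using finite_saddles finite_subset by blast
  let ?I = "\<Union>q\<in>PS. In q" and ?O = "\<Union>q\<in>PS. Out q"
  have card_I: "card ?I = (\<Sum>q\<in>PS. card (In q))"
  proof (rule card_UN_disjoint[OF fin])
    show "\<forall>q\<in>PS. \<forall>q'\<in>PS. q \<noteq> q' \<longrightarrow> In q \<inter> In q' = {}"
    proof (intro ballI impI equals0I)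
      fix q q' A assume "q \<noteq> q'" "A \<in> In q \<inter> In q'"
      then obtain z z' where "z \<in> stable_set v q" "z' \<in> stable_set v q'" "orbit v z = orbit v z'" by (auto simp: In_def)
      then have "{q} = {q'}" using limits_same_orbit(1)[of z z'] by (simp add: stable_set_def)
      then show False using \<open>q \<noteq> q'\<close> by simp
    qed
  qed (use card_In(1) PSD(2) in simp)
  have card_O: "card ?O = (\<Sum>q\<in>PS. card (Out q))"
  proof (rule card_UN_disjoint[OF fin])
    show "\<forall>q\<in>PS. \<forall>q'\<in>PS. q \<noteq> q' \<longrightarrow> Out q \<inter> Out q' = {}"
    proof (intro ballI impI equals0I)
      fix q q' A assume "q \<noteq> q'" "A \<in> Out q \<inter> Out q'"
      then obtain z z' where "z \<in> unstable_set v q" "z' \<in> unstable_set v q'" "orbit v z = orbit v z'" by (auto simp: Out_def)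
      then have "{q} = {q'}" using limits_same_orbit(2)[of z z'] by (simp add: unstable_set_def)
      then show False using \<open>q \<noteq> q'\<close> by simp
    qed
  qed (use card_Out(1) PSD(2) in simp)
  have "card ?I = card ?O" unfolding card_I card_O using card_In(2) card_Out(2) PSD(2) by simp
  moreover have "?O \<subseteq> ?I"
  proof
    fix A assume "A \<in> ?O"
    then obtain q x where q: "q \<in> PS" and x: "alpha_limit v x = {q}" "x \<noteq> q" "A = orbit v x"
      by (auto simp: Out_def unstable_set_def)
    obtain q' where q': "q' \<in> PS" "omega_limit v x = {q'}" using om[OF sad[OF q x(1)]] by auto
    have "x \<noteq> q'" using x(1,2) alpha_Sd[OF PSD(2)[OF q'(1)]] by auto
    then have "A \<in> In q'" using q'(2) x(3) by (auto simp: In_def stable_set_def)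
    then show "A \<in> ?I" using q'(1) by blast
  qed
  moreover have "finite ?I" using fin card_In PSD by auto
  ultimately have IO: "?I = ?O" by (metis card_subset_eq)
  have from_in: "z \<in> fwd p" if q: "q \<in> PS" and z: "omega_limit v z = {q}" for q z
  proof (cases "z = q")
    case False
    then have "orbit v z \<in> ?O" using q z unfolding IO[symmetric] by (auto simp: In_def stable_set_def)
    then obtain q' y where "q' \<in> PS" "alpha_limit v y = {q'}" "orbit v z = orbit v y"
      by (auto simp: Out_def unstable_set_def)
    then show ?thesis using sad[of q' z] limits_same_orbit(2) by metis
  qed (use PSD q in simp)
  show "stable_set v p \<subseteq> fwd p"
    using from_in[of p] fwd_self p by (auto simp: PS_def stable_set_def)
  show "y \<in> fwd p" if "y \<in> bwd x" "x \<in> fwd p"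
    using that
  proof (induction rule: ext_fwd.induct)
    case (orb t)
    then show ?case using al[OF orb(2)] sad by auto
  next
    case s: (sad x' q z)
    then have "x' \<in> fwd p" by simp
    from al[OF this] have "q \<in> PS" using s by (auto simp: omega_reverse)
    then show ?case using from_in s by (simp add: alpha_reverse)
  qed
qed

text \<open>The extended positive orbit is a finite union of orbits and contains their limit sets,
  so it is closed. By the counting argument it also absorbs everything leading backward, so it
  contains the class of each of its points.\<close>

lemma finite_type_forward:
  assumes p: "p \<in> Sd" and FT: "\<And>x. x \<in> fwd p \<Longrightarrow> \<exists>q\<in>Sd. omega_limit v x = {q}"
  shows "stable_set v p \<union> unstable_set v p \<subseteq> fwd p" "\<And>x. x \<in> fwd p \<Longrightarrow> C x = fwd p"
    "\<And>x. x \<in> fwd p \<Longrightarrow> \<not> generic x"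
proof -
  define PS where "PS = fwd p \<inter> Sd"
  have PSD: "q \<in> fwd p" "q \<in> Sd" if "q \<in> PS" for q using that by (auto simp: PS_def)
  have sad: "z \<in> fwd p" if "q \<in> PS" "alpha_limit v z = {q}" for q z
    using saddle_chain_limits(3)[OF p PSD(1)[OF that(1)] PSD(2)[OF that(1)] that(2)] .
  have om: "\<exists>q\<in>PS. omega_limit v x = {q}" if x: "x \<in> fwd p" for x
    using FT[OF x] saddle_chain_limits(2)[OF p x] by (auto simp: PS_def)
  have al: "\<exists>q\<in>PS. alpha_limit v x = {q}" if x: "x \<in> fwd p" for x
    using saddle_chain_limits(1)[OF p x] by (simp add: PS_def)
  show stab: "stable_set v p \<union> unstable_set v p \<subseteq> fwd p"
    using finite_type_backward(1)[OF p FT] sad[of p] fwd_self p by (auto simp: PS_def unstable_set_def)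
  show ng: "\<not> generic x" if "x \<in> fwd p" for x using FT[OF that] by (auto simp: generic_def)
  have orb: "orbit v x \<subseteq> fwd p" if "x \<in> fwd p" for x
  proof -
    obtain q where "q \<in> PS" "alpha_limit v x = {q}" using al[OF \<open>x \<in> fwd p\<close>] by auto
    then show ?thesis using sad by (auto simp: orbit_def)
  qed
  have lim: "omega_limit v x \<subseteq> fwd p" "alpha_limit v x \<subseteq> fwd p" if "x \<in> fwd p" for x
    using om[OF that] al[OF that] PSD by auto
  have clo: "closed (fwd p)"
  proof -
    have "fwd p \<subseteq> {z \<in> C p. \<not> generic z}" using ng ext_subset_C by (auto simp: ext_def)
    then have "finite (orbit v ` fwd p)"
      using finite_nongeneric_orbits[of p] p finite_subset[OF image_mono] by (simp add: proper_def)
    then obtain F where F: "finite F" "F \<subseteq> fwd p" "orbit v ` fwd p = orbit v ` F"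
      by (metis finite_subset_image subset_refl)
    have "fwd p = (\<Union>x\<in>F. orbit v x \<union> omega_limit v x \<union> alpha_limit v x)"
    proof (intro subset_antisym subsetI)
      fix y assume "y \<in> fwd p"
      then have "orbit v y \<in> orbit v ` F" using F(3) by blast
      then show "y \<in> (\<Union>x\<in>F. orbit v x \<union> omega_limit v x \<union> alpha_limit v x)" using orbit_self[of y] by auto
    next
      fix y assume "y \<in> (\<Union>x\<in>F. orbit v x \<union> omega_limit v x \<union> alpha_limit v x)"
      then show "y \<in> fwd p"
        using F(2) orb lim by blast
    qed
    moreover have "closed (\<Union>x\<in>F. orbit v x \<union> omega_limit v x \<union> alpha_limit v x)"
      using F(1) closed_limits_orbit by (intro closed_UN) auto
    ultimately show ?thesis by simp
  qed
  show "C x = fwd p" if x: "x \<in> fwd p" for x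
  proof -
    have "E x \<subseteq> fwd p" using finite_type_backward(2)[OF p FT _ x] fwd_trans[OF _ x] by (auto simp: ext_def)
    then have "C x \<subseteq> fwd p" unfolding cl_ext_def using clo by (rule closure_minimal)
    moreover have "p \<in> fwd x"
    proof -
      obtain q where q: "q \<in> PS" "omega_limit v x = {q}" using om[OF x] by auto
      have "q \<in> fwd x" by (rule ext_fwd.sad[OF fwd_self _ q(2) alpha_Sd]) (use PSD[OF q(1)] in auto)
      \<comment> \<open>The set \<open>fwd q\<close> is again of this kind, so going back from q to
        p does not leave it.\<close>
      moreover have "p \<in> fwd q"
      proof (rule finite_type_backward(2)[of q _ q])
        show "\<exists>q'\<in>Sd. omega_limit v y = {q'}" if "y \<in> fwd q" for y
          by (rule FT[OF fwd_trans[OF that PSD(1)[OF q(1)]]])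
        show "p \<in> bwd q" using PSD(1)[OF q(1)] by (simp add: bwd_iff)
      qed (use PSD[OF q(1)] fwd_self in auto)
      ultimately show ?thesis by (rule fwd_trans[rotated])
    qed
    then have "fwd p \<subseteq> C x" using fwd_trans ext_subset_C[of x] by (auto simp: ext_def)
    ultimately show ?thesis by blast
  qed
qed

end

section \<open>Recurrent and nonrecurrent orbits\<close>

lemma Hausdorff_euclidean: "Hausdorff_space (euclidean :: 'a::t2_space topology)"
  unfolding Hausdorff_space_def disjnt_def using hausdorff by auto

context compact_flow begin

text \<open>A Baire argument: countably many orbits are covered by countably many compact arcs, one
  of which contains a nonempty relatively open part of the limit set. The orbit of e returns to this
  part at times too far apart for one arc, unless it closes up.\<close>

lemma recurrent_countably_many_orbits:
  assumes e: "e \<in> omega_limit v e" and count: "countable (orbit v ` omega_limit v e)"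
  shows "\<exists>T>0. v T e = e"
proof -
  let ?X = "omega_limit v e"
  let ?T = "top_of_set ?X"
  have "compact_space ?T" using closed_imp_compact[OF closed_omega] by (simp add: compact_space_subtopology)
  moreover have "Hausdorff_space ?T" by (rule Hausdorff_space_subtopology[OF Hausdorff_euclidean])
  ultimately have lc: "locally_compact_space ?T \<and> regular_space ?T"
    using compact_imp_locally_compact_space compact_Hausdorff_imp_regular_space by blast
  obtain F where F: "F \<subseteq> ?X" "countable F" "orbit v ` ?X = orbit v ` F"
    using count by (metis countable_subset_image subset_refl)
  define \<G> where "\<G> = (\<lambda>(f, k). (\<lambda>t. v t f) ` {- real k..real k}) ` (F \<times> (UNIV :: nat set))"
  have "countable \<G>" unfolding \<G>_def using F(2) by auto
  have sub: "\<Union>\<G> = ?X"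
  proof (intro subset_antisym subsetI)
    fix y assume "y \<in> \<Union>\<G>"
    then show "y \<in> ?X" using F(1) omega_invariant by (auto simp: \<G>_def)
  next
    fix y assume "y \<in> ?X"
    then obtain f where f: "f \<in> F" "orbit v y = orbit v f" using F(3) by blast
    then obtain t where t: "y = v t f" using orbit_self[of y] by (auto simp: orbit_def)
    obtain k :: nat where "\<bar>t\<bar> \<le> real k" using real_arch_simple by blast
    then have "t \<in> {- real k..real k}" by auto
    then show "y \<in> \<Union>\<G>" unfolding \<G>_def using f(1) t by blast
  qed
  have "\<exists>A\<in>\<G>. ?T interior_of A \<noteq> {}"
  proof (rule ccontr)
    assume none: "\<not> ?thesis"
    have "?T interior_of \<Union>\<G> = {}"
    proof (rule Baire_category_alt[OF disjI2[OF lc] \<open>countable \<G>\<close>])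
      fix A assume A: "A \<in> \<G>"
      then have "compact A" unfolding \<G>_def by (auto intro!: compact_continuous_image continuous_intros)
      then have "closed A" by (rule compact_imp_closed)
      moreover have "A \<subseteq> ?X" using A sub by blast
      ultimately show "closedin ?T A \<and> ?T interior_of A = {}" using none A by (auto intro: closed_subset)
    qed
    moreover have "?T interior_of ?X = ?X" using interior_of_topspace[of ?T] by simp
    ultimately show False using e sub by simp
  qed
  then obtain f k y where y: "y \<in> ?T interior_of ((\<lambda>t. v t f) ` {- real k..real k})" by (auto simp: \<G>_def)
  then obtain W where W: "open W" "y \<in> W" "y \<in> ?X" "?X \<inter> W \<subseteq> (\<lambda>t. v t f) ` {- real k..real k}"
    unfolding interior_of_def openin_open by blast
  have inX: "v t e \<in> ?X" for t by (rule omega_invariant[OF e])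
  obtain t1 where t1: "t1 > 0" "v t1 e \<in> W" using W(1,2,3) unfolding omega_iff by blast
  \<comment> \<open>The arc has parameters in an interval of length 2 k, so a larger gap between the
    two returns makes the resulting period positive.\<close>
  obtain t2 where t2: "t2 > t1 + 2 * real k" "v t2 e \<in> W" using W(1,2,3) unfolding omega_iff by blast
  obtain s1 where s1: "v t1 e = v s1 f" "s1 \<in> {- real k..real k}" using W(4) t1(2) inX[of t1] by blast
  obtain s2 where s2: "v t2 e = v s2 f" "s2 \<in> {- real k..real k}" using W(4) t2(2) inX[of t2] by blast
  have "v (- s1) (v t1 e) = f" "v (- s2) (v t2 e) = f" by (simp_all only: s1(1) s2(1) v_minus)
  then have "v (t2 - s2) e = v (t1 - s1) e" by (simp add: v_add)
  then have "v (- (t1 - s1)) (v (t2 - s2) e) = e" by (simp only: v_minus)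
  then have "v ((t2 - s2) - (t1 - s1)) e = e" by (simp add: v_add algebra_simps)
  moreover have "(t2 - s2) - (t1 - s1) > 0" using t2(1) s1(2) s2(2) by auto
  ultimately show ?thesis by blast
qed

lemma periodic_multiple: "v T e = e \<Longrightarrow> v (real n * T) e = e"
proof (induction n)
  case (Suc n)
  have "v (real (Suc n) * T) e = v T (v (real n * T) e)" by (simp add: v_add algebra_simps)
  then show ?case using Suc by simp
qed simp

lemma periodic_recurrent:
  assumes "v T e = e" "T > 0"
  shows "e \<in> omega_limit v e" "e \<in> alpha_limit v e"
proof -
  have ex: "\<exists>t>n. v t e = e \<and> v (- t) e = e" for n
  proof -
    obtain k :: nat where "real k * T > n" using ex_less_of_nat_mult[OF assms(2)] by blast
    moreover have "v (real k * T) e = e" by (rule periodic_multiple[OF assms(1)])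
    moreover from this have "v (- (real k * T)) e = e" by (metis v_minus(1))
    ultimately show ?thesis by blast
  qed
  show "e \<in> omega_limit v e" unfolding omega_iff using ex by metis
  show "e \<in> alpha_limit v e"
    unfolding omega_reverse[symmetric] compact_flow.omega_iff[OF compact_flow_reverse] using ex by metis
qed

lemma not_omega:
  assumes "y \<notin> omega_limit v x"
  shows "\<exists>W n. open W \<and> y \<in> W \<and> (\<forall>t>n. v t x \<notin> W)"
  using assms unfolding omega_iff by blast

text \<open>At all large times the orbit avoids a neighbourhood of e. The bounded times of absolute
  value at least \<open>\<epsilon>\<close> give a compact set, which misses e because e is not
  periodic.\<close>

lemma nonrecurrent_isolated_time:
  assumes "e \<notin> omega_limit v e" "e \<notin> alpha_limit v e" "\<epsilon> > 0"
  obtains W where "open W" "e \<in> W" "\<And>t. v t e \<in> W \<Longrightarrow> \<bar>t\<bar> < \<epsilon>"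
proof -
  obtain W1 n where W1: "open W1" "e \<in> W1" "\<forall>t>n. v t e \<notin> W1"
    using not_omega[OF assms(1)] by (elim exE conjE)
  obtain W2 m where W2: "open W2" "e \<in> W2" "\<forall>t>m. v (- t) e \<notin> W2"
    using compact_flow.not_omega[OF compact_flow_reverse, of e e] assms(2) unfolding omega_reverse by (elim meta_impE exE conjE)
  let ?K = "(\<lambda>t. v t e) ` ({-m..-\<epsilon>} \<union> {\<epsilon>..n})"
  have "closed ?K" by (intro compact_imp_closed compact_continuous_image continuous_intros compact_Un) auto
  have np: "v t e \<noteq> e" if "t \<noteq> 0" for t
  proof
    assume "v t e = e"
    moreover from this have "v (- t) e = e" by (metis v_minus(1))
    ultimately have "v \<bar>t\<bar> e = e" by (simp add: abs_if)
    then show False using periodic_recurrent(1)[of "\<bar>t\<bar>" e] that assms(1) by simp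
  qed
  have "e \<notin> ?K"
  proof
    assume "e \<in> ?K"
    then obtain t where t: "e = v t e" "t \<in> {-m..-\<epsilon>} \<union> {\<epsilon>..n}" by (rule imageE)
    have "t \<noteq> 0" using t(2) assms(3) by auto
    then show False using np t(1) by metis
  qed
  show thesis
  proof (rule that[of "W1 \<inter> W2 \<inter> - ?K"])
    show "open (W1 \<inter> W2 \<inter> - ?K)" using W1(1) W2(1) \<open>closed ?K\<close> by (intro open_Int open_Compl)
    show "e \<in> W1 \<inter> W2 \<inter> - ?K" using W1(2) W2(2) \<open>e \<notin> ?K\<close> by simp
    fix t assume t: "v t e \<in> W1 \<inter> W2 \<inter> - ?K"
    have "t \<le> n" using W1(3)[rule_format, of t] t by force
    moreover have "- t \<le> m" using W2(3)[rule_format, of "- t"] t by force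
    moreover have "t \<notin> {-m..-\<epsilon>} \<union> {\<epsilon>..n}" using t by blast
    ultimately show "\<bar>t\<bar> < \<epsilon>" by auto
  qed
qed

lemma omega_subset_if_eventually_near:
  assumes "closed \<Lambda>" "\<And>N. open N \<Longrightarrow> \<Lambda> \<subseteq> N \<Longrightarrow> \<exists>T. \<forall>t\<ge>T. v t z \<in> N"
  shows "omega_limit v z \<subseteq> \<Lambda>"
proof (rule subsetI, rule ccontr)
  fix y assume y: "y \<in> omega_limit v z" "y \<notin> \<Lambda>"
  obtain N W where NW: "open N" "open W" "\<Lambda> \<subseteq> N" "y \<in> W" "N \<inter> W = {}"
    using Hausdorff_space_compact_separation[OF Hausdorff_euclidean, of \<Lambda> "{y}"] closed_imp_compact[OF assms(1)] y(2)
    by (auto simp: disjnt_def)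
  obtain T where T: "\<forall>t\<ge>T. v t z \<in> N" using assms(2)[OF NW(1,3)] by blast
  obtain t where "t > T" "v t z \<in> W" using y(1) NW(2,4) unfolding omega_iff by blast
  then have "v t z \<in> N \<inter> W" using T by simp
  then show False using NW(5) by simp
qed

end

text \<open>Recurrence among finitely many orbits makes e periodic, hence a point of its own alpha
  limit. But the omega limit of the nongeneric point e is not a saddle, so its alpha limit is one,
  and e would be that saddle.\<close>

lemma (in saddle_R_closed) nongeneric_recurrent_false:
  assumes u: "proper u" and e: "e \<in> omega_limit v e" and sub: "omega_limit v e \<subseteq> C u"
    and ng: "\<And>y. y \<in> omega_limit v e \<Longrightarrow> \<not> generic y" and ns: "\<not> (\<exists>p\<in>Sd. omega_limit v e = {p})"
  shows False
proof -
  have "orbit v ` omega_limit v e \<subseteq> orbit v ` {z \<in> C u. \<not> generic z}" using sub ng by blast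
  then have "finite (orbit v ` omega_limit v e)" using finite_nongeneric_orbits[OF u] by (rule finite_subset)
  then obtain T where T: "T > 0" "v T e = e"
    using recurrent_countably_many_orbits[OF e] countable_finite by blast
  obtain p where p: "p \<in> Sd" "alpha_limit v e = {p}" using ng[OF e] ns by (auto simp: generic_def)
  have "e = p" using periodic_recurrent(2)[OF T(2,1)] p(2) by simp
  then show False using ns omega_Sd[OF p(1)] p(1) by auto
qed

lemma (in compact_flow) omegaD:
  "y \<in> omega_limit v x \<Longrightarrow> open W \<Longrightarrow> y \<in> W \<Longrightarrow> \<exists>t>n. v t x \<in> W"
  unfolding omega_iff by simp

section \<open>Orbits accumulating on a saddle\<close>

context box_flow begin

interpretation rev: box_flow "\<lambda>t. v (- t)" p U "prod.swap \<circ> \<psi>"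
  by (rule box_flow_reverse)

definition visits :: "'a \<Rightarrow> real \<Rightarrow> real \<Rightarrow> bool" where
  "visits x a b \<longleftrightarrow> \<bar>a\<bar> = 1 \<and> \<bar>b\<bar> = 1 \<and>
     (\<forall>\<epsilon>>0. \<forall>K. \<exists>t \<tau>. 0 < t \<and> t < \<epsilon> \<and> \<tau> > K \<and> v \<tau> x = sec a b t)"

lemma visitsD:
  assumes "visits x a b" "\<epsilon> > 0"
  obtains t \<tau> where "0 < t" "t < \<epsilon>" "\<tau> > K" "v \<tau> x = sec a b t"
proof -
  have "\<exists>t \<tau>. 0 < t \<and> t < \<epsilon> \<and> \<tau> > K \<and> v \<tau> x = sec a b t"
    using assms unfolding visits_def by simp
  then show thesis by (elim exE conjE) (rule that)
qed

text \<open>Deep entrances accumulate on the entry point of the stable branch, and by continuity of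
  the corner map at 0 the corresponding exits accumulate on the exit point of the unstable
  branch.\<close>

lemma visits_limits:
  assumes V: "visits x a b"
  shows "zs a \<in> omega_limit v x" "p \<in> omega_limit v x" "rev.zs b \<in> omega_limit v x"
proof -
  have a: "\<bar>a\<bar> = 1" and b: "\<bar>b\<bar> = 1" using V by (simp_all add: visits_def)
  show z: "zs a \<in> omega_limit v x"
    unfolding omega_iff
  proof (intro allI impI)
    fix W n assume W: "open W \<and> zs a \<in> W"
    obtain \<epsilon> where \<epsilon>: "\<epsilon> > 0" "\<And>t. 0 \<le> t \<Longrightarrow> t < \<epsilon> \<Longrightarrow> sec a b t \<in> W"
      by (rule sec_near[OF a b conjunct1[OF W] conjunct2[OF W]]) (rule that)
    obtain t \<tau> where "0 < t" "t < \<epsilon>" "\<tau> > n" "v \<tau> x = sec a b t" by (rule visitsD[OF V \<epsilon>(1)])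
    then show "\<exists>t>n. v t x \<in> W" using \<epsilon>(2)[of t] by (intro exI[of _ \<tau>]) simp
  qed
  have "omega_limit v (zs a) = {p}" using a by (intro stay_omega zs_stay) simp
  then show "p \<in> omega_limit v x" using omega_of_omega[OF z] by simp
  show "rev.zs b \<in> omega_limit v x"
    unfolding omega_iff
  proof (intro allI impI)
    fix W n assume W: "open W \<and> rev.zs b \<in> W"
    obtain \<epsilon> where \<epsilon>: "\<epsilon> > 0" "\<And>t. 0 \<le> t \<Longrightarrow> t < \<epsilon> \<Longrightarrow> rev.sec b a t \<in> W"
      by (rule rev.sec_near[OF b a conjunct1[OF W] conjunct2[OF W]]) (rule that)
    obtain \<delta> D where D: "0 < \<delta>" "\<delta> < depth a" "continuous_on {0..\<delta>} D" "strict_mono_on {0..\<delta>} D" "D 0 = 0"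
      "\<And>t. 0 < t \<Longrightarrow> t \<le> \<delta> \<Longrightarrow> \<exists>T. corner a b t (D t) T"
      by (rule corner_map[OF a b]) (rule that)
    obtain \<eta> where \<eta>: "0 < \<eta>" "\<eta> \<le> \<delta>" "\<And>t. 0 < t \<Longrightarrow> t \<le> \<eta> \<Longrightarrow> 0 < D t \<and> D t < \<epsilon>"
      by (rule strict_mono_germ_near_zero[OF D(3,4,5,1) \<epsilon>(1)]) (rule that)
    obtain t \<tau> where t: "0 < t" "t < \<eta>" "\<tau> > n" "v \<tau> x = sec a b t" by (rule visitsD[OF V \<eta>(1)])
    have "t \<le> \<delta>" using t(2) \<eta>(2) by simp
    then obtain T where T: "corner a b t (D t) T" using D(6)[OF t(1)] by blast
    have "v (T + \<tau>) x = rev.sec b a (D t)" using T t(4) by (simp add: corner_def flip: v_add)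
    moreover have "rev.sec b a (D t) \<in> W" using \<eta>(3)[of t] t by (intro \<epsilon>(2)) auto
    moreover have "T + \<tau> > n" using T t(3) by (simp add: corner_def)
    ultimately show "\<exists>t>n. v t x \<in> W" by metis
  qed
qed

text \<open>Entrances at distance at least \<open>\<epsilon>\<close> from the stable branch form a
  compact set disjoint from \<open>stay\<close>, so they leave the square within a common time K0.
  What they reach until then is compact and misses the fixed point p; N is its complement.\<close>

lemma deep_entrance:
  assumes "\<epsilon> > 0"
  obtains N where "open N" "p \<in> N"
    "\<And>w T. w \<in> B \<Longrightarrow> \<bar>X w\<bar> = 1 \<Longrightarrow> 0 \<le> T \<Longrightarrow> \<forall>s\<in>{0..T}. v s w \<in> B \<Longrightarrow> v T w \<in> N \<Longrightarrow> \<bar>Y w - g (X w)\<bar> < \<epsilon>"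
proof -
  define A where "A = {w \<in> B. \<bar>X w\<bar> = 1} \<inter> {w \<in> B. \<epsilon> \<le> \<bar>Y w - g (X w)\<bar>}"
  have sub: "B \<subseteq> U" by (auto simp: B_iff)
  have cX: "continuous_on B X" using continuous_X[OF continuous_on_id, of B] sub by simp
  have cY: "continuous_on B Y" using continuous_Y[OF continuous_on_id, of B] sub by simp
  have cg: "continuous_on B (\<lambda>w. g (X w))"
    by (rule continuous_on_compose2[OF continuous_on_g cX]) (auto simp: B_iff abs_le_iff)
  have "closed {w \<in> B. \<bar>X w\<bar> = 1}"
    by (rule continuous_closed_preimage_constant[OF continuous_on_rabs[OF cX] closed_B])
  moreover have "closed {w \<in> B. \<epsilon> \<le> \<bar>Y w - g (X w)\<bar>}"
    by (rule continuous_on_closed_Collect_le[OF continuous_on_const continuous_on_rabs[OF continuous_on_diff[OF cY cg]] closed_B])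
  ultimately have "closed A" unfolding A_def by (rule closed_Int)
  then have "compact A" by (rule closed_imp_compact)
  let ?O = "\<lambda>K :: real. \<Union>r\<in>{0..K}. v r -` (- B)"
  have op: "open (?O K)" for K
    using closed_B by (intro open_UN ballI open_vimage continuous_intros) auto
  have cover: "A \<subseteq> (\<Union>K\<in>UNIV. ?O K)"
  proof
    fix w assume w: "w \<in> A"
    then have "w \<notin> stay" using stay_iff[of w] assms by (auto simp: A_def)
    then obtain r where "r \<ge> 0" "v r w \<notin> B" by (auto simp: stay_def)
    then show "w \<in> (\<Union>K\<in>UNIV. ?O K)" by (intro UN_I[of r] UN_I[of r]) auto
  qed
  obtain I where I: "I \<subseteq> UNIV" "finite I" "A \<subseteq> (\<Union>K\<in>I. ?O K)"
    by (rule compactE_image[OF \<open>compact A\<close> op cover])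
  define K0 where "K0 = Max (insert 0 I)"
  have K0: "\<exists>r\<in>{0..K0}. v r w \<notin> B" if w: "w \<in> A" for w
  proof -
    have "w \<in> (\<Union>K\<in>I. ?O K)" using I(3) w by blast
    then obtain k r where k: "k \<in> I" "r \<in> {0..k}" "v r w \<notin> B" by auto
    moreover have "k \<le> K0" using I(2) k(1) by (simp add: K0_def)
    ultimately show ?thesis by (intro bexI[of _ r]) auto
  qed
  define M where "M = (\<lambda>q. v (fst q) (snd q)) ` ({0..K0} \<times> A)"
  have "compact M"
    unfolding M_def by (intro compact_continuous_image continuous_intros compact_Times compact_Icc \<open>compact A\<close>)
  then have "closed M" by (rule compact_imp_closed)
  have "p \<notin> M"
  proof
    assume "p \<in> M"
    then obtain s w where "w \<in> A" "v s w = p" by (auto simp: M_def)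
    then have "w = p" by (metis p_fixed v_inj)
    then show False using \<open>w \<in> A\<close> by (simp add: A_def)
  qed
  show thesis
  proof (rule that[of "- M"])
    show "open (- M)" "p \<in> - M" using \<open>closed M\<close> \<open>p \<notin> M\<close> by auto
    fix w T assume w: "w \<in> B" "\<bar>X w\<bar> = 1" and T: "0 \<le> T" "\<forall>s\<in>{0..T}. v s w \<in> B" "v T w \<in> - M"
    show "\<bar>Y w - g (X w)\<bar> < \<epsilon>"
    proof (rule ccontr)
      assume "\<not> ?thesis"
      then have "w \<in> A" using w by (simp add: A_def)
      then obtain r where r: "r \<in> {0..K0}" "v r w \<notin> B" using K0 by blast
      have "\<not> r \<le> T" using T(2) r by auto
      then have "(T, w) \<in> {0..K0} \<times> A" using r(1) T(1) \<open>w \<in> A\<close> by simp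
      then have "v T w \<in> M" unfolding M_def by (intro image_eqI[of _ _ "(T, w)"]) auto
      then show False using T(3) by simp
    qed
  qed
qed

text \<open>The orbit is outside the square at arbitrarily late times and later comes near p; the
  entrance in between is then close to the stable branch. As there are only four pairs of signs, one
  of them serves all depths and all times.\<close>

lemma visits_exist:
  assumes p: "p \<in> omega_limit v x" and ne: "omega_limit v x \<noteq> {p}"
  shows "\<exists>a b. visits x a b"
proof -
  have hit: "\<exists>a b t \<tau>. \<bar>a\<bar> = 1 \<and> \<bar>b\<bar> = 1 \<and> 0 < t \<and> t < \<epsilon> \<and> \<tau> > K \<and> v \<tau> x = sec a b t" if "\<epsilon> > 0" for \<epsilon> K
  proof -
    obtain N where N: "open N" "p \<in> N"
      "\<And>w T. w \<in> B \<Longrightarrow> \<bar>X w\<bar> = 1 \<Longrightarrow> 0 \<le> T \<Longrightarrow> \<forall>s\<in>{0..T}. v s w \<in> B \<Longrightarrow> v T w \<in> N \<Longrightarrow> \<bar>Y w - g (X w)\<bar> < \<epsilon>"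
      by (rule deep_entrance[OF \<open>\<epsilon> > 0\<close>]) (rule that)
    have "\<not> (\<forall>t>K. v t x \<in> B)"
    proof
      assume "\<forall>t>K. v t x \<in> B"
      then have "omega_limit v x = {p}" by (intro omega_eq_p_if[of K]) simp
      then show False using ne by simp
    qed
    then obtain t1 where t1: "t1 > K" "v t1 x \<notin> B" by auto
    let ?W = "N \<inter> {z \<in> U. \<psi> z \<in> {-1<..<1} \<times> {-1<..<1}}"
    have "p \<in> ?W" using N(2) p_U by simp
    from omegaD[OF p open_Int[OF N(1) p_interior] this, of t1]
    obtain t2 where t2: "t2 > t1" "v t2 x \<in> ?W" by (elim exE conjE) (rule that)
    define z where "z = v t2 x"
    have z: "z \<in> B" "z \<in> N" using t2(2) by (auto simp: z_def B_iff mem_Times_iff)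
    have "v (- (t2 - t1)) z \<notin> B" using t1(2) by (simp add: z_def v_add)
    \<comment> \<open>In reversed time the first exit from the square is the last entrance before
      \<open>t2\<close>.\<close>
    obtain T where T: "0 \<le> T" "T < t2 - t1" "\<And>s. s \<in> {0..T} \<Longrightarrow> v (- s) z \<in> B" "\<bar>rev.Y (v (- T) z)\<bar> = 1"
    proof (rule rev.exit_time[of z "t2 - t1", unfolded square_swap])
      show "z \<in> B" "0 \<le> t2 - t1" "v (- (t2 - t1)) z \<notin> B" using z(1) t2(1) \<open>v (- (t2 - t1)) z \<notin> B\<close> by simp_all
    qed (rule that)
    define w where "w = v (- T) z"
    have w: "w \<in> B" "\<bar>X w\<bar> = 1" "v T w = z" "v (t2 - T) x = w" using T(1) T(3)[of T] T(4) by (simp_all add: w_def z_def v_add)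
    have arc: "\<forall>s\<in>{0..T}. v s w \<in> B"
    proof
      fix s assume "s \<in> {0..T}"
      then have "v (- (T - s)) z \<in> B" by (intro T(3)) auto
      then show "v s w \<in> B" by (simp add: w_def v_add)
    qed
    define d where "d = Y w - g (X w)"
    have d: "\<bar>d\<bar> < \<epsilon>" unfolding d_def using N(3)[OF w(1,2) T(1) arc] z(2) w(3) by simp
    have "d \<noteq> 0"
    proof
      assume "d = 0"
      then have "w \<in> stay" using stay_iff[OF w(1)] by (simp add: d_def)
      then have "omega_limit v w = {p}" by (rule stay_omega)
      then show False using ne w(4) by (metis omega_orbit)
    qed
    have "sec (X w) (sgn d) \<bar>d\<bar> = w"
      using w(1,2) by (intro sec_eqI) (auto simp: B_iff d_def sgn_mult_abs)
    then show ?thesis using w(2,4) d \<open>d \<noteq> 0\<close> T(2) t1(1)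
      by (intro exI[of _ "X w"] exI[of _ "sgn d"] exI[of _ "\<bar>d\<bar>"] exI[of _ "t2 - T"]) (auto simp: sgn_real_def)
  qed
  show ?thesis
  proof (rule ccontr)
    assume none: "\<not> ?thesis"
    let ?I = "{1, -1 :: real} \<times> {1, -1 :: real}"
    have "\<exists>\<epsilon>>0. \<exists>K. \<forall>t \<tau>. 0 < t \<and> t < \<epsilon> \<and> \<tau> > K \<longrightarrow> v \<tau> x \<noteq> sec (fst i) (snd i) t" if i: "i \<in> ?I" for i
    proof -
      have "\<not> visits x (fst i) (snd i)" using none by blast
      moreover have "\<bar>fst i\<bar> = 1" "\<bar>snd i\<bar> = 1" using i by auto
      ultimately show ?thesis unfolding visits_def by blast
    qed
    then obtain e K where eK: "\<And>i. i \<in> ?I \<Longrightarrow> e i > 0"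
      "\<And>i t \<tau>. i \<in> ?I \<Longrightarrow> 0 < t \<and> t < e i \<and> \<tau> > K i \<Longrightarrow> v \<tau> x \<noteq> sec (fst i) (snd i) t"
      by metis
    have "0 < Min (e ` ?I)" using eK(1) by (subst Min_gr_iff) auto
    from hit[OF this, of "Max (K ` ?I)"] obtain a b t \<tau> where h: "\<bar>a\<bar> = 1" "\<bar>b\<bar> = 1" "0 < t" "t < Min (e ` ?I)"
      "\<tau> > Max (K ` ?I)" "v \<tau> x = sec a b t" by (elim exE conjE)
    have i: "(a, b) \<in> ?I" using h(1,2) by auto
    have "t < e (a, b)" using h(4) Min_le[of "e ` ?I" "e (a, b)"] i by auto
    moreover have "\<tau> > K (a, b)" using h(5) Max_ge[of "K ` ?I" "K (a, b)"] i by auto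
    ultimately show False using eK(2)[OF i] h(3,6) by auto
  qed
qed

text \<open>The finitely many orbits are treated one by one. An orbit not containing
  \<open>zs a\<close> forms with its limit sets a closed set missing that point. The orbit of
  \<open>zs a\<close> itself is not recurrent, so it is near \<open>zs a\<close> only at short
  times, when transversality keeps it off the section.\<close>

lemma section_avoids:
  assumes a: "\<bar>a\<bar> = 1" and b: "\<bar>b\<bar> = 1" and fin: "finite (orbit v ` \<Lambda>)"
    and lim: "\<And>y. y \<in> \<Lambda> \<Longrightarrow> zs a \<notin> omega_limit v y \<union> alpha_limit v y"
  obtains \<delta> where "\<delta> > 0" "\<And>t. 0 < t \<Longrightarrow> t < \<delta> \<Longrightarrow> sec a b t \<notin> \<Lambda>"
proof -
  have "\<exists>\<delta>>0. \<forall>t. 0 < t \<and> t < \<delta> \<longrightarrow> sec a b t \<notin> A" if A: "A \<in> orbit v ` \<Lambda>" for A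
  proof -
    obtain f where f: "f \<in> \<Lambda>" "A = orbit v f" using A by blast
    show ?thesis
    proof (cases "zs a \<in> A")
      case False
      let ?S = "orbit v f \<union> omega_limit v f \<union> alpha_limit v f"
      have "zs a \<in> - ?S" using False f(2) lim[OF f(1)] by simp
      then obtain \<epsilon> where \<epsilon>: "\<epsilon> > 0" "\<And>t. 0 \<le> t \<Longrightarrow> t < \<epsilon> \<Longrightarrow> sec a b t \<in> - ?S"
        by (rule sec_near[OF a b open_Compl[OF closed_limits_orbit]]) (rule that)
      then show ?thesis using f(2) by (intro exI[of _ \<epsilon>]) auto
    next
      case True
      then have fa: "orbit v (zs a) = A" using orbit_eqI f(2) by simp
      then have nr: "zs a \<notin> omega_limit v (zs a)" "zs a \<notin> alpha_limit v (zs a)"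
        using lim[OF f(1)] limits_same_orbit[of "zs a" f] f(2) by simp_all
      define d where "d = depth a / 2"
      have d: "0 < d" "d < depth a" using depth(1)[OF a] by (simp_all add: d_def)
      obtain \<epsilon> where \<epsilon>: "\<epsilon> > 0"
        "\<And>t1 t2 s. t1 \<in> {0..d} \<Longrightarrow> t2 \<in> {0..d} \<Longrightarrow> \<bar>s\<bar> \<le> \<epsilon> \<Longrightarrow> v s (sec a b t1) = sec a b t2 \<Longrightarrow> s = 0"
        by (rule sec_transversal[OF a b d(2)]) (rule that)
      obtain W where W: "open W" "zs a \<in> W" "\<And>t. v t (zs a) \<in> W \<Longrightarrow> \<bar>t\<bar> < \<epsilon>"
        by (rule nonrecurrent_isolated_time[OF nr \<epsilon>(1)]) (rule that)
      obtain e where e: "e > 0" "\<And>t. 0 \<le> t \<Longrightarrow> t < e \<Longrightarrow> sec a b t \<in> W"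
        by (rule sec_near[OF a b W(1,2)]) (rule that)
      have "sec a b t \<notin> A" if t: "0 < t" "t < min d e" for t
      proof
        assume "sec a b t \<in> A"
        then obtain s where s: "sec a b t = v s (zs a)" unfolding fa[symmetric] orbit_def by blast
        have "\<bar>s\<bar> < \<epsilon>" using W(3)[of s] e(2)[of t] t s by simp
        then have "s = 0" using \<epsilon>(2)[of 0 t s] t s d(1) by (simp add: sec_0)
        then have "sec a b t = sec a b 0" using s by (simp add: sec_0)
        then have "t = 0" using inj_onD[OF inj_on_sec[OF a b d(2)]] t d(1) by auto
        then show False using t(1) by simp
      qed
      then show ?thesis using d(1) e(1) by (intro exI[of _ "min d e"]) simp
    qed
  qed
  then obtain \<delta> where \<delta>: "\<And>A. A \<in> orbit v ` \<Lambda> \<Longrightarrow> \<delta> A > 0"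
    "\<And>A t. A \<in> orbit v ` \<Lambda> \<Longrightarrow> 0 < t \<and> t < \<delta> A \<Longrightarrow> sec a b t \<notin> A" by metis
  show thesis
  proof (rule that[of "Min (insert 1 (\<delta> ` orbit v ` \<Lambda>))"])
    show "0 < Min (insert 1 (\<delta> ` orbit v ` \<Lambda>))" using fin \<delta>(1) by (subst Min_gr_iff) auto
    fix t assume t: "0 < t" "t < Min (insert 1 (\<delta> ` orbit v ` \<Lambda>))"
    show "sec a b t \<notin> \<Lambda>"
    proof
      assume s: "sec a b t \<in> \<Lambda>"
      then have "t < \<delta> (orbit v (sec a b t))" using t(2) fin by (subst (asm) Min_gr_iff) auto
      then show False using \<delta>(2)[of "orbit v (sec a b t)" t] s t(1) orbit_self by blast
    qed
  qed
qed

text \<open>Away from 0 the section misses the limit set of x, so late hits of this orbit have small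
  parameters, and the iterates of P from one hit t0 tend to 0. As P is increasing, the iterates of
  every smaller parameter are squeezed between 0 and these.\<close>

lemma return_passage_limits:
  assumes V: "visits x a b" and P: "passage \<Lambda> (sec a b) (sec a b) P" and \<Lambda>: "\<Lambda> = omega_limit v x"
    and \<delta>0: "\<delta>0 > 0" "\<And>t. 0 < t \<Longrightarrow> t < \<delta>0 \<Longrightarrow> sec a b t \<notin> \<Lambda>"
  obtains t0 where "0 < t0" "t0 < depth a" "t0 < \<delta>0"
    "\<And>t. 0 < t \<Longrightarrow> t \<le> t0 \<Longrightarrow> omega_limit v (sec a b t) \<subseteq> \<Lambda>"
    "\<And>t. 0 < t \<Longrightarrow> t \<le> t0 \<Longrightarrow> zs a \<in> omega_limit v (sec a b t)"
proof -
  have a: "\<bar>a\<bar> = 1" and b: "\<bar>b\<bar> = 1" using V by (simp_all add: visits_def)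
  let ?c = "sec a b"
  define \<delta>1 where "\<delta>1 = min \<delta>0 (depth a) / 2"
  have \<delta>1: "0 < \<delta>1" "\<delta>1 < depth a" "\<delta>1 < \<delta>0" using \<delta>0(1) depth(1)[OF a] by (simp_all add: \<delta>1_def min_def)
  obtain \<delta> where \<delta>: "\<delta> > 0" "continuous_on {0..\<delta>} P" "strict_mono_on {0..\<delta>} P" by (rule passage_germ[OF P])
  obtain \<epsilon>0 where \<epsilon>0: "0 < \<epsilon>0" "\<epsilon>0 \<le> \<delta>" "\<And>t. 0 < t \<Longrightarrow> t \<le> \<epsilon>0 \<Longrightarrow> 0 < P t \<and> P t < \<delta>1"
    by (rule strict_mono_germ_near_zero[OF \<delta>(2,3) passage_zero[OF P] \<delta>(1) \<delta>1(1)]) (rule that)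
  obtain e1 where e1: "e1 > 0"
    "\<And>t. 0 < t \<Longrightarrow> t < e1 \<Longrightarrow> \<exists>\<tau>\<ge>1. v \<tau> (?c t) = ?c (P t) \<and> (\<forall>s\<in>{0..\<tau>}. v s (?c t) \<in> UNIV)"
    by (rule passage_time[OF P open_UNIV subset_UNIV]) (rule that)
  define \<eta> where "\<eta> = Min {\<epsilon>0, e1, \<delta>1}"
  have \<eta>: "0 < \<eta>" "\<eta> \<le> \<epsilon>0" "\<eta> \<le> e1" "\<eta> \<le> \<delta>1" using \<epsilon>0(1) e1(1) \<delta>1(1) by (simp_all add: \<eta>_def)
  have avoid: "\<exists>T. \<forall>\<tau>>T. v \<tau> x \<notin> ?c ` {r..\<delta>1}" if r: "0 < r" for r
  proof -
    have "compact (?c ` {r..\<delta>1})"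
      using r by (intro compact_continuous_image continuous_on_subset[OF continuous_on_sec[OF a b \<delta>1(2)]]) auto
    then have "open (- (?c ` {r..\<delta>1}))" by (intro open_Compl compact_imp_closed)
    moreover have "omega_limit v x \<subseteq> - (?c ` {r..\<delta>1})" using \<delta>0(2) \<delta>1(3) r unfolding \<Lambda> by auto
    ultimately show ?thesis using eventually_near_omega by fastforce
  qed
  obtain T\<eta> where T\<eta>: "\<And>\<tau>. \<tau> > T\<eta> \<Longrightarrow> v \<tau> x \<notin> ?c ` {\<eta>..\<delta>1}" using avoid[OF \<eta>(1)] by blast
  obtain t0 \<tau>0 where t0: "0 < t0" "t0 < \<eta>" "\<tau>0 > T\<eta>" "v \<tau>0 x = ?c t0" by (rule visitsD[OF V \<eta>(1)])
  \<comment> \<open>From below \<open>\<eta>\<close> the map P leads at most to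
    \<open>\<delta>1\<close>; since a late hit between \<open>\<eta>\<close> and
    \<open>\<delta>1\<close> is impossible, the iteration never gets stuck outside the domain of the
    return map.\<close>
  have iter: "0 < (P ^^ n) t0 \<and> (P ^^ n) t0 < \<eta> \<and> (\<exists>\<tau>\<ge>\<tau>0 + real n. v \<tau> x = ?c ((P ^^ n) t0))" for n
  proof (induction n)
    case 0
    then show ?case using t0 by (auto intro: exI[of _ \<tau>0])
  next
    case (Suc n)
    define s where "s = (P ^^ n) t0"
    obtain \<tau> where s: "0 < s" "s < \<eta>" and \<tau>: "\<tau> \<ge> \<tau>0 + real n" "v \<tau> x = ?c s" using Suc unfolding s_def by blast
    have "s < e1" "s \<le> \<epsilon>0" using s(2) \<eta> by simp_all
    obtain \<tau>' where \<tau>': "\<tau>' \<ge> 1" "v \<tau>' (?c s) = ?c (P s)" using e1(2)[OF s(1) \<open>s < e1\<close>] by blast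
    have hit: "v (\<tau>' + \<tau>) x = ?c (P s)" using \<tau>(2) \<tau>'(2) by (simp flip: v_add)
    have Ps: "0 < P s" "P s < \<delta>1" using \<epsilon>0(3)[OF s(1) \<open>s \<le> \<epsilon>0\<close>] by simp_all
    have "\<tau>' + \<tau> > T\<eta>" using \<tau>(1) \<tau>'(1) t0(3) by simp
    from T\<eta>[OF this] have "P s < \<eta>" using Ps unfolding hit by (meson atLeastAtMost_iff image_eqI less_imp_le not_le)
    then show ?case using Ps(1) hit \<tau>(1) \<tau>'(1) by (auto simp: s_def intro!: exI[of _ "\<tau>' + \<tau>"])
  qed
  have small: "\<exists>n0. \<forall>n\<ge>n0. (P ^^ n) t0 < r" if r: "0 < r" for r
  proof -
    obtain T where T: "\<And>\<tau>. \<tau> > T \<Longrightarrow> v \<tau> x \<notin> ?c ` {r..\<delta>1}" using avoid[OF r] by blast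
    obtain n0 :: nat where n0: "real n0 > T - \<tau>0" using reals_Archimedean2 by blast
    have "(P ^^ n) t0 < r" if n: "n \<ge> n0" for n
    proof -
      obtain \<tau> where \<tau>: "\<tau> \<ge> \<tau>0 + real n" "v \<tau> x = ?c ((P ^^ n) t0)" using iter[of n] by blast
      have "\<tau> > T" using \<tau>(1) n0 n by simp
      from T[OF this] show ?thesis
        using iter[of n] \<eta>(4) unfolding \<tau>(2) by (meson atLeastAtMost_iff image_eqI less_imp_le not_le order_trans)
    qed
    then show ?thesis by blast
  qed
  have mono: "0 < (P ^^ n) t \<and> (P ^^ n) t \<le> (P ^^ n) t0" if t: "0 < t" "t \<le> t0" for t n
  proof (induction n)
    case (Suc n)
    define s s0 where "s = (P ^^ n) t" and "s0 = (P ^^ n) t0"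
    have s: "0 < s" "s \<le> s0" "s0 < \<eta>" using Suc iter[of n] by (simp_all add: s_def s0_def)
    have "s0 \<le> \<delta>" "s \<le> \<epsilon>0" using s \<eta> \<epsilon>0(2) by simp_all
    then have "P s \<le> P s0" using s strict_mono_on_leD[OF \<delta>(3), of s s0] by simp
    moreover have "0 < P s" using \<epsilon>0(3)[OF s(1) \<open>s \<le> \<epsilon>0\<close>] by simp
    ultimately show ?case by (simp add: s_def s0_def)
  qed (use t in simp)
  have hits: "\<exists>\<sigma>\<ge>real n. v \<sigma> (?c t) = ?c ((P ^^ n) t)" if t: "0 < t" "t \<le> t0" for t n
  proof (induction n)
    case 0
    then show ?case by (auto intro!: exI[of _ 0])
  next
    case (Suc n)
    obtain \<sigma> where \<sigma>: "\<sigma> \<ge> real n" "v \<sigma> (?c t) = ?c ((P ^^ n) t)" using Suc by blast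
    have "0 < (P ^^ n) t" "(P ^^ n) t < e1" using mono[OF t, of n] iter[of n] \<eta>(3) by auto
    then obtain \<tau> where \<tau>: "\<tau> \<ge> 1" "v \<tau> (?c ((P ^^ n) t)) = ?c (P ((P ^^ n) t))" using e1(2) by blast
    have "v (\<tau> + \<sigma>) (?c t) = ?c ((P ^^ Suc n) t)" using \<sigma>(2) \<tau>(2) by (simp flip: v_add)
    then show ?case using \<sigma>(1) \<tau>(1) by (intro exI[of _ "\<tau> + \<sigma>"]) simp
  qed
  show thesis
  proof (rule that[of t0])
    show "0 < t0" "t0 < depth a" "t0 < \<delta>0" using t0 \<eta> \<delta>1 by auto
  next
    fix t assume t: "0 < t" "t \<le> t0"
    show "omega_limit v (?c t) \<subseteq> \<Lambda>"
    proof (rule omega_subset_if_eventually_near)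
      show "closed \<Lambda>" unfolding \<Lambda> by (rule closed_omega)
      fix N assume N: "open N" "\<Lambda> \<subseteq> N"
      obtain e where e: "e > 0"
        "\<And>t. 0 < t \<Longrightarrow> t < e \<Longrightarrow> \<exists>\<tau>\<ge>1. v \<tau> (?c t) = ?c (P t) \<and> (\<forall>s\<in>{0..\<tau>}. v s (?c t) \<in> N)"
        by (rule passage_time[OF P N]) (rule that)
      obtain n0 where n0: "\<And>n. n \<ge> n0 \<Longrightarrow> (P ^^ n) t0 < e" using small[OF e(1)] by blast
      define z where "z = ?c ((P ^^ n0) t)"
      obtain \<sigma>0 where \<sigma>0: "v \<sigma>0 (?c t) = z" using hits[OF t, of n0] by (auto simp: z_def)
      \<comment> \<open>The half-open interval makes the case k = 0, with
        \<open>\<sigma> = 0\<close>, demand nothing; each end point is covered by the arc that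
        follows.\<close>
      have arcs: "\<exists>\<sigma>\<ge>real k. v \<sigma> z = ?c ((P ^^ (k + n0)) t) \<and> (\<forall>r\<in>{0..<\<sigma>}. v r z \<in> N)" for k
      proof (induction k)
        case 0
        then show ?case by (auto simp: z_def intro!: exI[of _ 0])
      next
        case (Suc k)
        define s where "s = (P ^^ (k + n0)) t"
        obtain \<sigma> where \<sigma>: "\<sigma> \<ge> real k" "v \<sigma> z = ?c s" "\<forall>r\<in>{0..<\<sigma>}. v r z \<in> N" using Suc by (auto simp: s_def)
        have "0 < s" "s < e" using mono[OF t, of "k + n0"] n0[of "k + n0"] by (simp_all add: s_def)
        then obtain \<tau> where \<tau>: "\<tau> \<ge> 1" "v \<tau> (?c s) = ?c (P s)" "\<forall>r\<in>{0..\<tau>}. v r (?c s) \<in> N" using e(2) by blast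
        have "v r z \<in> N" if r: "r \<in> {0..<\<tau> + \<sigma>}" for r
        proof (cases "r < \<sigma>")
          case False
          then have "v (r - \<sigma>) (v \<sigma> z) \<in> N" using \<tau>(3) r by (simp add: \<sigma>(2))
          then show ?thesis by (simp add: v_add)
        qed (use \<sigma>(3) r in auto)
        moreover have "v (\<tau> + \<sigma>) z = ?c ((P ^^ (Suc k + n0)) t)" using \<sigma>(2) \<tau>(2) by (simp add: s_def flip: v_add)
        ultimately show ?case using \<sigma>(1) \<tau>(1) by (intro exI[of _ "\<tau> + \<sigma>"]) simp
      qed
      have "v r z \<in> N" if "r \<ge> 0" for r
      proof -
        obtain k :: nat where "real k > r" using reals_Archimedean2 by blast
        moreover obtain \<sigma> where "\<sigma> \<ge> real k" "\<forall>r\<in>{0..<\<sigma>}. v r z \<in> N" using arcs[of k] by blast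
        ultimately show ?thesis using that by simp
      qed
      then have "v s (?c t) \<in> N" if "s \<ge> \<sigma>0" for s
        using that \<open>\<And>r. r \<ge> 0 \<Longrightarrow> v r z \<in> N\<close>[of "s - \<sigma>0"] by (simp add: v_add flip: \<sigma>0)
      then show "\<exists>T. \<forall>s\<ge>T. v s (?c t) \<in> N" by blast
    qed
    show "zs a \<in> omega_limit v (?c t)"
      unfolding omega_iff
    proof (intro allI impI)
      fix W n assume W: "open W \<and> zs a \<in> W"
      obtain \<epsilon> where \<epsilon>: "\<epsilon> > 0" "\<And>t. 0 \<le> t \<Longrightarrow> t < \<epsilon> \<Longrightarrow> ?c t \<in> W"
        by (rule sec_near[OF a b conjunct1[OF W] conjunct2[OF W]]) (rule that)
      obtain n0 where n0: "\<And>n. n \<ge> n0 \<Longrightarrow> (P ^^ n) t0 < \<epsilon>" using small[OF \<epsilon>(1)] by blast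
      obtain m :: nat where m: "real m > n" using reals_Archimedean2 by blast
      define k where "k = max n0 m"
      obtain \<sigma> where \<sigma>: "\<sigma> \<ge> real k" "v \<sigma> (?c t) = ?c ((P ^^ k) t)" using hits[OF t] by blast
      have "(P ^^ k) t < \<epsilon>" "0 < (P ^^ k) t" using mono[OF t, of k] n0[of k] by (simp_all add: k_def)
      then have "v \<sigma> (?c t) \<in> W" unfolding \<sigma>(2) by (intro \<epsilon>(2)) simp_all
      moreover have "\<sigma> > n" using \<sigma>(1) m by (simp add: k_def)
      ultimately show "\<exists>s>n. v s (?c t) \<in> W" by blast
    qed
  qed
qed

text \<open>The hitting argument of \<open>transit\<close> at an interior point of the section; the
  strip around it keeps the parameter strictly between 0 and t0.\<close>

lemma section_flow_box:
  assumes a: "\<bar>a\<bar> = 1" and b: "\<bar>b\<bar> = 1" and t: "0 < t" "t < t0" "t0 < depth a"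
  obtains G where "open G" "sec a b t \<in> G" "\<And>z. z \<in> G \<Longrightarrow> \<exists>s t'. 0 < t' \<and> t' < t0 \<and> v s z = sec a b t'"
proof -
  define z0 where "z0 = sec a b t"
  have z0: "z0 \<in> U" "X z0 = a" "Y z0 = g a + b * t" "\<bar>g a + b * t\<bar> < 1"
    using sec_depth[OF a b, of t] t by (simp_all add: z0_def)
  have aa: "a * a = 1" "b * b = 1" "a = 1 \<or> a = -1" using a b by (auto simp: abs_eq_1_cases)
  let ?W = "{z \<in> U. \<psi> z \<in> {x. 1/2 < a * x \<and> a * x < 2} \<times> {y. 0 < b * (y - g a) \<and> b * (y - g a) < t0}}"
  have W: "open ?W" by (intro open_coord open_Times open_Collect_conj open_Collect_less continuous_intros)
  have Y1: "\<bar>Y z\<bar> < 1" if "z \<in> ?W" for z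
  proof -
    have "\<bar>b * (Y z - g a)\<bar> < t0" using that by (auto simp: mem_Times_iff)
    then have "\<bar>Y z - g a\<bar> < t0" using b by (simp add: abs_mult)
    then show ?thesis using t(3) by (simp add: depth_def)
  qed
  have WX: "z \<in> WX" "\<bar>X z\<bar> = a * X z" if "z \<in> ?W" for z
    using that aa(3) Y1[OF that] by (auto simp: WX_def mem_Times_iff)
  have bbt: "b * (b * t) = t" using aa(2) by (simp flip: mult.assoc)
  have "z0 \<in> ?W" using z0 aa t by (auto simp: mem_Times_iff bbt)
  then obtain \<epsilon> where \<epsilon>: "\<epsilon> > 0" "\<And>s. \<bar>s\<bar> \<le> \<epsilon> \<Longrightarrow> v s z0 \<in> ?W" by (rule short_arc[OF W]) (rule that)
  let ?I = "{-\<epsilon>..\<epsilon>}"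
  have arc0: "v s z0 \<in> ?W" if "s \<in> ?I" for s using that by (intro \<epsilon>(2)) auto
  obtain N where N: "open N" "z0 \<in> N" "\<And>z s. z \<in> N \<Longrightarrow> s \<in> ?I \<Longrightarrow> v s z \<in> ?W"
    by (rule tube[OF W compact_Icc[of "-\<epsilon>" \<epsilon>] arc0]) (assumption, rule that)
  let ?V = "{z \<in> U. \<psi> z \<in> {x. 1 < a * x} \<times> UNIV}" and ?V' = "{z \<in> U. \<psi> z \<in> {x. a * x < 1} \<times> UNIV}"
  have V: "open ?V" "open ?V'" by (intro open_coord open_Times open_UNIV open_Collect_less continuous_intros)+
  define M where "M = N \<inter> v (-\<epsilon>) -` ?V \<inter> v \<epsilon> -` ?V'"
  have M: "open M" unfolding M_def using N(1) V by (intro open_Int open_vimage continuous_intros)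
  have mono0: "a * X (v s' z0) < a * X (v s z0)" if "s \<in> ?I" "s' \<in> ?I" "s < s'" for s s'
  proof -
    have "\<bar>X (v s' z0)\<bar> < \<bar>X (v s z0)\<bar>" using that WX(1) arc0 by (intro X_decreasing) auto
    then show ?thesis using WX(2)[OF arc0[OF that(1)]] WX(2)[OF arc0[OF that(2)]] by simp
  qed
  have I: "-\<epsilon> \<in> ?I" "\<epsilon> \<in> ?I" "0 \<in> ?I" using \<epsilon>(1) by auto
  have "a * X (v 0 z0) = 1" using z0(2) aa by simp
  then have "z0 \<in> M"
    unfolding M_def using N(2) mono0[OF I(1,3)] mono0[OF I(3,2)] arc0[OF I(1)] arc0[OF I(2)] \<epsilon>(1) by (auto simp: mem_Times_iff)
  moreover have "\<exists>s t'. 0 < t' \<and> t' < t0 \<and> v s z = sec a b t'" if z: "z \<in> M" for z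
  proof -
    have arc: "v s z \<in> ?W" if "s \<in> ?I" for s using z that by (intro N(3)) (auto simp: M_def)
    have "1 \<le> a * X (v (-\<epsilon>) z)" "a * X (v \<epsilon> z) \<le> 1" using z by (auto simp: M_def mem_Times_iff)
    moreover have "continuous_on ?I (\<lambda>s. a * X (v s z))" using arc by (intro continuous_intros) auto
    ultimately obtain s where s: "s \<in> ?I" "a * X (v s z) = 1"
      using IVT2'[of "\<lambda>s. a * X (v s z)" \<epsilon> 1 "-\<epsilon>"] \<epsilon>(1) by auto
    define t' where "t' = b * (Y (v s z) - g a)"
    have "a * (a * X (v s z)) = a * 1" using s(2) by simp
    then have Xa: "X (v s z) = a" using aa(1) by (simp flip: mult.assoc)
    have bt: "b * t' = Y (v s z) - g a" using aa(2) by (simp add: t'_def flip: mult.assoc)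
    have "v s z \<in> U" using arc[OF s(1)] by simp
    then have "sec a b t' = v s z"
      using Xa Y1[OF arc[OF s(1)]] by (intro sec_eqI[OF a]) (simp_all add: bt)
    moreover have "0 < t'" "t' < t0" using arc[OF s(1)] by (auto simp: t'_def mem_Times_iff)
    ultimately show ?thesis by metis
  qed
  ultimately show thesis using that[of M] M by (simp add: z0_def)
qed

text \<open>By transversality two hits of one orbit at different parameters are more than
  \<open>\<epsilon>\<close> apart in time, so rounding the times to multiples of
  \<open>\<epsilon>\<close> is injective.\<close>

lemma countable_section_times:
  assumes a: "\<bar>a\<bar> = 1" and b: "\<bar>b\<bar> = 1" and t0: "t0 < depth a"
  shows "countable {t \<in> {0<..<t0}. sec a b t \<in> orbit v f}"
proof -
  let ?S = "{t \<in> {0<..<t0}. sec a b t \<in> orbit v f}"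
  obtain \<epsilon> where \<epsilon>: "\<epsilon> > 0"
    "\<And>t1 t2 s. t1 \<in> {0..t0} \<Longrightarrow> t2 \<in> {0..t0} \<Longrightarrow> \<bar>s\<bar> \<le> \<epsilon> \<Longrightarrow> v s (sec a b t1) = sec a b t2 \<Longrightarrow> s = 0"
    by (rule sec_transversal[OF a b t0]) (rule that)
  have "\<exists>\<tau>. v \<tau> f = sec a b t" if "t \<in> ?S" for t using that by (auto simp: orbit_def)
  then obtain \<tau> where \<tau>: "\<And>t. t \<in> ?S \<Longrightarrow> v (\<tau> t) f = sec a b t" by metis
  have "inj_on (\<lambda>t. \<lfloor>\<tau> t / \<epsilon>\<rfloor>) ?S"
  proof (rule inj_onI)
    fix t t' assume t: "t \<in> ?S" "t' \<in> ?S" "\<lfloor>\<tau> t / \<epsilon>\<rfloor> = \<lfloor>\<tau> t' / \<epsilon>\<rfloor>"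
    have "\<bar>\<tau> t' / \<epsilon> - \<tau> t / \<epsilon>\<bar> \<le> 1" using t(3) by linarith
    then have "\<bar>\<tau> t' - \<tau> t\<bar> \<le> \<epsilon>" using \<epsilon>(1) by (simp add: field_simps abs_le_iff flip: diff_divide_distrib)
    moreover have "v (\<tau> t' - \<tau> t) (sec a b t) = sec a b t'"
      using \<tau>[OF t(1)] \<tau>[OF t(2)] by (metis v_add diff_add_cancel)
    ultimately have "\<tau> t' - \<tau> t = 0" using t by (intro \<epsilon>(2)[of t t']) auto
    then have "sec a b t = sec a b t'" using \<tau>[OF t(1)] \<tau>[OF t(2)] by simp
    then show "t = t'" using inj_onD[OF inj_on_sec[OF a b t0]] t by auto
  qed
  then show ?thesis using countable_image_inj_eq by blast
qed

end

text \<open>Without a loop the relation would be a strict order on a finite set, and a maximal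
  element would have no successor.\<close>

lemma finite_transitive_loop:
  assumes "finite A" "A \<noteq> {}" "transp_on A R" "\<And>x. x \<in> A \<Longrightarrow> \<exists>y\<in>A. R x y"
  shows "\<exists>x\<in>A. R x x"
proof (rule ccontr)
  assume no: "\<not> ?thesis"
  have "asymp_on A R" using no assms(3) by (auto simp: asymp_on_def transp_on_def)
  then obtain m where "m \<in> A" "\<forall>x\<in>A. x \<noteq> m \<longrightarrow> \<not> R m x"
    using Finite_Set.bex_max_element[OF assms(1) _ assms(3,2)] by blast
  then show False using assms(4)[of m] no by metis
qed

section \<open>Walks along saddle connections\<close>

context saddle_flow begin

text \<open>One fixed box per saddle, so that returning to the same corner means returning to the
  same section.\<close>

definition chart :: "'a \<Rightarrow> 'a set \<times> ('a \<Rightarrow> real \<times> real)" where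
  "chart p = (SOME q. saddle_box v p (fst q) (snd q))"

lemma box_flow_chart: "p \<in> Sd \<Longrightarrow> box_flow v p (fst (chart p)) (snd (chart p))"
proof -
  assume "p \<in> Sd"
  then obtain U \<psi> where "saddle_box v p U \<psi>" using box_exists by blast
  then have "\<exists>q. saddle_box v p (fst q) (snd q)" by (intro exI[of _ "(U, \<psi>)"]) simp
  then have "saddle_box v p (fst (chart p)) (snd (chart p))" unfolding chart_def by (rule someI_ex)
  then show ?thesis by (rule box_flow.intro[OF compact_flow_axioms box_flow_axioms.intro])
qed

abbreviation "chart_sec p \<equiv> box_flow.sec v (fst (chart p)) (snd (chart p))"
abbreviation "chart_visits p \<equiv> box_flow.visits v (fst (chart p)) (snd (chart p))"

text \<open>The unstable branch b of p lies in the limit set of x, so by assumption it ends in a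
  saddle q, along one of the two stable branches of q. The passage carries late and deep hits at p
  to late and deep hits at q.\<close>

lemma next_visit:
  assumes p: "p \<in> Sd" and V: "chart_visits p x a b"
    and ends: "\<And>y. y \<in> omega_limit v x \<Longrightarrow> \<exists>q\<in>Sd. omega_limit v y = {q}"
  shows "\<exists>q\<in>Sd. \<exists>a' b' P. chart_visits q x a' b' \<and> passage (omega_limit v x) (chart_sec p a b) (chart_sec q a' b') P"
proof -
  interpret P: box_flow v p "fst (chart p)" "snd (chart p)" by (rule box_flow_chart[OF p])
  interpret R: box_flow rv p "fst (chart p)" "prod.swap \<circ> snd (chart p)" by (rule P.box_flow_reverse)
  let ?\<Lambda> = "omega_limit v x"
  have a: "\<bar>a\<bar> = 1" and b: "\<bar>b\<bar> = 1" using V by (simp_all add: P.visits_def)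
  note lim = P.visits_limits[OF V]
  obtain q where q: "q \<in> Sd" "omega_limit v (R.zs b) = {q}" using ends[OF lim(3)] by blast
  interpret Q: box_flow v q "fst (chart q)" "snd (chart q)" by (rule box_flow_chart[OF q(1)])
  have "omega_limit rv (R.zs b) = {p}" using b by (intro R.stay_omega R.zs_stay) simp
  then have al: "alpha_limit v (R.zs b) = {p}" by (simp add: omega_reverse)
  have "R.zs b \<noteq> q"
  proof
    assume eq: "R.zs b = q"
    then have "p = q" using al alpha_Sd[OF q(1)] by simp
    moreover have "R.zs b \<noteq> p" using b by (intro R.zs_ne_p) auto
    ultimately show False using eq by simp
  qed
  then have "R.zs b \<in> orbit v (Q.zs 1) \<or> R.zs b \<in> orbit v (Q.zs (-1))"
    using Q.stable_set_eq q(2) by (auto simp: stable_set_def)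
  then obtain a' where a': "\<bar>a'\<bar> = 1" "R.zs b \<in> orbit v (Q.zs a')"
    by (elim disjE) (rule that[of 1], simp, assumption, rule that[of "-1"], simp)
  then obtain T where "R.zs b = v T (Q.zs a')" by (auto simp: orbit_def)
  then have T: "v (- T) (R.zs b) = Q.zs a'" by simp
  obtain b' P where b': "\<bar>b'\<bar> = 1" and P: "passage ?\<Lambda> (P.sec a b) (Q.sec a' b') P"
    using P.corner_passage[OF a b box_flow_chart[OF q(1)] a'(1) lim(2) omega_invariant[OF lim(1)] omega_invariant[OF lim(3)] T]
    by blast
  have "Q.visits x a' b'"
    unfolding Q.visits_def
  proof (intro conjI allI impI a'(1) b')
    fix \<epsilon> K :: real assume "\<epsilon> > 0"
    obtain \<delta> where \<delta>: "\<delta> > 0" "continuous_on {0..\<delta>} P" "strict_mono_on {0..\<delta>} P" by (rule passage_germ[OF P])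
    obtain \<eta> where \<eta>: "0 < \<eta>" "\<eta> \<le> \<delta>" "\<And>t. 0 < t \<Longrightarrow> t \<le> \<eta> \<Longrightarrow> 0 < P t \<and> P t < \<epsilon>"
      by (rule strict_mono_germ_near_zero[OF \<delta>(2,3) passage_zero[OF P] \<delta>(1) \<open>\<epsilon> > 0\<close>]) (rule that)
    obtain e where e: "e > 0"
      "\<And>t. 0 < t \<Longrightarrow> t < e \<Longrightarrow> \<exists>\<tau>\<ge>0. v \<tau> (P.sec a b t) = Q.sec a' b' (P t) \<and> (\<forall>s\<in>{0..\<tau>}. v s (P.sec a b t) \<in> UNIV)"
      by (rule passage_time[OF P open_UNIV subset_UNIV]) (rule that)
    have "0 < min \<eta> e" using \<eta>(1) e(1) by simp
    obtain t \<tau> where t: "0 < t" "t < min \<eta> e" "\<tau> > K" "v \<tau> x = P.sec a b t"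
      by (rule P.visitsD[OF V \<open>0 < min \<eta> e\<close>])
    obtain \<tau>' where \<tau>': "\<tau>' \<ge> 0" "v \<tau>' (P.sec a b t) = Q.sec a' b' (P t)" using e(2)[of t] t by auto
    have "v (\<tau>' + \<tau>) x = Q.sec a' b' (P t)" using t(4) \<tau>'(2) by (simp flip: v_add)
    moreover have "0 < P t \<and> P t < \<epsilon>" using \<eta>(3)[of t] t by simp
    moreover have "\<tau>' + \<tau> > K" using t(3) \<tau>'(1) by simp
    ultimately show "\<exists>t \<tau>. 0 < t \<and> t < \<epsilon> \<and> \<tau> > K \<and> v \<tau> x = Q.sec a' b' t" by blast
  qed
  then show ?thesis using q(1) P by blast
qed

end

context saddle_R_closed begin

text \<open>Only finitely many corners are visited, each leads to another visited one, and passages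
  compose. So some corner has a passage to itself, the return map of a cycle.\<close>

lemma recurrent_walk:
  assumes ends: "\<And>y. y \<in> omega_limit v x \<Longrightarrow> \<exists>q\<in>Sd. omega_limit v y = {q}"
    and ns: "\<And>p. p \<in> Sd \<Longrightarrow> omega_limit v x \<noteq> {p}" and x: "proper x"
  obtains p a b P where "p \<in> Sd" "chart_visits p x a b" "passage (omega_limit v x) (chart_sec p a b) (chart_sec p a b) P"
proof -
  let ?\<Lambda> = "omega_limit v x"
  define A where "A = {(p, a, b). p \<in> Sd \<and> chart_visits p x a b}"
  have "A \<subseteq> (C x \<inter> Sd) \<times> {1, -1} \<times> {1, -1}"
  proof
    fix i assume "i \<in> A"
    then obtain p a b where i: "i = (p, a, b)" and p: "p \<in> Sd" and V: "chart_visits p x a b" by (auto simp: A_def)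
    interpret P: box_flow v p "fst (chart p)" "snd (chart p)" by (rule box_flow_chart[OF p])
    have "p \<in> C x" using P.visits_limits(2)[OF V] omega_subset_C[OF C_self] by blast
    moreover have "\<bar>a\<bar> = 1" "\<bar>b\<bar> = 1" using V by (simp_all add: P.visits_def)
    ultimately show "i \<in> (C x \<inter> Sd) \<times> {1, -1} \<times> {1, -1}" using p by (auto simp: i abs_eq_1_cases)
  qed
  then have "finite A" using finite_saddles[OF x] finite_subset by blast
  moreover have "A \<noteq> {}"
  proof -
    obtain y where y: "y \<in> ?\<Lambda>" using omega_nonempty by blast
    obtain p where p: "p \<in> Sd" "omega_limit v y = {p}" using ends[OF y] by blast
    interpret P: box_flow v p "fst (chart p)" "snd (chart p)" by (rule box_flow_chart[OF p(1)])
    have "p \<in> ?\<Lambda>" using omega_of_omega[OF y] p(2) by simp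
    then obtain a b where "P.visits x a b" using P.visits_exist[OF _ ns[OF p(1)]] by blast
    then show ?thesis using p(1) by (auto simp: A_def)
  qed
  moreover define R where "R i j \<longleftrightarrow> (\<exists>P. passage ?\<Lambda> (chart_sec (fst i) (fst (snd i)) (snd (snd i)))
      (chart_sec (fst j) (fst (snd j)) (snd (snd j))) P)" for i j
  moreover have "transp_on A R"
    unfolding R_def transp_on_def using passage_compose by blast
  moreover have "\<exists>j\<in>A. R i j" if i: "i \<in> A" for i
  proof -
    obtain p a b where i': "i = (p, a, b)" "p \<in> Sd" "chart_visits p x a b" using i by (auto simp: A_def)
    obtain q a' b' P where q: "q \<in> Sd" "chart_visits q x a' b'"
      "passage (omega_limit v x) (chart_sec p a b) (chart_sec q a' b') P"
      using next_visit[OF i'(2,3) ends] by blast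
    then show ?thesis by (intro bexI[of _ "(q, a', b')"]) (auto simp: A_def R_def i')
  qed
  ultimately obtain i where "i \<in> A" "R i i" using finite_transitive_loop[of A R] by blast
  then show thesis using that by (auto simp: A_def R_def)
qed

text \<open>
  An orbit spiralling onto a graph of saddle connections drags along all orbits in between, so the
  class of a connection would contain an open set, although it consists of finitely many orbits
  that are not recurrent there.
\<close>

lemma no_spiral:
  assumes ends: "\<And>y. y \<in> omega_limit v x \<Longrightarrow> \<exists>q\<in>Sd. omega_limit v y = {q}"
    "\<And>y. y \<in> omega_limit v x \<Longrightarrow> \<exists>q\<in>Sd. alpha_limit v y = {q}"
    and ns: "\<And>p. p \<in> Sd \<Longrightarrow> omega_limit v x \<noteq> {p}" and nr: "x \<notin> omega_limit v x"
  shows False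
proof -
  let ?\<Lambda> = "omega_limit v x"
  have x: "proper x" using nr omega_fixed[of x] by (auto simp: proper_def)
  obtain p a b P where p: "p \<in> Sd" and V: "chart_visits p x a b"
    and P: "passage ?\<Lambda> (chart_sec p a b) (chart_sec p a b) P"
    by (rule recurrent_walk[OF ends(1) ns x]) (assumption | rule that)+
  interpret B: box_flow v p "fst (chart p)" "snd (chart p)" by (rule box_flow_chart[OF p])
  have a: "\<bar>a\<bar> = 1" and b: "\<bar>b\<bar> = 1" using V by (simp_all add: B.visits_def)
  define e where "e = B.zs a"
  have e: "omega_limit v e = {p}" "e \<noteq> p"
    unfolding e_def using a B.zs_ne_p[of a] by (auto intro!: B.stay_omega B.zs_stay)
  have e_ne: "e \<noteq> q" if "q \<in> Sd" for q
    using omega_Sd[OF that] e by auto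
  have ng_\<Lambda>: "\<not> generic y" if "y \<in> ?\<Lambda>" for y using ends(1)[OF that] by (auto simp: generic_def)
  have "orbit v ` ?\<Lambda> \<subseteq> orbit v ` {z \<in> C x. \<not> generic z}"
    using ng_\<Lambda> omega_subset_C[OF C_self] by blast
  then have fin: "finite (orbit v ` ?\<Lambda>)" using finite_nongeneric_orbits[OF x] by (rule finite_subset)
  have "e \<notin> omega_limit v y \<union> alpha_limit v y" if "y \<in> ?\<Lambda>" for y
    using ends[OF that] e_ne by auto
  then obtain \<delta> where \<delta>: "\<delta> > 0" "\<And>t. 0 < t \<Longrightarrow> t < \<delta> \<Longrightarrow> B.sec a b t \<notin> ?\<Lambda>"
    unfolding e_def by (rule B.section_avoids[OF a b fin]) (assumption, rule that)
  obtain t0 where t0: "0 < t0" "t0 < B.depth a" "t0 < \<delta>"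
    "\<And>t. 0 < t \<Longrightarrow> t \<le> t0 \<Longrightarrow> omega_limit v (B.sec a b t) \<subseteq> ?\<Lambda>"
    "\<And>t. 0 < t \<Longrightarrow> t \<le> t0 \<Longrightarrow> B.zs a \<in> omega_limit v (B.sec a b t)"
    by (rule B.return_passage_limits[OF V P refl \<delta>]) (assumption | rule that)+
  note t0_e = t0(5)[folded e_def]
  have "\<not> generic e" using e(1) p by (auto simp: generic_def)
  define \<A> where "\<A> = orbit v ` {z \<in> C e. \<not> generic z}"
  have "finite \<A>" unfolding \<A>_def by (intro finite_nongeneric_orbits nongeneric_proper \<open>\<not> generic e\<close>)
  \<comment> \<open>By symmetry of classes the section point lies in the closure of
    \<open>E e\<close>, which has only finitely many orbits. So it lies in the closure of a single
    one that meets the flow box G; since that orbit does not accumulate there, it contains the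
    point.\<close>
  have in_\<A>: "orbit v (B.sec a b t) \<in> \<A>" if t: "0 < t" "t < t0" for t
  proof -
    let ?c = "B.sec a b t"
    obtain G where G: "open G" "?c \<in> G" "\<And>z. z \<in> G \<Longrightarrow> \<exists>s t'. 0 < t' \<and> t' < t0 \<and> v s z = B.sec a b t'"
      by (rule B.section_flow_box[OF a b t t0(2)]) (rule that)
    have e_c: "e \<in> omega_limit v ?c" using t by (intro t0_e) auto
    then have "e \<in> C ?c" using omega_subset_C[OF C_self] by blast
    then have "?c \<in> closure (E e)" using C_sym by (simp add: cl_ext_def)
    then have "?c \<in> closure (G \<inter> E e)" using open_Int_closure_subset[OF G(1)] G(2) by blast
    moreover have ngE: "\<not> generic z" if "z \<in> E e" for z
    proof
      assume "generic z"
      moreover have "e \<in> E z" using ext_sym that by simp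
      ultimately have "e \<in> orbit v z" by (simp add: ext_generic)
      then have "orbit v e = orbit v z" by (rule orbit_eqI)
      from limits_same_orbit[OF this] show False
        using \<open>generic z\<close> \<open>\<not> generic e\<close> by (simp add: generic_def)
    qed
    have sub\<A>: "orbit v ` (G \<inter> E e) \<subseteq> \<A>" unfolding \<A>_def using ngE ext_subset_C by blast
    then have "finite (orbit v ` (G \<inter> E e))" using \<open>finite \<A>\<close> by (rule finite_subset)
    then have "closed (\<Union>A\<in>orbit v ` (G \<inter> E e). closure A)" by (intro closed_UN) auto
    moreover have "G \<inter> E e \<subseteq> (\<Union>A\<in>orbit v ` (G \<inter> E e). closure A)"
      using orbit_self closure_subset by fast
    ultimately have "?c \<in> (\<Union>A\<in>orbit v ` (G \<inter> E e). closure A)" using closure_minimal by blast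
    then obtain z where z: "z \<in> G" "z \<in> E e" "?c \<in> closure (orbit v z)" by blast
    have "closure (orbit v z) \<subseteq> orbit v z \<union> omega_limit v z \<union> alpha_limit v z"
      by (intro closure_minimal closed_limits_orbit) auto
    moreover obtain s t' where s: "0 < t'" "t' < t0" "v s z = B.sec a b t'" using G(3)[OF z(1)] by blast
    have om_z: "omega_limit v z = omega_limit v (B.sec a b t')" by (simp flip: s(3))
    \<comment> \<open>Orbits meeting the flow box have their omega limit in
      \<open>\<Lambda>\<close>, which the section avoids.\<close>
    have "?c \<notin> omega_limit v z"
      using t0(4)[of t'] s om_z \<delta>(2)[of t] t t0(3) by auto
    \<comment> \<open>The omega limit of z contains e and is no saddle, so the nongeneric z has a
      saddle as alpha limit; the section point accumulates on e and is no saddle.\<close>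
    moreover have "?c \<notin> alpha_limit v z"
    proof
      assume c: "?c \<in> alpha_limit v z"
      have "e \<in> omega_limit v z" unfolding om_z using s by (intro t0_e) auto
      then have "omega_limit v z \<noteq> {q}" if "q \<in> Sd" for q using e_ne[OF that] by auto
      then obtain q where q: "q \<in> Sd" "alpha_limit v z = {q}" using ngE[OF z(2)] by (auto simp: generic_def)
      then have "?c = q" using c by simp
      then show False using e_c e_ne[OF q(1)] omega_Sd[OF q(1)] by simp
    qed
    ultimately have "?c \<in> orbit v z" using z(3) by blast
    then have "orbit v ?c = orbit v z" by (rule orbit_eqI)
    then show ?thesis using sub\<A> z by blast
  qed
  have "{0<..<t0} \<subseteq> (\<Union>A\<in>\<A>. {t \<in> {0<..<t0}. B.sec a b t \<in> A})" using in_\<A> orbit_self by fastforce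
  moreover have "countable {t \<in> {0<..<t0}. B.sec a b t \<in> A}" if "A \<in> \<A>" for A
    using that B.countable_section_times[OF a b t0(2)] by (auto simp: \<A>_def)
  then have "countable (\<Union>A\<in>\<A>. {t \<in> {0<..<t0}. B.sec a b t \<in> A})"
    using countable_finite[OF \<open>finite \<A>\<close>] by (intro countable_UN)
  ultimately have "countable {0<..<t0}" by (rule countable_subset)
  then show False using t0(1) uncountable_open_interval by blast
qed

text \<open>A point whose omega or alpha limit is the whole set would be recurrent in that direction
  of time, which \<open>nongeneric_recurrent_false\<close> excludes. So all limits inside the set
  are saddles, and \<open>no_spiral\<close> applies.\<close>

lemma minimal_limit_false:
  assumes x: "proper x" and ns: "\<And>p. p \<in> Sd \<Longrightarrow> omega_limit v x \<noteq> {p}"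
    and ng: "\<And>y. y \<in> omega_limit v x \<Longrightarrow> \<not> generic y"
    and min: "\<And>y. y \<in> omega_limit v x \<Longrightarrow> (\<exists>q\<in>Sd. omega_limit v y = {q}) \<or> omega_limit v y = omega_limit v x"
      "\<And>y. y \<in> omega_limit v x \<Longrightarrow> (\<exists>q\<in>Sd. alpha_limit v y = {q}) \<or> alpha_limit v y = omega_limit v x"
  shows False
proof -
  have sub: "omega_limit v x \<subseteq> C x" by (rule omega_subset_C[OF C_self])
  have ns': "\<not> (\<exists>p\<in>Sd. omega_limit v x = {p})" using ns by blast
  have om: "\<exists>q\<in>Sd. omega_limit v y = {q}" if y: "y \<in> omega_limit v x" for y
  proof (rule ccontr)
    assume "\<not> ?thesis"
    then have eq: "omega_limit v y = omega_limit v x" using min(1)[OF y] by simp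
    show False
      by (rule nongeneric_recurrent_false[OF x, of y]) (use y sub ng ns' in \<open>simp_all add: eq\<close>)
  qed
  have al: "\<exists>q\<in>Sd. alpha_limit v y = {q}" if y: "y \<in> omega_limit v x" for y
  proof (rule ccontr)
    assume "\<not> ?thesis"
    then have eq: "alpha_limit v y = omega_limit v x" using min(2)[OF y] by simp
    show False
      by (rule saddle_R_closed.nongeneric_recurrent_false[OF saddle_R_closed_reverse, of x y])
        (use x y sub ng ns' in \<open>simp_all add: eq omega_reverse cl_ext_reverse generic_reverse proper_reverse\<close>)
  qed
  have "x \<notin> omega_limit v x"
    using nongeneric_recurrent_false[OF x _ sub ng] ns' by blast
  then show False using no_spiral[OF om al ns] by blast
qed

text \<open>Minimality is measured by the number of orbits, which is finite for a set of nongeneric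
  points in a proper class. Alpha limits compete along with omega limits, because both kinds occur
  inside a limit set; a minimal alpha limit is handled by the reversed flow.\<close>

lemma generic_in_omega:
  assumes u: "proper u" and ns: "\<And>p. p \<in> Sd \<Longrightarrow> omega_limit v u \<noteq> {p}"
  shows "\<exists>y\<in>omega_limit v u. generic y"
proof (rule ccontr)
  assume no: "\<not> ?thesis"
  define F where "F \<Lambda> \<longleftrightarrow> \<Lambda> \<subseteq> {z \<in> C u. \<not> generic z} \<and> \<not> (\<exists>p\<in>Sd. \<Lambda> = {p})
      \<and> (\<exists>x\<in>C u. \<Lambda> = omega_limit v x \<or> \<Lambda> = alpha_limit v x)" for \<Lambda>
  have "F (omega_limit v u)" unfolding F_def using no ns omega_subset_C[OF C_self] C_self by auto
  then obtain \<Lambda> where \<Lambda>: "F \<Lambda>" and least: "\<And>\<Lambda>'. F \<Lambda>' \<Longrightarrow> card (orbit v ` \<Lambda>) \<le> card (orbit v ` \<Lambda>')"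
    using exists_least_iff ex_has_least_nat[of F _ "\<lambda>\<Lambda>. card (orbit v ` \<Lambda>)"] by blast
  have fin: "finite (orbit v ` \<Lambda>)"
    using \<Lambda> by (intro finite_subset[OF image_mono finite_nongeneric_orbits[OF u]]) (simp add: F_def)
  \<comment> \<open>A smaller member of the family has no fewer orbits, hence the same ones, and
    invariant sets are the unions of their orbits.\<close>
  have eq: "\<Lambda>' = \<Lambda>" if \<Lambda>': "F \<Lambda>'" "\<Lambda>' \<subseteq> \<Lambda>" for \<Lambda>'
  proof -
    have "orbit v ` \<Lambda>' = orbit v ` \<Lambda>" by (rule card_seteq[OF fin image_mono[OF \<Lambda>'(2)] least[OF \<Lambda>'(1)]])
    moreover have "\<Union> (orbit v ` \<Lambda>') = \<Lambda>'"
    proof -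
      obtain x where "\<Lambda>' = omega_limit v x \<or> \<Lambda>' = alpha_limit v x" using \<Lambda>'(1) by (auto simp: F_def)
      then have "orbit v y \<subseteq> \<Lambda>'" if "y \<in> \<Lambda>'" for y
        using that omega_invariant alpha_invariant by (auto simp: orbit_def)
      then show ?thesis using orbit_self by blast
    qed
    moreover have "\<Lambda> \<subseteq> \<Union> (orbit v ` \<Lambda>)" using orbit_self by blast
    ultimately show ?thesis using \<Lambda>'(2) by auto
  qed
  have clos: "closed \<Lambda>" using \<Lambda> closed_omega closed_alpha by (auto simp: F_def)
  have inv: "v s y \<in> \<Lambda>" if "y \<in> \<Lambda>" for s y
    using \<Lambda> that omega_invariant alpha_invariant by (auto simp: F_def)
  have sub: "omega_limit v y \<subseteq> \<Lambda>" "alpha_limit v y \<subseteq> \<Lambda>" if "y \<in> \<Lambda>" for y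
  proof -
    have "closure (orbit v y) \<subseteq> \<Lambda>" using inv[OF that] clos by (intro closure_minimal) (auto simp: orbit_def)
    then show "omega_limit v y \<subseteq> \<Lambda>" "alpha_limit v y \<subseteq> \<Lambda>"
      using omega_subset_closure_orbit alpha_subset_closure_orbit by blast+
  qed
  have min: "(\<exists>q\<in>Sd. omega_limit v y = {q}) \<or> omega_limit v y = \<Lambda>"
    "(\<exists>q\<in>Sd. alpha_limit v y = {q}) \<or> alpha_limit v y = \<Lambda>" if y: "y \<in> \<Lambda>" for y
  proof -
    have "y \<in> C u" using \<Lambda> y by (auto simp: F_def)
    then have "F (omega_limit v y) \<or> (\<exists>q\<in>Sd. omega_limit v y = {q})" "F (alpha_limit v y) \<or> (\<exists>q\<in>Sd. alpha_limit v y = {q})"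
      using sub[OF y] \<Lambda> by (auto simp: F_def)
    then show "(\<exists>q\<in>Sd. omega_limit v y = {q}) \<or> omega_limit v y = \<Lambda>"
      "(\<exists>q\<in>Sd. alpha_limit v y = {q}) \<or> alpha_limit v y = \<Lambda>"
      using eq sub[OF y] by blast+
  qed
  obtain x where x: "x \<in> C u" "\<Lambda> = omega_limit v x \<or> \<Lambda> = alpha_limit v x" using \<Lambda> by (auto simp: F_def)
  have px: "proper x" by (rule proper_C[OF u x(1)])
  have ns_\<Lambda>: "\<Lambda> \<noteq> {p}" if "p \<in> Sd" for p using \<Lambda> that by (auto simp: F_def)
  have ng_\<Lambda>: "\<not> generic y" if "y \<in> \<Lambda>" for y using \<Lambda> that by (auto simp: F_def)
  from x(2) show False
  proof
    assume "\<Lambda> = omega_limit v x"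
    then show False using minimal_limit_false[OF px] ns_\<Lambda> ng_\<Lambda> min by simp
  next
    assume "\<Lambda> = alpha_limit v x"
    then show False
      using saddle_R_closed.minimal_limit_false[OF saddle_R_closed_reverse, of x] px ns_\<Lambda> ng_\<Lambda> min
      by (simp add: omega_reverse alpha_reverse generic_reverse proper_reverse)
  qed
qed

text \<open>Every point of \<open>bwd p\<close> has u in its extended positive orbit, so its class
  contains y and, by symmetry, it lies in \<open>C y\<close>; likewise \<open>fwd p\<close> lies in
  \<open>C y'\<close>. Since u belongs to \<open>fwd p\<close>, also y lies in \<open>C y'\<close>,
  and the two generic classes coincide. Both u and s enter because the extended orbit of z spreads
  from p in both directions.\<close>

lemma saddle_generic_class:
  assumes p: "p \<in> Sd" and z: "omega_limit v z = {p} \<or> alpha_limit v z = {p}"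
    and u: "u \<in> fwd p" "\<And>q. q \<in> Sd \<Longrightarrow> omega_limit v u \<noteq> {q}"
    and s: "s \<in> bwd p" "\<And>q. q \<in> Sd \<Longrightarrow> alpha_limit v s \<noteq> {q}"
  shows "\<exists>y. generic y \<and> C z = C y"
proof -
  have E: "fwd w \<subseteq> C w" "bwd w \<subseteq> C w" for w using ext_subset_C by (auto simp: ext_def)
  have "proper p" using omega_Sd[OF p] p by (intro nongeneric_proper) (auto simp: generic_def)
  then have us: "proper u" "proper s" using u(1) s(1) E proper_C by blast+
  obtain y where y: "y \<in> omega_limit v u" "generic y" using generic_in_omega[OF us(1) u(2)] by blast
  obtain y' where y': "y' \<in> alpha_limit v s" "generic y'"
    using saddle_R_closed.generic_in_omega[OF saddle_R_closed_reverse, of s] us(2) s(2)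
    by (auto simp: omega_reverse generic_reverse proper_reverse)
  have fw: "fwd p \<subseteq> C y'"
  proof
    fix x assume "x \<in> fwd p"
    then have "s \<in> bwd x" using s(1) fwd_trans by (simp add: bwd_iff)
    then have "y' \<in> C x" using y'(1) E(2) alpha_subset_C by blast
    then show "x \<in> C y'" by (rule C_sym)
  qed
  have bw: "bwd p \<subseteq> C y"
  proof
    fix x assume "x \<in> bwd p"
    then have "u \<in> fwd x" using u(1) fwd_trans by (simp add: bwd_iff)
    then have "y \<in> C x" using y(1) E(1) omega_subset_C by blast
    then show "x \<in> C y" by (rule C_sym)
  qed
  have "y \<in> C y'" using u(1) fw y(1) omega_subset_C by blast
  then have yy: "C y = C y'" using C_generic_subset y(2) y'(2) C_sym by blast
  have "E z \<subseteq> C y"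
    using z
  proof
    assume om: "omega_limit v z = {p}"
    then have zb: "z \<in> bwd p"
      using p ext_fwd.sad[of p rv Sd p p z] saddle_flow.fwd_self[OF saddle_flow_reverse]
      by (simp add: omega_reverse alpha_reverse alpha_Sd)
    then have "bwd z \<subseteq> bwd p" using saddle_flow.fwd_trans[OF saddle_flow_reverse] by blast
    moreover have "fwd z \<subseteq> C y" using fwd_saddle[OF p om] zb bw fw yy C_invariant by blast
    ultimately show ?thesis using bw by (auto simp: ext_def)
  next
    assume al: "alpha_limit v z = {p}"
    then have zf: "z \<in> fwd p" using p ext_fwd.sad[of p v Sd p p z] fwd_self by (simp add: omega_Sd)
    then have "fwd z \<subseteq> fwd p" using fwd_trans by blast
    moreover have "bwd z \<subseteq> C y"
      using saddle_flow.fwd_saddle[OF saddle_flow_reverse p, of z, unfolded omega_reverse, OF al]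
        zf bw fw yy C_invariant by blast
    ultimately show ?thesis using fw yy by (auto simp: ext_def)
  qed
  then have sub: "C z \<subseteq> C y" unfolding cl_ext_def[of v Sd z] by (rule closure_minimal[OF _ closed_C])
  then have "y \<in> C z" using C_self C_sym by blast
  then show ?thesis using sub C_generic_subset[OF y(2)] y(2) by blast
qed

lemma nongeneric_class:
  assumes "\<not> generic z"
  shows "(\<forall>x\<in>C z. \<not> generic x \<and> C x = C z) \<or> (\<exists>y. generic y \<and> C z = C y)"
proof -
  obtain p where p: "p \<in> Sd" and z: "omega_limit v z = {p} \<or> alpha_limit v z = {p}"
    using assms by (auto simp: generic_def)
  interpret rev: saddle_R_closed rv Sd by (rule saddle_R_closed_reverse)
  consider "\<forall>x\<in>fwd p. \<exists>q\<in>Sd. omega_limit v x = {q}" | "\<forall>x\<in>bwd p. \<exists>q\<in>Sd. alpha_limit v x = {q}"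
    | u s where "u \<in> fwd p" "\<forall>q\<in>Sd. omega_limit v u \<noteq> {q}" "s \<in> bwd p" "\<forall>q\<in>Sd. alpha_limit v s \<noteq> {q}" by blast
  then show ?thesis
  proof cases
    case 1
    note F = finite_type_forward[OF p 1[rule_format]]
    have "z \<in> fwd p" using F(1) z by (auto simp: stable_set_def unstable_set_def)
    then show ?thesis using F(2,3) by simp
  next
    case 2
    have ft: "x \<in> bwd p \<Longrightarrow> \<exists>q\<in>Sd. omega_limit rv x = {q}" for x using 2 by (simp add: omega_reverse)
    note F = rev.finite_type_forward[OF p ft]
    have "z \<in> bwd p" using F(1) z by (auto simp: stable_set_def unstable_set_def omega_reverse alpha_reverse)
    then show ?thesis using F(2,3) by (simp add: cl_ext_reverse generic_reverse)
  next
    case (3 u s)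
    then show ?thesis using saddle_generic_class[OF p z] by blast
  qed
qed

text \<open>A class belongs to a generic point or consists of nongeneric points that all have this
  class. A point y of a generic class \<open>C w\<close> cannot have a class of the second kind,
  since w lies in \<open>C y\<close> by symmetry.\<close>

lemma C_eq:
  assumes "y \<in> C x"
  shows "C y = C x"
proof -
  have gen: "C y = C w" if w: "generic w" "y \<in> C w" for w
  proof -
    have wy: "w \<in> C y" by (rule C_sym[OF w(2)])
    have "\<exists>w'. generic w' \<and> C y = C w'"
      using nongeneric_class[of y] wy w(1) by blast
    then obtain w' where w': "generic w'" "C y = C w'" by blast
    then have "w \<in> C w'" "w' \<in> C w" using wy C_sym by auto
    then show ?thesis using C_generic_subset w(1) w' by blast
  qed
  show ?thesis
  proof (cases "\<exists>w. generic w \<and> C x = C w")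
    case True
    then show ?thesis using gen assms by auto
  next
    case False
    then show ?thesis using nongeneric_class[of x] assms by blast
  qed
qed

end

section \<open>Transfinite iteration and the main theorem\<close>

lemma ord_iterate_subset:
  assumes r: "Well_order r" and A: "A \<subseteq> B" and F: "\<And>X. X \<subseteq> B \<Longrightarrow> F X \<subseteq> B"
  shows "ord_iterate r F A i \<subseteq> B"
proof (induction i rule: wf_induct_rule[OF conjunct2[OF r[unfolded well_order_on_def]]])
  case less: (1 i)
  consider (zero) "\<forall>j. (j, i) \<notin> r - Id" | (suc) j where "immediate_pred r j i"
    | (limit) j where "(j, i) \<in> r - Id" "\<nexists>j. immediate_pred r j i" by blast
  then show ?case
  proof cases
    case zero
    show ?thesis unfolding ord_iterate_zero[OF r zero] by (rule A)
  next
    case (suc j)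
    then have "(j, i) \<in> r - Id" by (simp add: immediate_pred_def)
    then show ?thesis unfolding ord_iterate_succ[OF r suc] by (intro F less.IH)
  next
    case (limit j)
    show ?thesis unfolding ord_iterate_limit[OF r limit] using less.IH by (intro UN_least) simp
  qed
qed

text \<open>Finite stages exhaust the iteration, so only the order type of the natural numbers is realised.\<close>

lemma ord_iterate_natLeq:
  fixes e :: "nat \<Rightarrow> 'i"
  assumes e: "inj e"
  shows "Well_order (dir_image natLeq e)" "ord_iterate (dir_image natLeq e) F A (e n) = (F ^^ n) A"
proof -
  let ?r = "dir_image natLeq e"
  show r: "Well_order ?r" by (intro Well_order_dir_image natLeq_Well_order inj_on_subset[OF e]) simp
  have less: "(y, e i) \<in> ?r - Id \<longleftrightarrow> (\<exists>j<i. y = e j)" for y i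
    using inj_eq[OF e] by (auto simp: dir_image_def natLeq_def)
  show "ord_iterate ?r F A (e n) = (F ^^ n) A"
  proof (induction n)
    case 0
    have "\<forall>y. (y, e 0) \<notin> ?r - Id" unfolding less by simp
    from ord_iterate_zero[OF r this, of F A] show ?case by simp
  next
    case (Suc n)
    have "\<not> ((e n, k) \<in> ?r - Id \<and> (k, e (Suc n)) \<in> ?r - Id)" for k
    proof
      assume k: "(e n, k) \<in> ?r - Id \<and> (k, e (Suc n)) \<in> ?r - Id"
      obtain j where j: "j < Suc n" "k = e j" using k[THEN conjunct2, unfolded less] by (elim exE conjE) (rule that)
      have "(e n, e j) \<in> ?r - Id" using k[THEN conjunct1] unfolding j(2) .
      then obtain i where "i < j" "e n = e i" unfolding less by (elim exE conjE) (rule that)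
      then show False using j(1) by (simp add: inj_eq[OF e])
    qed
    moreover have "(e n, e (Suc n)) \<in> ?r - Id" unfolding less by (intro exI[of _ n]) simp
    ultimately have "immediate_pred ?r (e n) (e (Suc n))" unfolding immediate_pred_def by simp
    from ord_iterate_succ[OF r this, of F A] show ?case using Suc by simp
  qed
qed

lemma ord_iterate_subset_union:
  fixes r :: "'a set rel" and F :: "'a set \<Rightarrow> 'a set"
  assumes "Well_order r" "i \<in> Field r"
  shows "ord_iterate r F A i \<subseteq> ord_iterates_union F A"
  unfolding ord_iterates_union_def using assms by blast

text \<open>The upper bound holds along every well-order. For the lower bound, an infinite type
  provides a sequence in \<open>'a set\<close> that is well-ordered like the natural numbers; if B
  is contained in A, the zero stage of a one-point well-order is enough.\<close>

lemma ord_iterates_union_eq: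
  fixes F :: "'a set \<Rightarrow> 'a set"
  assumes "A \<subseteq> B" "\<And>X. X \<subseteq> B \<Longrightarrow> F X \<subseteq> B" "B \<subseteq> (\<Union>n. (F ^^ n) A)" "infinite (UNIV :: 'a set) \<or> B \<subseteq> A"
  shows "ord_iterates_union F A = B"
proof
  show "ord_iterates_union F A \<subseteq> B"
    unfolding ord_iterates_union_def by (intro UN_least ord_iterate_subset assms(1,2)) auto
  show "B \<subseteq> ord_iterates_union F A"
  proof (cases "B \<subseteq> A")
    case True
    let ?r = "{({} :: 'a set, {})}"
    have r: "Well_order ?r"
      by (simp add: well_order_on_def linear_order_on_def partial_order_on_def preorder_on_def refl_on_def
          trans_def antisym_def total_on_def wf_def)
    have "ord_iterate ?r F A {} = A" by (rule ord_iterate_zero[OF r]) auto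
    then show ?thesis using True ord_iterate_subset_union[OF r, of "{}" F A] by (simp add: Field_def)
  next
    case False
    then have "infinite (UNIV :: 'a set set)" using assms(4) by (simp add: Finite_Set.finite_set)
    then obtain e :: "nat \<Rightarrow> 'a set" where e: "inj e" using infinite_countable_subset by blast
    have Field: "e n \<in> Field (dir_image natLeq e)" for n by (auto simp: Field_def dir_image_def natLeq_def)
    have "(F ^^ n) A \<subseteq> ord_iterates_union F A" for n
      using ord_iterate_subset_union[OF ord_iterate_natLeq(1)[OF e] Field] unfolding ord_iterate_natLeq(2)[OF e] .
    then show ?thesis using assms(3) by blast
  qed
qed

definition ext_step :: "(real \<Rightarrow> 'a \<Rightarrow> 'a::topological_space) \<Rightarrow> 'a set \<Rightarrow> 'a set \<Rightarrow> 'a set" where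
  "ext_step v Sd A = A \<union> \<Union>{unstable_set v p | p. p \<in> Sd \<and> (\<exists>x'\<in>A. omega_limit v x' = {p})}"

text \<open>An element of the inductive set is derived in finitely many steps, so it appears at a
  finite stage.\<close>

lemma ord_iterates_union_ext_step:
  fixes v :: "real \<Rightarrow> 'a \<Rightarrow> 'a::topological_space"
  assumes "infinite (UNIV :: 'a set) \<or> Sd = {}"
  shows "ord_iterates_union (ext_step v Sd) (pos_orbit v x) = ext_fwd v Sd x"
proof (rule ord_iterates_union_eq)
  show "pos_orbit v x \<subseteq> ext_fwd v Sd x" by (auto simp: pos_orbit_def intro: ext_fwd.orb)
  show "ext_step v Sd X \<subseteq> ext_fwd v Sd x" if "X \<subseteq> ext_fwd v Sd x" for X
    using that by (auto simp: ext_step_def unstable_set_def intro: ext_fwd.sad)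
  show "ext_fwd v Sd x \<subseteq> (\<Union>n. (ext_step v Sd ^^ n) (pos_orbit v x))"
  proof
    fix z assume "z \<in> ext_fwd v Sd x"
    then show "z \<in> (\<Union>n. (ext_step v Sd ^^ n) (pos_orbit v x))"
    proof induction
      case (orb t)
      then have "v t x \<in> (ext_step v Sd ^^ 0) (pos_orbit v x)" by (auto simp: pos_orbit_def)
      then show ?case by blast
    next
      case (sad x' p z)
      then obtain n where "x' \<in> (ext_step v Sd ^^ n) (pos_orbit v x)" by blast
      then have "z \<in> (ext_step v Sd ^^ Suc n) (pos_orbit v x)"
        using sad.hyps unfolding funpow.simps o_apply ext_step_def unstable_set_def by blast
      then show ?case by blast
    qed
  qed
  have "z \<in> pos_orbit v x" if "z \<in> ext_fwd v Sd x" "Sd = {}" for z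
    using that by induction (auto simp: pos_orbit_def)
  then show "infinite (UNIV :: 'a set) \<or> ext_fwd v Sd x \<subseteq> pos_orbit v x" using assms by blast
qed

text \<open>A neighbourhood of the saddle is homeomorphic to a nonempty open set of the plane. Hence
  the iteration has room for all finite stages whenever a saddle is present.\<close>

lemma saddle_infinite:
  fixes v :: "real \<Rightarrow> 'a \<Rightarrow> 'a::topological_space"
  assumes "saddle v p"
  shows "infinite (UNIV :: 'a set)"
proof
  assume fin: "finite (UNIV :: 'a set)"
  obtain w :: "real \<Rightarrow> real^2 \<Rightarrow> real^2" and q where "locally_orbit_equivalent v p w q"
    using assms unfolding saddle_def by (elim conjE exE) (rule that)
  then obtain U h k and V :: "(real^2) set" where U: "homeomorphism U V h k" "open V" "p \<in> U"
    unfolding locally_orbit_equivalent_def by blast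
  have "V = h ` U" using homeomorphism_image1[OF U(1)] by simp
  moreover have "finite U" by (rule finite_subset[OF subset_UNIV fin])
  ultimately have "V = {}" using finite_imp_not_open[of V] U(2) by simp
  then show False using \<open>V = h ` U\<close> U(3) by simp
qed

lemma (in compact_flow) ext_orbit_eq: "ext_orbit v x = ext v {p. saddle v p} x"
proof -
  let ?Sd = "{p. saddle v p}"
  have inf: "infinite (UNIV :: 'a set) \<or> ?Sd = {}" using saddle_infinite by blast
  have "pos_step v = ext_step v ?Sd" by (simp add: fun_eq_iff pos_step_def ext_step_def)
  moreover have "neg_step v = ext_step (\<lambda>t. v (- t)) ?Sd"
    by (simp add: fun_eq_iff neg_step_def ext_step_def stable_set_def unstable_set_def omega_reverse alpha_reverse)
  moreover have "neg_orbit v x = pos_orbit (\<lambda>t. v (- t)) x"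
    unfolding neg_orbit_def pos_orbit_def by (metis minus_minus neg_0_le_iff_le)
  ultimately show ?thesis
    unfolding ext_orbit_def ext_pos_orbit_def ext_neg_orbit_def ext_def
    by (simp add: ord_iterates_union_ext_step[OF inf])
qed

theorem lemma4p1:
  fixes v :: "real \<Rightarrow> 'a::t2_space \<Rightarrow> 'a"
  assumes "compact_surface TYPE('a)"
    and "flow v"
    and "extended_R_closed v"
  shows "extended_pap v"
proof -
  let ?Sd = "{p. saddle v p}"
  interpret compact_flow v
    using assms(1,2) by unfold_locales (auto simp: compact_surface_def)
  have C: "closure (ext_orbit v x) = cl_ext v ?Sd x" for x by (simp add: ext_orbit_eq cl_ext_def)
  interpret saddle_R_closed v ?Sd
  proof
    show "\<exists>U \<psi>. saddle_box v p U \<psi>" if "p \<in> ?Sd" for p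
      using saddle_imp_saddle_box[OF assms(2)] that by simp
    show "closed {(x, y). y \<in> cl_ext v ?Sd x}" using assms(3) by (simp add: extended_R_closed_def C)
  qed
  \<comment> \<open>Two classes sharing a point both equal the class of that point.\<close>
  have "disjnt (cl_ext v ?Sd x) (cl_ext v ?Sd y)" if "cl_ext v ?Sd x \<noteq> cl_ext v ?Sd y" for x y
    using C_eq that unfolding disjnt_iff by metis
  then show ?thesis
    unfolding extended_pap_def partition_on_def C disjoint_def disjnt_def using C_self by fast
qed

end
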